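(* Let $X$ be the set of all finite non-zero order-types $\{\mathbf{1},\mathbf{2},\mathbf{3},\dots\}$, and let $C\subseteq\mathbb{N}$ be a co-c.e. cohesive set. Then there is a computable linear order $\mathcal{M}$ of order-type $\omega$ such that the cohesive power $\Pi_C\mathcal{M}$ has order-type $\omega+\boldsymbol{\sigma}(X\cup\{\alpha\})$, where $\alpha=\omega+\zeta\eta+\omega^*$.
   Context: A set $C\subseteq\mathbb{N}$ is cohesive if it is infinite and for every c.e. set $W$, either $C\setminus W$ or $C\cap W$ is finite; co-c.e. means $\mathbb{N}\setminus C$ is c.e. Write $X\subseteq^* Y$ if $X\setminus Y$ is finite. For a computable linear order $\mathcal{L}=(L,\prec_{\mathcal{L}})$, the cohesive power $\Pi_C\mathcal{L}$ has as elements the classes $[\varphi]$ of partial computable $\varphi\colon\mathbb{N}\to L$ with $C\subseteq^*\mathrm{dom}(\varphi)$ under $\varphi=_C\psi$ iff $C\subseteq^*\{x:\varphi(x)\downarrow=\psi(x)\downarrow\}$, ordered by $[\varphi]\prec[\psi]$ iff $C\subseteq^*\{x:\varphi(x)\downarrow,\psi(x)\downarrow,\varphi(x)\prec_{\mathcal{L}}\psi(x)\}$. $\mathbf{k}$ is the order-type of a $k$-element linear order; $\omega,\zeta,\eta$ are the order-types of $\mathbb{N},\mathbb{Z},\mathbb{Q}$; $\omega^*$ is the reverse of $\omega$; $\zeta\eta$ is $\eta$-many copies of $\zeta$ ordered lexicographically. Shuffle: for a non-empty at most countable set $X$ of order-types, choose a coloring of $\mathbb{Q}$ with $|X|$ colors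 each of which is dense in $\mathbb{Q}$, assign distinct colors to members of $X$, and replace each rational by a copy of the order-type assigned to its color; the resulting order-type is $\boldsymbol{\sigma}(X)$. *)

theory Defs
  imports Complex_Main "HOL-Library.Nat_Bijection" "HOL-Library.Countable_Set"
begin

section \<open>Partial computable functions\<close>

definition minimization :: "(nat \<Rightarrow> nat option) \<Rightarrow> nat option" where
  "minimization p =
     (if \<exists>n. p n = Some 0 \<and> (\<forall>m<n. p m \<noteq> None) then Some (LEAST n. p n = Some 0) else None)"

text \<open>
  The partial recursive functions, presented as unary functions: tuples of arguments are coded
  by the Cantor pairing function \<^const>\<open>prod_encode\<close>, whose projections are initial functions.
\<close>

inductive partial_computable :: "(nat \<Rightarrow> nat option) \<Rightarrow> bool" where
  zero: "partial_computable (\<lambda>_. Some 0)"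
| succ: "partial_computable (\<lambda>x. Some (Suc x))"
| left: "partial_computable (\<lambda>x. Some (fst (prod_decode x)))"
| right: "partial_computable (\<lambda>x. Some (snd (prod_decode x)))"
| pair: "partial_computable f \<Longrightarrow> partial_computable g \<Longrightarrow>
    partial_computable (\<lambda>x. Option.bind (f x) (\<lambda>y. Option.bind (g x) (\<lambda>z. Some (prod_encode (y, z)))))"
| comp: "partial_computable f \<Longrightarrow> partial_computable g \<Longrightarrow>
    partial_computable (\<lambda>x. Option.bind (g x) f)"
| prim_rec: "partial_computable f \<Longrightarrow> partial_computable g \<Longrightarrow>
    partial_computable (\<lambda>x. case prod_decode x of (a, m) \<Rightarrow>
      rec_nat (f a) (\<lambda>n r. Option.bind r (\<lambda>y. g (prod_encode (a, prod_encode (n, y))))) m)"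
| minim: "partial_computable f \<Longrightarrow>
    partial_computable (\<lambda>x. minimization (\<lambda>n. f (prod_encode (x, n))))"

definition computable :: "(nat \<Rightarrow> nat) \<Rightarrow> bool" where
  "computable f \<longleftrightarrow> partial_computable (\<lambda>x. Some (f x))"

definition computable_set :: "nat set \<Rightarrow> bool" where
  "computable_set A \<longleftrightarrow> computable (\<lambda>x. if x \<in> A then 1 else 0)"

definition ce :: "nat set \<Rightarrow> bool" where
  "ce W \<longleftrightarrow> (\<exists>\<phi>. partial_computable \<phi> \<and> W = dom \<phi>)"

definition co_ce :: "nat set \<Rightarrow> bool" where
  "co_ce A \<longleftrightarrow> ce (UNIV - A)"

definition cohesive :: "nat set \<Rightarrow> bool" where
  "cohesive C \<longleftrightarrow> infinite C \<and> (\<forall>W. ce W \<longrightarrow> finite (C - W) \<or> finite (C \<inter> W))"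

definition almost_subset :: "nat set \<Rightarrow> nat set \<Rightarrow> bool"  (infix \<open>\<subseteq>\<^sup>*\<close> 50) where
  "X \<subseteq>\<^sup>* Y \<longleftrightarrow> finite (X - Y)"

section \<open>Linear orders\<close>

text \<open>An order is given by its carrier and its \<^emph>\<open>strict\<close> order relation.\<close>

type_synonym 'a order = "'a set \<times> 'a rel"

definition linear_ord :: "'a order \<Rightarrow> bool" where
  "linear_ord P \<longleftrightarrow> snd P \<subseteq> fst P \<times> fst P \<and> strict_linear_order_on (fst P) (snd P)"

definition order_iso :: "'a order \<Rightarrow> 'b order \<Rightarrow> bool" where
  "order_iso P Q \<longleftrightarrow> (\<exists>f. bij_betw f (fst P) (fst Q) \<and>
     (\<forall>x\<in>fst P. \<forall>y\<in>fst P. (x, y) \<in> snd P \<longleftrightarrow> (f x, f y) \<in> snd Q))"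

definition computable_linear_order :: "nat order \<Rightarrow> bool" where
  "computable_linear_order P \<longleftrightarrow>
     linear_ord P \<and> computable_set (fst P) \<and> computable_set (prod_encode ` snd P)"

definition order_on :: "'a::linorder set \<Rightarrow> 'a order" where
  "order_on A = (A, {(x, y). x \<in> A \<and> y \<in> A \<and> x < y})"

definition reverse_order :: "'a order \<Rightarrow> 'a order" where
  "reverse_order P = (fst P, (snd P)\<inverse>)"

text \<open>Replace every point \<open>i\<close> of \<open>I\<close> by a copy of \<open>F i\<close>.\<close>

definition lex_sum :: "'i order \<Rightarrow> ('i \<Rightarrow> 'a order) \<Rightarrow> ('i \<times> 'a) order" where
  "lex_sum I F =
     (SIGMA i:fst I. fst (F i),
      {((i, x), (j, y)). i \<in> fst I \<and> j \<in> fst I \<and> x \<in> fst (F i) \<and> y \<in> fst (F j) \<and>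
         ((i, j) \<in> snd I \<or> i = j \<and> (x, y) \<in> snd (F i))})"

section \<open>Order-types\<close>

text \<open>
  Only at most countable order-types occur.  Such an order-type is represented by the set of all
  linear orders with carrier included in \<^typ>\<open>nat\<close> that realise it, which makes it independent
  of the type of the elements.
\<close>

type_synonym otype = "nat order set"

definition order_type :: "'a order \<Rightarrow> otype" where
  "order_type P = {Q. linear_ord Q \<and> order_iso P Q}"

definition has_order_type :: "'a order \<Rightarrow> otype \<Rightarrow> bool" where
  "has_order_type P \<tau> \<longleftrightarrow> (\<exists>Q\<in>\<tau>. order_iso P Q)"

definition rep :: "otype \<Rightarrow> nat order" where
  "rep \<tau> = (SOME Q. Q \<in> \<tau>)"

lemma order_iso_refl: "order_iso P P"
  unfolding order_iso_def by (rule exI[of _ id]) auto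

lemma order_iso_sym:
  assumes "order_iso P Q" shows "order_iso Q P"
proof -
  obtain f where f: "bij_betw f (fst P) (fst Q)"
    "\<And>x y. x \<in> fst P \<Longrightarrow> y \<in> fst P \<Longrightarrow> (x, y) \<in> snd P \<longleftrightarrow> (f x, f y) \<in> snd Q"
    using assms unfolding order_iso_def by blast
  let ?g = "the_inv_into (fst P) f"
  have g: "bij_betw ?g (fst Q) (fst P)" using f(1) by (rule bij_betw_the_inv_into)
  have "(x, y) \<in> snd Q \<longleftrightarrow> (?g x, ?g y) \<in> snd P" if xy: "x \<in> fst Q" "y \<in> fst Q" for x y
  proof -
    have "?g x \<in> fst P" "?g y \<in> fst P" using bij_betwE[OF g] xy by blast+
    moreover have "f (?g x) = x" "f (?g y) = y"
      using f_the_inv_into_f_bij_betw[OF f(1)] xy by blast+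
    ultimately show ?thesis using f(2)[of "?g x" "?g y"] by simp
  qed
  with g show ?thesis unfolding order_iso_def by blast
qed

lemma order_iso_trans:
  assumes "order_iso P Q" "order_iso Q R" shows "order_iso P R"
proof -
  obtain f where f: "bij_betw f (fst P) (fst Q)"
    "\<And>x y. x \<in> fst P \<Longrightarrow> y \<in> fst P \<Longrightarrow> (x, y) \<in> snd P \<longleftrightarrow> (f x, f y) \<in> snd Q"
    using assms(1) unfolding order_iso_def by blast
  obtain g where g: "bij_betw g (fst Q) (fst R)"
    "\<And>x y. x \<in> fst Q \<Longrightarrow> y \<in> fst Q \<Longrightarrow> (x, y) \<in> snd Q \<longleftrightarrow> (g x, g y) \<in> snd R"
    using assms(2) unfolding order_iso_def by blast
  have "bij_betw (g \<circ> f) (fst P) (fst R)" using f(1) g(1) by (rule bij_betw_trans)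
  moreover have "(x, y) \<in> snd P \<longleftrightarrow> ((g \<circ> f) x, (g \<circ> f) y) \<in> snd R"
    if "x \<in> fst P" "y \<in> fst P" for x y
    using that f(2) g(2) bij_betwE[OF f(1)] by simp
  ultimately show ?thesis unfolding order_iso_def by blast
qed

lemma order_type_nonempty:
  assumes "linear_ord P" "countable (fst P)"
  shows "order_type P \<noteq> {}"
proof -
  obtain f :: "'a \<Rightarrow> nat" where inj: "inj_on f (fst P)"
    using assms(2) by (auto simp: countable_def)
  define r where "r = {(f x, f y) | x y. (x, y) \<in> snd P}"
  have lin: "snd P \<subseteq> fst P \<times> fst P" "trans (snd P)" "irrefl (snd P)" "total_on (fst P) (snd P)"
    using assms(1) by (simp_all add: linear_ord_def strict_linear_order_on_def)
  have sub: "x \<in> fst P \<and> y \<in> fst P" if "(x, y) \<in> snd P" for x y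
    using that lin(1) by blast
  have iff: "(f x, f y) \<in> r \<longleftrightarrow> (x, y) \<in> snd P" if "x \<in> fst P" "y \<in> fst P" for x y
  proof
    assume "(f x, f y) \<in> r"
    then obtain x' y' where *: "(x', y') \<in> snd P" "f x = f x'" "f y = f y'"
      unfolding r_def by blast
    then have "x = x'" "y = y'" using that sub inj by (meson inj_onD)+
    with * show "(x, y) \<in> snd P" by simp
  qed (auto simp: r_def)
  have s: "\<exists>x\<in>fst P. \<exists>y\<in>fst P. a = f x \<and> b = f y \<and> (x, y) \<in> snd P" if "(a, b) \<in> r" for a b
    using that sub unfolding r_def by blast
  have "trans r"
  proof (rule transI)
    fix a b c assume "(a, b) \<in> r" "(b, c) \<in> r"
    then obtain x y y' z where *: "(x, y) \<in> snd P" "(y', z) \<in> snd P"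
      "a = f x" "b = f y" "b = f y'" "c = f z" unfolding r_def by blast
    then have "y = y'" using sub inj by (metis inj_onD)
    with * have "(x, z) \<in> snd P" using lin(2) by (meson transD)
    with * show "(a, c) \<in> r" unfolding r_def by blast
  qed
  moreover have "irrefl r"
  proof (rule irreflI)
    fix a show "(a, a) \<notin> r"
    proof
      assume "(a, a) \<in> r"
      then obtain x y where "(x, y) \<in> snd P" "f x = f y" unfolding r_def by force
      then have "(x, x) \<in> snd P" using sub inj by (metis inj_onD)
      then show False using lin(3) by (simp add: irrefl_def)
    qed
  qed
  moreover have "total_on (f ` fst P) r"
    using lin(4) iff by (auto simp: total_on_def)
  moreover have "r \<subseteq> f ` fst P \<times> f ` fst P"
    using s by (intro subrelI) blast
  ultimately have "linear_ord (f ` fst P, r)"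
    by (simp add: linear_ord_def strict_linear_order_on_def)
  moreover have "order_iso P (f ` fst P, r)"
    unfolding order_iso_def fst_conv snd_conv
    using inj_on_imp_bij_betw[OF inj] iff by blast
  ultimately show ?thesis by (auto simp: order_type_def)
qed

lemma order_type_eq_iff:
  assumes "linear_ord P" "countable (fst P)"
  shows "order_type P = order_type Q \<longleftrightarrow> order_iso P Q"
proof
  assume eq: "order_type P = order_type Q"
  obtain R where R: "R \<in> order_type P" using order_type_nonempty[OF assms] by blast
  with eq have "order_iso P R" "order_iso Q R" by (auto simp: order_type_def)
  then show "order_iso P Q" by (meson order_iso_trans order_iso_sym)
next
  assume PQ: "order_iso P Q"
  have "order_iso P R \<longleftrightarrow> order_iso Q R" for R :: "nat order"
    using order_iso_trans[OF PQ, of R] order_iso_trans[OF order_iso_sym[OF PQ], of R] by blast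
  then show "order_type P = order_type Q" by (simp add: order_type_def)
qed

lemma order_iso_rep:
  assumes "linear_ord P" "countable (fst P)"
  shows "order_iso P (rep (order_type P))"
proof -
  have "rep (order_type P) \<in> order_type P"
    unfolding rep_def using order_type_nonempty[OF assms] by (meson ex_in_conv someI_ex)
  then show ?thesis by (simp add: order_type_def)
qed

lemma has_order_type_iff:
  assumes "linear_ord Q" "countable (fst Q)"
  shows "has_order_type P (order_type Q) \<longleftrightarrow> order_iso P Q"
proof
  assume "has_order_type P (order_type Q)"
  then obtain R :: "nat order" where "order_iso P R" "order_iso Q R"
    unfolding has_order_type_def order_type_def by blast
  then show "order_iso P Q" by (meson order_iso_trans order_iso_sym)
next
  assume PQ: "order_iso P Q"
  obtain R where R: "R \<in> order_type Q" using order_type_nonempty[OF assms] by blast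
  then have "order_iso Q R" by (simp add: order_type_def)
  then have "order_iso P R" by (rule order_iso_trans[OF PQ])
  with R show "has_order_type P (order_type Q)" by (auto simp: has_order_type_def)
qed

definition finite_type :: "nat \<Rightarrow> otype" where
  "finite_type k = order_type (order_on {..<k})"

definition omega :: otype where
  "omega = order_type (order_on (UNIV :: nat set))"

definition zeta :: otype where
  "zeta = order_type (order_on (UNIV :: int set))"

definition eta :: otype where
  "eta = order_type (order_on (UNIV :: rat set))"

definition reverse_type :: "otype \<Rightarrow> otype" where
  "reverse_type \<tau> = order_type (reverse_order (rep \<tau>))"

definition plus_type :: "otype \<Rightarrow> otype \<Rightarrow> otype"  (infixl \<open>\<oplus>\<close> 65) where
  "\<sigma> \<oplus> \<tau> =
     order_type (lex_sum (order_on (UNIV :: bool set)) (\<lambda>b. if b then rep \<tau> else rep \<sigma>))"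

text \<open>\<open>\<sigma> \<odot> \<tau>\<close> is \<open>\<tau>\<close>-many copies of \<open>\<sigma>\<close>.\<close>

definition times_type :: "otype \<Rightarrow> otype \<Rightarrow> otype"  (infixl \<open>\<odot>\<close> 70) where
  "\<sigma> \<odot> \<tau> = order_type (lex_sum (rep \<tau>) (\<lambda>_. rep \<sigma>))"

text \<open>The members of \<open>X\<close> themselves serve as the colors of the rationals.\<close>

definition dense_coloring :: "otype set \<Rightarrow> (rat \<Rightarrow> otype) \<Rightarrow> bool" where
  "dense_coloring X c \<longleftrightarrow>
     range c = X \<and> (\<forall>\<tau>\<in>X. \<forall>a b. a < b \<longrightarrow> (\<exists>q. a < q \<and> q < b \<and> c q = \<tau>))"

text \<open>
  For non-empty, at most countable \<open>X\<close> a dense coloring exists, and by back-and-forth the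
  result does not depend on which one is chosen.
\<close>

definition shuffle :: "otype set \<Rightarrow> otype" where
  "shuffle X =
     order_type (lex_sum (order_on UNIV) (\<lambda>q. rep ((SOME c. dense_coloring X c) q)))"

section \<open>Cohesive powers\<close>

definition power_funs :: "nat set \<Rightarrow> nat order \<Rightarrow> (nat \<Rightarrow> nat option) set" where
  "power_funs C L = {\<phi>. partial_computable \<phi> \<and> ran \<phi> \<subseteq> fst L \<and> C \<subseteq>\<^sup>* dom \<phi>}"

definition power_eq :: "nat set \<Rightarrow> nat order \<Rightarrow> (nat \<Rightarrow> nat option) rel" where
  "power_eq C L = {(\<phi>, \<psi>). \<phi> \<in> power_funs C L \<and> \<psi> \<in> power_funs C L \<and>
     C \<subseteq>\<^sup>* {x. \<exists>a. \<phi> x = Some a \<and> \<psi> x = Some a}}"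

definition cohesive_power :: "nat set \<Rightarrow> nat order \<Rightarrow> (nat \<Rightarrow> nat option) set order" where
  "cohesive_power C L =
     (power_funs C L // power_eq C L,
      {(power_eq C L `` {\<phi>}, power_eq C L `` {\<psi>}) | \<phi> \<psi>.
         \<phi> \<in> power_funs C L \<and> \<psi> \<in> power_funs C L \<and>
         C \<subseteq>\<^sup>* {x. \<exists>a b. \<phi> x = Some a \<and> \<psi> x = Some b \<and> (a, b) \<in> snd L}})"

end

theory Submission
  imports Defs
begin

text \<open>
  The order \<open>M\<close> consists of finite blocks placed at rational positions, with finitely many blocks in each
  unit interval, so it has order-type \<open>\<omega>\<close>.  Every program \<open>e\<close> may request, on input \<open>n\<close>, a block of
  a given size in a given dyadic interval around level \<open>r\<close>; the request is granted once it is seen that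
  \<open>e \<le> |C\<^sub>w \<inter> {..<n}| \<le> 2 r\<close>, where \<open>C\<^sub>w\<close> is the stage \<open>w\<close> approximation of the co-c.e. set \<open>C\<close>.
  As \<open>C\<close> is infinite, only finitely many requests are granted at each level.  Conversely an unbounded
  partial computable function is eventually injective on \<open>C\<close> and hence grows at least like half the
  counting function of \<open>C\<close>, so every request whose level tends to infinity is granted for almost
  all \<open>n \<in> C\<close>.  Therefore the blocks in the nonstandard part of the power form a dense order without
  endpoints in which every finite size and every nonstandard size is dense.  A block of nonstandard
  size is an initial segment \<open>\<omega> + \<zeta>\<eta> + \<omega>\<^sup>*\<close> of the cohesive power of \<open>\<omega>\<close>, and by back-and-forth
  the dense arrangement is the shuffle.
\<close>

section \<open>Computable functions and decidable predicates\<close>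

text \<open>Two demands conflict: type omega leaves room for only finitely many blocks per level,
  yet every request along C whose level tends to infinity has to be met, however slowly that level
  grows. The counting function of C is the yardstick that reconciles them. C is co-c.e., so its
  values are limits of computable upper bounds, and the test against \<open>2 r\<close> becomes a
  search for a stage. Among k distinct values of a germ one is at least k - 1, which ties its growth
  to the number of points of C past the threshold of injectivity; the factor 2 absorbs the points
  before that threshold. A label contains both the halting computation and the stage, which makes
  the set of granted requests decidable and not merely c.e. On the side of the power the main tool
  is a dichotomy: a semidecidable property of a germ holds almost everywhere on C or fails almost
  everywhere on C. It makes every germ constant or divergent along C, and this separates the initial
  omega from the rest and the finite blocks from those of type alpha.\<close>

abbreviation p1 :: "nat \<Rightarrow> nat" where "p1 z \<equiv> fst (prod_decode z)"
abbreviation p2 :: "nat \<Rightarrow> nat" where "p2 z \<equiv> snd (prod_decode z)"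

lemma computable_compose:
  assumes "computable f" "computable g"
  shows "computable (\<lambda>x. f (g x))"
  using partial_computable.comp[of "\<lambda>x. Some (f x)" "\<lambda>x. Some (g x)"] assms
  by (simp add: computable_def)

named_theorems computable_intros

lemma computable_p1 [computable_intros]: "computable f \<Longrightarrow> computable (\<lambda>x. p1 (f x))"
  and computable_p2 [computable_intros]: "computable f \<Longrightarrow> computable (\<lambda>x. p2 (f x))"
  and computable_Suc [computable_intros]: "computable f \<Longrightarrow> computable (\<lambda>x. Suc (f x))"
  by (rule computable_compose[of p1 f] computable_compose[of p2 f] computable_compose[of Suc f];
      simp add: computable_def partial_computable.left partial_computable.right partial_computable.succ)+

lemma computable_pair [computable_intros]:
  "computable f \<Longrightarrow> computable g \<Longrightarrow> computable (\<lambda>x. prod_encode (f x, g x))"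
  using partial_computable.pair[of "\<lambda>x. Some (f x)" "\<lambda>x. Some (g x)"] by (simp add: computable_def)

lemma computable_id [computable_intros]: "computable (\<lambda>x. x)"
proof -
  have "computable (\<lambda>x. prod_encode (p1 x, p2 x))"
    using partial_computable.left partial_computable.right
    by (intro computable_pair) (simp_all add: computable_def)
  then show ?thesis by simp
qed

lemma computable_const [computable_intros]: "computable (\<lambda>_. c)"
proof (induction c)
  case 0
  show ?case by (simp add: computable_def partial_computable.zero)
next
  case (Suc c)
  then show ?case by (rule computable_Suc)
qed

text \<open>The step function may use the outer argument as a parameter. The clause
  \<open>prim_rec\<close> hands over the triple (a, (n, r)), which explains the nested projections
  in the second assumption.\<close>

lemma computable_rec:
  assumes "computable f" "computable (\<lambda>z. g (p1 z) (p1 (p2 z)) (p2 (p2 z)))" "computable k"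
  shows "computable (\<lambda>x. rec_nat (f x) (g x) (k x))"
proof -
  let ?g = "\<lambda>z. g (p1 z) (p1 (p2 z)) (p2 (p2 z))"
  have *: "rec_nat (Some (f a)) (\<lambda>n r. Option.bind r (\<lambda>y. Some (?g (prod_encode (a, prod_encode (n, y)))))) m
    = Some (rec_nat (f a) (g a) m)" for a m
    by (induction m) auto
  have "computable (\<lambda>x. rec_nat (f (p1 x)) (g (p1 x)) (p2 x))"
    using partial_computable.prim_rec[OF assms(1,2)[unfolded computable_def]]
    unfolding * by (simp add: computable_def case_prod_beta)
  from computable_compose[OF this computable_pair[OF computable_id assms(3)]] show ?thesis by simp
qed

lemma computable_add [computable_intros]:
  assumes "computable f" "computable g" shows "computable (\<lambda>x. f x + g x)"
proof -
  have "rec_nat a (\<lambda>n r. Suc r) b = a + b" for a b :: nat by (induction b) auto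
  moreover have "computable (\<lambda>x. rec_nat (f x) (\<lambda>n r. Suc r) (g x))"
    by (intro computable_rec computable_intros assms)
  ultimately show ?thesis by simp
qed

lemma computable_diff [computable_intros]:
  assumes "computable f" "computable g" shows "computable (\<lambda>x. f x - g x)"
proof -
  have 1: "rec_nat 0 (\<lambda>n r. n) b = b - 1" for b :: nat by (induction b) auto
  have "computable (\<lambda>x. rec_nat 0 (\<lambda>n r. n) (h x))" if "computable h" for h
    by (intro computable_rec computable_intros that)
  then have 2: "computable (\<lambda>x. h x - 1)" if "computable h" for h using that unfolding 1 .
  have "rec_nat a (\<lambda>n r. r - 1) b = a - b" for a b :: nat by (induction b) auto
  moreover have "computable (\<lambda>x. rec_nat (f x) (\<lambda>n r. r - 1) (g x))"
    by (intro computable_rec 2 computable_intros assms)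
  ultimately show ?thesis by simp
qed

lemma computable_mult [computable_intros]:
  assumes "computable f" "computable g" shows "computable (\<lambda>x. f x * g x)"
proof -
  have "rec_nat 0 (\<lambda>n r. r + a) b = a * b" for a b :: nat by (induction b) auto
  moreover have "computable (\<lambda>x. rec_nat 0 (\<lambda>n r. r + f x) (g x))"
    by (intro computable_rec computable_intros computable_compose[OF assms(1)] assms)
  ultimately show ?thesis by simp
qed

lemma computable_power [computable_intros]:
  assumes "computable f" "computable g" shows "computable (\<lambda>x. f x ^ g x)"
proof -
  have "rec_nat 1 (\<lambda>n r. r * a) b = a ^ b" for a b :: nat by (induction b) auto
  moreover have "computable (\<lambda>x. rec_nat 1 (\<lambda>n r. r * f x) (g x))"
    by (intro computable_rec computable_intros computable_compose[OF assms(1)] assms)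
  ultimately show ?thesis by simp
qed

section \<open>Decidable predicates, bounded quantifiers and search\<close>

definition decidable :: "(nat \<Rightarrow> bool) \<Rightarrow> bool" where
  "decidable P \<longleftrightarrow> computable (\<lambda>x. if P x then 1 else 0)"

lemma computable_If [computable_intros]:
  assumes "decidable P" "computable f" "computable g"
  shows "computable (\<lambda>x. if P x then f x else g x)"
proof -
  have "(\<lambda>x. if P x then f x else g x) =
    (\<lambda>x. (if P x then 1 else 0) * f x + (1 - (if P x then 1 else 0)) * g x)"
    by auto
  then show ?thesis
    using assms unfolding decidable_def by (simp only:) (intro computable_intros)
qed

lemma decidable_compose: "decidable P \<Longrightarrow> computable f \<Longrightarrow> decidable (\<lambda>x. P (f x))"
  unfolding decidable_def by (rule computable_compose)

lemma decidable_compose2: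
  assumes "decidable (\<lambda>z. P (p1 z) (p2 z))" "computable f" "computable g"
  shows "decidable (\<lambda>x. P (f x) (g x))"
  using decidable_compose[OF assms(1) computable_pair[OF assms(2,3)]] by simp

lemma decidable_not [computable_intros]: "decidable P \<Longrightarrow> decidable (\<lambda>x. \<not> P x)"
proof -
  assume "decidable P"
  then have "computable (\<lambda>x. if P x then 0 else 1)" by (intro computable_intros)
  moreover have "(\<lambda>x. if P x then 0 else 1) = (\<lambda>x. if \<not> P x then 1 else 0::nat)" by auto
  ultimately show ?thesis unfolding decidable_def by simp
qed

lemma decidable_conj [computable_intros]:
  assumes "decidable P" "decidable Q" shows "decidable (\<lambda>x. P x \<and> Q x)"
proof -
  have "computable (\<lambda>x. if P x then (if Q x then 1 else 0) else 0)"
    using assms by (intro computable_intros)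
  moreover have "(\<lambda>x. if P x then (if Q x then 1 else 0) else 0) = (\<lambda>x. if P x \<and> Q x then 1 else 0::nat)"
    by auto
  ultimately show ?thesis by (simp only: decidable_def)
qed

lemma decidable_disj [computable_intros]:
  assumes "decidable P" "decidable Q" shows "decidable (\<lambda>x. P x \<or> Q x)"
  using decidable_not[OF decidable_conj[OF decidable_not[OF assms(1)] decidable_not[OF assms(2)]]]
  by simp

lemma decidable_imp [computable_intros]:
  assumes "decidable P" "decidable Q" shows "decidable (\<lambda>x. P x \<longrightarrow> Q x)"
  using decidable_disj[OF decidable_not[OF assms(1)] assms(2)] by (simp only: imp_conv_disj)

lemma decidable_less [computable_intros]:
  assumes "computable f" "computable g" shows "decidable (\<lambda>x. f x < g x)"
proof -
  have "computable (\<lambda>x. 1 - (Suc (f x) - g x))" using assms by (intro computable_intros)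
  moreover have "(\<lambda>x. 1 - (Suc (f x) - g x)) = (\<lambda>x. if f x < g x then 1 else 0)" by auto
  ultimately show ?thesis by (simp only: decidable_def)
qed

lemma decidable_le [computable_intros]:
  assumes "computable f" "computable g" shows "decidable (\<lambda>x. f x \<le> g x)"
  using decidable_not[OF decidable_less[OF assms(2,1)]] by (simp add: not_less)

lemma decidable_eq [computable_intros]:
  assumes "computable f" "computable g" shows "decidable (\<lambda>x. f x = g x)"
  using decidable_conj[OF decidable_le[OF assms] decidable_le[OF assms(2,1)]]
  by (simp only: order_eq_iff[symmetric])

text \<open>One recursion yields bounded counting; bounded quantifiers, division and the
  approximations \<open>count\<close> to the counting function of C are all obtained from
  it.\<close>

lemma computable_card [computable_intros]:
  assumes P: "decidable (\<lambda>z. P (p1 z) (p2 z))" and f: "computable f"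
  shows "computable (\<lambda>x. card {m. m < f x \<and> P x m})"
proof -
  have "{m. m < Suc b \<and> P x m} = (if P x b then insert b {m. m < b \<and> P x m} else {m. m < b \<and> P x m})"
    for x b by (auto simp: less_Suc_eq)
  then have "rec_nat 0 (\<lambda>n r. if P x n then Suc r else r) b = card {m. m < b \<and> P x m}" for x b
    by (induction b) simp_all
  moreover have "computable (\<lambda>x. rec_nat 0 (\<lambda>n r. if P x n then Suc r else r) (f x))"
    by (intro computable_rec computable_intros decidable_compose2[OF P] f)
  ultimately show ?thesis by simp
qed

lemma decidable_ex_less [computable_intros]:
  assumes "decidable (\<lambda>z. P (p1 z) (p2 z))" "computable f"
  shows "decidable (\<lambda>x. \<exists>m<f x. P x m)"
proof -
  have "card {m. m < f x \<and> P x m} \<noteq> 0 \<longleftrightarrow> (\<exists>m<f x. P x m)" for x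
    by auto
  moreover have "decidable (\<lambda>x. card {m. m < f x \<and> P x m} \<noteq> 0)"
    by (intro computable_intros assms)
  ultimately show ?thesis by (simp only:)
qed

lemma decidable_all_less [computable_intros]:
  assumes "decidable (\<lambda>z. P (p1 z) (p2 z))" "computable f"
  shows "decidable (\<lambda>x. \<forall>m<f x. P x m)"
  using decidable_not[OF decidable_ex_less[OF decidable_not[OF assms(1)] assms(2)]] by simp

lemma decidable_ex_le [computable_intros]:
  assumes "decidable (\<lambda>z. P (p1 z) (p2 z))" "computable f"
  shows "decidable (\<lambda>x. \<exists>m\<le>f x. P x m)"
  using decidable_ex_less[OF assms(1) computable_Suc[OF assms(2)]] by (simp add: less_Suc_eq_le)

lemma decidable_all_le [computable_intros]:
  assumes "decidable (\<lambda>z. P (p1 z) (p2 z))" "computable f"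
  shows "decidable (\<lambda>x. \<forall>m\<le>f x. P x m)"
  using decidable_all_less[OF assms(1) computable_Suc[OF assms(2)]] by (simp add: less_Suc_eq_le)

lemma computable_div [computable_intros]:
  assumes "computable f" "computable g" shows "computable (\<lambda>x. f x div g x)"
proof -
  \<comment> \<open>A quotient counts the positive multiples of \<open>b\<close> up to
    \<open>a\<close>. The conjunct \<open>0 < b\<close> makes the count 0 when \<open>b = 0\<close>,
    in agreement with \<open>a div 0 = 0\<close>.\<close>
  have "card {q. q < a \<and> 0 < b \<and> Suc q * b \<le> a} = a div b" for a b :: nat
  proof (cases "b = 0")
    case False
    have "Suc q * b \<le> a \<longleftrightarrow> q < a div b" for q
      using False less_eq_div_iff_mult_less_eq[of b "Suc q" a] by (simp only: Suc_le_eq)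
    moreover have "q < a" if "q < a div b" for q using that div_le_dividend[of a b] by linarith
    ultimately have "{q. q < a \<and> 0 < b \<and> Suc q * b \<le> a} = {..<a div b}"
      using False by blast
    then show ?thesis by (simp only: card_lessThan)
  qed simp
  moreover have "computable (\<lambda>x. card {q. q < f x \<and> 0 < g x \<and> Suc q * g x \<le> f x})"
    by (intro computable_intros assms computable_compose[OF assms(1)] computable_compose[OF assms(2)])
  ultimately show ?thesis by simp
qed

lemma decidable_in_set_decode [computable_intros]:
  assumes "computable f" "computable g" shows "decidable (\<lambda>x. f x \<in> set_decode (g x))"
proof -
  have "odd c \<longleftrightarrow> c \<noteq> 2 * (c div 2)" for c :: nat by presburger
  then have "a \<in> set_decode b \<longleftrightarrow> b div 2 ^ a \<noteq> 2 * (b div 2 ^ a div 2)" for a b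
    unfolding set_decode_def mem_Collect_eq .
  moreover have "decidable (\<lambda>x. g x div 2 ^ f x \<noteq> 2 * (g x div 2 ^ f x div 2))"
    by (intro computable_intros assms)
  ultimately show ?thesis by (simp only:)
qed

text \<open>As \<open>R\<close> is total and decidable, the condition of \<open>minimization\<close>
  that all earlier values be defined holds by itself.\<close>

lemma partial_computable_search:
  assumes "decidable (\<lambda>z. R (p1 z) (p2 z))"
  shows "partial_computable (\<lambda>x. if \<exists>y. R x y then Some (LEAST y. R x y) else None)"
proof -
  define r where "r z = (if R (p1 z) (p2 z) then 0 else 1::nat)" for z
  have "computable r" unfolding r_def by (intro computable_intros assms)
  then have "partial_computable (\<lambda>x. minimization (\<lambda>n. Some (r (prod_encode (x, n)))))"
    unfolding computable_def by (rule partial_computable.minim)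
  moreover have "minimization (\<lambda>n. Some (r (prod_encode (x, n)))) =
    (if \<exists>y. R x y then Some (LEAST y. R x y) else None)" for x
    by (simp add: minimization_def r_def)
  ultimately show ?thesis by simp
qed

text \<open>Replaces the least-element operator by a condition made of positive facts about the
  values of \<open>q\<close>; in this form it is clause 7 of \<open>justified\<close>.\<close>

lemma minimization_eq_Some_iff:
  "minimization q = Some y \<longleftrightarrow> q y = Some 0 \<and> (\<forall>m<y. \<exists>r. q m = Some (Suc r))"
proof
  assume l: "minimization q = Some y"
  then obtain n where n: "q n = Some 0" "\<forall>m<n. q m \<noteq> None" and y: "y = (LEAST n. q n = Some 0)"
    by (auto simp: minimization_def split: if_splits)
  have "q y = Some 0" using n(1) unfolding y by (rule LeastI)
  moreover have "\<exists>r. q m = Some (Suc r)" if "m < y" for m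
  proof -
    have "y \<le> n" unfolding y using n(1) by (rule Least_le)
    then have "q m \<noteq> None" using n(2) that by auto
    moreover have "q m \<noteq> Some 0" using that not_less_Least unfolding y by blast
    ultimately show ?thesis by (metis not0_implies_Suc option.exhaust)
  qed
  ultimately show "q y = Some 0 \<and> (\<forall>m<y. \<exists>r. q m = Some (Suc r))" by blast
next
  assume r: "q y = Some 0 \<and> (\<forall>m<y. \<exists>r. q m = Some (Suc r))"
  then have "(LEAST n. q n = Some 0) = y"
    by (intro Least_equality) (auto simp: not_less[symmetric])
  with r show "minimization q = Some y" unfolding minimization_def by force
qed

section \<open>A universal computation predicate\<close>

text \<open>
  A program is coded as \<open>(tag, a, b)\<close>, the tag naming the clause of
  \<^const>\<open>partial_computable\<close>.  \<open>justified H p x y\<close> says that the fact "\<open>p\<close> maps \<open>x\<close> to \<open>y\<close>"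
  follows from the facts in \<open>H\<close> in one step.
\<close>

definition justified :: "(nat \<Rightarrow> nat \<Rightarrow> nat \<Rightarrow> bool) \<Rightarrow> nat \<Rightarrow> nat \<Rightarrow> nat \<Rightarrow> bool" where
  "justified H p x y \<longleftrightarrow>
     p1 p = 0 \<and> y = 0 \<or>
     p1 p = 1 \<and> y = Suc x \<or>
     p1 p = 2 \<and> y = p1 x \<or>
     p1 p = 3 \<and> y = p2 x \<or>
     p1 p = 4 \<and> H (p1 (p2 p)) x (p1 y) \<and> H (p2 (p2 p)) x (p2 y) \<or>
     p1 p = 5 \<and> (\<exists>u. H (p2 (p2 p)) x u \<and> H (p1 (p2 p)) u y) \<or>
     p1 p = 6 \<and> p2 x = 0 \<and> H (p1 (p2 p)) (p1 x) y \<or>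
     p1 p = 6 \<and> p2 x \<noteq> 0 \<and> (\<exists>r. H p (prod_encode (p1 x, p2 x - 1)) r \<and>
       H (p2 (p2 p)) (prod_encode (p1 x, prod_encode (p2 x - 1, r))) y) \<or>
     p1 p = 7 \<and> H (p1 (p2 p)) (prod_encode (x, y)) 0 \<and>
       (\<forall>m<y. \<exists>r. H (p1 (p2 p)) (prod_encode (x, m)) (Suc r))"

definition has_fact :: "nat set \<Rightarrow> nat \<Rightarrow> nat \<Rightarrow> nat \<Rightarrow> bool" where
  "has_fact S p x y \<longleftrightarrow> prod_encode (p, prod_encode (x, y)) \<in> S"

text \<open>No order of derivation is recorded, so a set might support itself in a circle. For the
  code of an actual program this is harmless: there \<open>derivable_iff\<close> alone determines
  the values, by induction on the program and on the recursion counter.\<close>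

definition self_justified :: "nat set \<Rightarrow> bool" where
  "self_justified S \<longleftrightarrow> (\<forall>p x y. has_fact S p x y \<longrightarrow> justified (has_fact S) p x y)"

text \<open>Finiteness of \<open>S\<close> allows a computation to be coded by a single number
  through \<open>set_encode\<close>.\<close>

definition derivable :: "nat \<Rightarrow> nat \<Rightarrow> nat \<Rightarrow> bool" where
  "derivable p x y \<longleftrightarrow> (\<exists>S. finite S \<and> self_justified S \<and> has_fact S p x y)"

text \<open>\<open>H\<close> occurs only positively: the clause for minimization asks for successor
  values below \<open>y\<close> instead of denying the value 0.\<close>

lemma justified_mono:
  assumes "justified H p x y" "\<And>p x y. H p x y \<Longrightarrow> H' p x y"
  shows "justified H' p x y"
  using assms(1) unfolding justified_def
  by (elim disjE conjE; simp add: assms(2); meson assms(2))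

lemma self_justified_UN:
  assumes "\<And>i. i \<in> I \<Longrightarrow> self_justified (S i)"
  shows "self_justified (\<Union>i\<in>I. S i)"
  unfolding self_justified_def
proof (intro allI impI)
  fix p x y assume "has_fact (\<Union>i\<in>I. S i) p x y"
  then obtain i where i: "i \<in> I" "has_fact (S i) p x y" by (auto simp: has_fact_def)
  then have "justified (has_fact (S i)) p x y" using assms by (auto simp: self_justified_def)
  then show "justified (has_fact (\<Union>i\<in>I. S i)) p x y"
    by (rule justified_mono) (use i in \<open>auto simp: has_fact_def\<close>)
qed

lemma derivable_finite_support:
  assumes "finite F" "\<And>p x y. (p, x, y) \<in> F \<Longrightarrow> derivable p x y"
  shows "\<exists>S. finite S \<and> self_justified S \<and> (\<forall>(p, x, y)\<in>F. has_fact S p x y)"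
proof -
  have "\<forall>t\<in>F. \<exists>S. finite S \<and> self_justified S \<and> has_fact S (fst t) (fst (snd t)) (snd (snd t))"
    using assms(2) by (auto simp: derivable_def)
  then obtain S where S: "\<forall>t\<in>F. finite (S t) \<and> self_justified (S t) \<and>
    has_fact (S t) (fst t) (fst (snd t)) (snd (snd t))"
    by (rule bchoice[THEN exE])
  have "finite (\<Union>t\<in>F. S t)" using S assms(1) by auto
  moreover have "self_justified (\<Union>t\<in>F. S t)" using S by (intro self_justified_UN) auto
  moreover have "\<forall>(p, x, y)\<in>F. has_fact (\<Union>t\<in>F. S t) p x y"
    using S by (fastforce simp: has_fact_def)
  ultimately show ?thesis by blast
qed

text \<open>Only minimization has a number of premises that depends on the data, namely
  \<open>y + 1\<close>; once a value is chosen for each \<open>m < y\<close>, they are finitely many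
  facts. This lets \<open>derivable_iff\<close> assemble a finite certificate.\<close>

lemma justified_compact:
  assumes "justified H p x y"
  shows "\<exists>F. finite F \<and> (\<forall>(p, x, y)\<in>F. H p x y) \<and> justified (\<lambda>p x y. (p, x, y) \<in> F) p x y"
proof -
  let ?a = "p1 (p2 p)" and ?b = "p2 (p2 p)"
  have "p1 p \<in> {0, 1, 2, 3} \<or> p1 p = 4 \<or> p1 p = 5 \<or> p1 p = 6 \<or> p1 p = 7"
    using assms unfolding justified_def by (elim disjE conjE) simp_all
  then consider "p1 p \<in> {0, 1, 2, 3}" | "p1 p = 4" | "p1 p = 5" | "p1 p = 6" "p2 x = 0"
    | "p1 p = 6" "p2 x \<noteq> 0" | "p1 p = 7"
    by argo
  then show ?thesis
  proof cases
    case 1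
    with assms show ?thesis by (intro exI[of _ "{}"]) (auto simp: justified_def)
  next
    case 2
    with assms show ?thesis
      by (intro exI[of _ "{(?a, x, p1 y), (?b, x, p2 y)}"]) (auto simp: justified_def)
  next
    case 3
    with assms obtain u where "H ?b x u" "H ?a u y" by (auto simp: justified_def)
    with 3 show ?thesis
      by (intro exI[of _ "{(?b, x, u), (?a, u, y)}"]) (auto simp: justified_def)
  next
    case 4
    with assms show ?thesis
      by (intro exI[of _ "{(?a, p1 x, y)}"]) (auto simp: justified_def)
  next
    case 5
    with assms obtain r where "H p (prod_encode (p1 x, p2 x - 1)) r"
      "H ?b (prod_encode (p1 x, prod_encode (p2 x - 1, r))) y" by (auto simp: justified_def)
    with 5 show ?thesis
      by (intro exI[of _ "{(p, prod_encode (p1 x, p2 x - 1), r),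
        (?b, prod_encode (p1 x, prod_encode (p2 x - 1, r)), y)}"]) (auto simp: justified_def)
  next
    case 6
    with assms have *: "H ?a (prod_encode (x, y)) 0"
      "\<forall>m<y. \<exists>r. H ?a (prod_encode (x, m)) (Suc r)" by (auto simp: justified_def)
    then obtain r where "\<forall>m<y. H ?a (prod_encode (x, m)) (Suc (r m))" by metis
    with * 6 show ?thesis
      by (intro exI[of _ "insert (?a, prod_encode (x, y), 0)
        ((\<lambda>m. (?a, prod_encode (x, m), Suc (r m))) ` {..<y})"]) (auto simp: justified_def)
  qed
qed

text \<open>A fixed-point equation. A certificate for a conclusion also certifies its premises;
  conversely finitely many certificates unite, and adding the conclusion keeps the union
  self-justified.\<close>

lemma derivable_iff: "derivable p x y \<longleftrightarrow> justified derivable p x y"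
proof
  assume "derivable p x y"
  then obtain S where S: "finite S" "self_justified S" "has_fact S p x y"
    by (auto simp: derivable_def)
  then have "justified (has_fact S) p x y" unfolding self_justified_def by blast
  then show "justified derivable p x y"
    by (rule justified_mono) (use S in \<open>unfold derivable_def, blast\<close>)
next
  assume "justified derivable p x y"
  then obtain F where F: "finite F" "\<forall>(p, x, y)\<in>F. derivable p x y"
    "justified (\<lambda>p x y. (p, x, y) \<in> F) p x y" by (blast dest: justified_compact)
  have "derivable p x y" if "(p, x, y) \<in> F" for p x y using F(2) that by blast
  from derivable_finite_support[OF F(1) this]
  obtain S where S: "finite S" "self_justified S" "\<forall>(p, x, y)\<in>F. has_fact S p x y" by blast
  let ?S = "insert (prod_encode (p, prod_encode (x, y))) S"
  have "justified (has_fact ?S) p' x' y'" if "has_fact ?S p' x' y'" for p' x' y'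
  proof (cases "has_fact S p' x' y'")
    case True
    with S(2) have "justified (has_fact S) p' x' y'" unfolding self_justified_def by blast
    then show ?thesis by (rule justified_mono) (auto simp: has_fact_def)
  next
    case False
    with that have "p' = p" "x' = x" "y' = y" by (auto simp: has_fact_def)
    moreover from F(3) have "justified (has_fact ?S) p x y"
      by (rule justified_mono) (use S(3) in \<open>auto simp: has_fact_def\<close>)
    ultimately show ?thesis by simp
  qed
  then have "self_justified ?S" unfolding self_justified_def by blast
  moreover have "finite ?S" "has_fact ?S p x y" using S by (simp_all add: has_fact_def)
  ultimately show "derivable p x y" unfolding derivable_def by blast
qed

text \<open>Each clause of the inductive definition gets its tag as code, and
  \<open>derivable_iff\<close> turns the claim into that clause. The equivalence carries existence
  and uniqueness of values through the induction together.\<close>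

lemma derivable_complete:
  "partial_computable f \<Longrightarrow> \<exists>p. \<forall>x y. derivable p x y \<longleftrightarrow> f x = Some y"
proof (induction rule: partial_computable.induct)
  case zero
  show ?case by (rule exI[of _ "prod_encode (0, 0)"]) (subst derivable_iff, auto simp: justified_def)
next
  case succ
  show ?case by (rule exI[of _ "prod_encode (1, 0)"]) (subst derivable_iff, auto simp: justified_def)
next
  case left
  show ?case by (rule exI[of _ "prod_encode (2, 0)"]) (subst derivable_iff, auto simp: justified_def)
next
  case right
  show ?case by (rule exI[of _ "prod_encode (3, 0)"]) (subst derivable_iff, auto simp: justified_def)
next
  case (pair f g)
  then obtain a b where a: "\<And>x y. derivable a x y \<longleftrightarrow> f x = Some y"
    and b: "\<And>x y. derivable b x y \<longleftrightarrow> g x = Some y" by blast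
  show ?case
    by (rule exI[of _ "prod_encode (4, prod_encode (a, b))"])
      (subst derivable_iff, auto simp: justified_def a b bind_eq_Some_conv)
next
  case (comp f g)
  then obtain a b where a: "\<And>x y. derivable a x y \<longleftrightarrow> f x = Some y"
    and b: "\<And>x y. derivable b x y \<longleftrightarrow> g x = Some y" by blast
  show ?case
    by (rule exI[of _ "prod_encode (5, prod_encode (a, b))"])
      (subst derivable_iff, auto simp: justified_def a b bind_eq_Some_conv)
next
  case (prim_rec f g)
  then obtain a b where a: "\<And>x y. derivable a x y \<longleftrightarrow> f x = Some y"
    and b: "\<And>x y. derivable b x y \<longleftrightarrow> g x = Some y" by blast
  let ?p = "prod_encode (6, prod_encode (a, b))"
  have "derivable ?p (prod_encode (c, m)) y \<longleftrightarrow>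
    rec_nat (f c) (\<lambda>n r. Option.bind r (\<lambda>y. g (prod_encode (c, prod_encode (n, y))))) m = Some y"
    for c m y
  proof (induction m arbitrary: y)
    case 0
    show ?case by (subst derivable_iff) (auto simp: justified_def a)
  next
    case (Suc m)
    show ?case by (subst derivable_iff) (auto simp: justified_def b Suc bind_eq_Some_conv)
  qed
  from this[of "p1 x" "p2 x" for x] show ?case
    by (intro exI[of _ ?p]) (simp add: case_prod_beta)
next
  case (minim f)
  then obtain a where a: "\<And>x y. derivable a x y \<longleftrightarrow> f x = Some y" by blast
  show ?case
    by (rule exI[of _ "prod_encode (7, prod_encode (a, 0))"])
      (subst derivable_iff, auto simp: justified_def a minimization_eq_Some_iff)
qed

section \<open>Decidability of the certificate relation, and normal form\<close>

lemma less_of_mem_set_decode: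
  assumes "n \<in> set_decode D" shows "n < D"
proof -
  have "D div 2 ^ n \<noteq> 0" using assms by (intro notI) (simp add: set_decode_def)
  then have "2 ^ n \<le> D" by (meson div_less leI)
  then show ?thesis using less_exp[of n] by (meson less_le_trans)
qed

lemma has_fact_decode_less:
  assumes "has_fact (set_decode D) p x y"
  shows "p < D" "x < D" "y < D"
proof -
  have "prod_encode (p, prod_encode (x, y)) < D"
    using assms less_of_mem_set_decode by (simp add: has_fact_def)
  moreover have "p \<le> prod_encode (p, prod_encode (x, y))"
    "prod_encode (x, y) \<le> prod_encode (p, prod_encode (x, y))"
    "x \<le> prod_encode (x, y)" "y \<le> prod_encode (x, y)"
    by (rule le_prod_encode_1 le_prod_encode_2)+
  ultimately show "p < D" "x < D" "y < D" by linarith+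
qed

lemma decidable_has_fact [computable_intros]:
  assumes "computable D" "computable p" "computable x" "computable y"
  shows "decidable (\<lambda>z. has_fact (set_decode (D z)) (p z) (x z) (y z))"
  unfolding has_fact_def by (intro computable_intros assms)

text \<open>The intermediate value of a composition or recursion occurs in a fact of the set, hence
  is smaller than the code \<open>D\<close>. What remains is a formula with bounded
  quantifiers.\<close>

lemma justified_decode:
  "justified (has_fact (set_decode D)) p x y \<longleftrightarrow>
     p1 p = 0 \<and> y = 0 \<or>
     p1 p = 1 \<and> y = Suc x \<or>
     p1 p = 2 \<and> y = p1 x \<or>
     p1 p = 3 \<and> y = p2 x \<or>
     p1 p = 4 \<and> has_fact (set_decode D) (p1 (p2 p)) x (p1 y) \<and>
       has_fact (set_decode D) (p2 (p2 p)) x (p2 y) \<or>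
     p1 p = 5 \<and> (\<exists>u<D. has_fact (set_decode D) (p2 (p2 p)) x u \<and>
       has_fact (set_decode D) (p1 (p2 p)) u y) \<or>
     p1 p = 6 \<and> p2 x = 0 \<and> has_fact (set_decode D) (p1 (p2 p)) (p1 x) y \<or>
     p1 p = 6 \<and> p2 x \<noteq> 0 \<and> (\<exists>r<D. has_fact (set_decode D) p (prod_encode (p1 x, p2 x - 1)) r \<and>
       has_fact (set_decode D) (p2 (p2 p)) (prod_encode (p1 x, prod_encode (p2 x - 1, r))) y) \<or>
     p1 p = 7 \<and> has_fact (set_decode D) (p1 (p2 p)) (prod_encode (x, y)) 0 \<and>
       (\<forall>m<y. \<exists>r<D. has_fact (set_decode D) (p1 (p2 p)) (prod_encode (x, m)) (Suc r))"
proof -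
  have "(\<exists>u. has_fact (set_decode D) b x u \<and> Q u) \<longleftrightarrow>
    (\<exists>u<D. has_fact (set_decode D) b x u \<and> Q u)" for b x Q
    using has_fact_decode_less by blast
  moreover have "(\<exists>r. has_fact (set_decode D) b x (Suc r)) \<longleftrightarrow>
    (\<exists>r<D. has_fact (set_decode D) b x (Suc r))" for b x
    using has_fact_decode_less(3) Suc_lessD by blast
  ultimately show ?thesis unfolding justified_def by simp
qed

lemma decidable_justified [computable_intros]:
  assumes "computable D" "computable p" "computable x" "computable y"
  shows "decidable (\<lambda>z. justified (has_fact (set_decode (D z))) (p z) (x z) (y z))"
  unfolding justified_decode
  by (intro computable_intros assms computable_compose[OF assms(1)] computable_compose[OF assms(2)]
      computable_compose[OF assms(3)] computable_compose[OF assms(4)])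

lemma self_justified_decode:
  "self_justified (set_decode D) \<longleftrightarrow> (\<forall>c<D. c \<in> set_decode D \<longrightarrow>
     justified (has_fact (set_decode D)) (p1 c) (p1 (p2 c)) (p2 (p2 c)))"
proof
  assume r: "\<forall>c<D. c \<in> set_decode D \<longrightarrow>
     justified (has_fact (set_decode D)) (p1 c) (p1 (p2 c)) (p2 (p2 c))"
  show "self_justified (set_decode D)"
    unfolding self_justified_def
  proof (intro allI impI)
    fix p x y assume "has_fact (set_decode D) p x y"
    then have "prod_encode (p, prod_encode (x, y)) \<in> set_decode D" by (simp add: has_fact_def)
    with r[rule_format, OF less_of_mem_set_decode[OF this] this]
    show "justified (has_fact (set_decode D)) p x y" by simp
  qed
qed (auto simp: self_justified_def has_fact_def)

definition certifies :: "nat \<Rightarrow> nat \<Rightarrow> nat \<Rightarrow> bool" where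
  "certifies e n Q \<longleftrightarrow> self_justified (set_decode (p2 Q)) \<and> has_fact (set_decode (p2 Q)) e n (p1 Q)"

text \<open>Taking the least certificate makes it unique without a proof that programs are deterministic.\<close>

definition halts :: "nat \<Rightarrow> nat \<Rightarrow> nat \<Rightarrow> bool" where
  "halts e n Q \<longleftrightarrow> certifies e n Q \<and> (\<forall>Q'<Q. \<not> certifies e n Q')"

lemma decidable_certifies:
  assumes "computable e" "computable n" "computable Q"
  shows "decidable (\<lambda>z. certifies (e z) (n z) (Q z))"
  unfolding certifies_def self_justified_decode
  by (intro computable_intros assms computable_compose[OF assms(3)])

lemma decidable_halts [computable_intros]:
  assumes "computable e" "computable n" "computable Q"
  shows "decidable (\<lambda>z. halts (e z) (n z) (Q z))"
  unfolding halts_def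
  by (intro computable_intros decidable_certifies assms computable_compose[OF assms(1)]
      computable_compose[OF assms(2)])

lemma halts_unique: "halts e n Q \<Longrightarrow> halts e n Q' \<Longrightarrow> Q = Q'"
  unfolding halts_def by (metis linorder_neqE_nat)

text \<open>Kleene's normal form. All certificates for the same input agree on the output, because
  \<open>f\<close> is a function, so passing to the least certificate loses nothing.\<close>

lemma halts_complete:
  assumes "partial_computable f"
  obtains e where "\<And>n y. f n = Some y \<longleftrightarrow> (\<exists>Q. halts e n Q \<and> p1 Q = y)"
proof -
  obtain e where e: "\<And>x y. derivable e x y \<longleftrightarrow> f x = Some y"
    using derivable_complete[OF assms] by blast
  have cert: "derivable e n y \<longleftrightarrow> (\<exists>Q. certifies e n Q \<and> p1 Q = y)" for n y
  proof
    assume "derivable e n y"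
    then obtain S where "finite S" "self_justified S" "has_fact S e n y"
      by (auto simp: derivable_def)
    then show "\<exists>Q. certifies e n Q \<and> p1 Q = y"
      by (intro exI[of _ "prod_encode (y, set_encode S)"]) (simp add: certifies_def)
  next
    assume "\<exists>Q. certifies e n Q \<and> p1 Q = y"
    then obtain Q where "self_justified (set_decode (p2 Q))" "has_fact (set_decode (p2 Q)) e n y"
      by (auto simp: certifies_def)
    then show "derivable e n y" unfolding derivable_def using finite_set_decode by blast
  qed
  have "f n = Some y \<longleftrightarrow> (\<exists>Q. halts e n Q \<and> p1 Q = y)" for n y
  proof
    assume y: "f n = Some y"
    then obtain Q where Q: "certifies e n Q" using e cert by blast
    define Q' where "Q' = (LEAST Q. certifies e n Q)"
    have "certifies e n Q'" unfolding Q'_def using Q by (rule LeastI)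
    then have "halts e n Q'" unfolding halts_def Q'_def using not_less_Least by blast
    moreover have "p1 Q' = y"
      using \<open>certifies e n Q'\<close> cert[of n "p1 Q'"] e[of n "p1 Q'"] y by auto
    ultimately show "\<exists>Q. halts e n Q \<and> p1 Q = y" by blast
  next
    assume "\<exists>Q. halts e n Q \<and> p1 Q = y"
    then show "f n = Some y" using e cert unfolding halts_def by blast
  qed
  then show ?thesis by (rule that)
qed

text \<open>A function is determined by its index \<open>e\<close>. The countability of the power,
  on which the back-and-forth argument depends, comes from here.\<close>

lemma countable_partial_computable: "countable {f. partial_computable f}"
proof -
  have "{f. partial_computable f} \<subseteq>
    range (\<lambda>e n. if \<exists>Q. halts e n Q then Some (p1 (THE Q. halts e n Q)) else None)"
  proof
    fix f assume "f \<in> {f. partial_computable f}"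
    then obtain e where e: "\<And>n y. f n = Some y \<longleftrightarrow> (\<exists>Q. halts e n Q \<and> p1 Q = y)"
      using halts_complete by blast
    have "f n = (if \<exists>Q. halts e n Q then Some (p1 (THE Q. halts e n Q)) else None)" for n
    proof (cases "\<exists>Q. halts e n Q")
      case True
      then obtain Q where Q: "halts e n Q" by blast
      then have "(THE Q. halts e n Q) = Q" using halts_unique by blast
      with Q e show ?thesis by auto
    next
      case False
      with e have "f n \<noteq> Some y" for y by blast
      with False show ?thesis by (metis option.exhaust)
    qed
    then show "f \<in> range (\<lambda>e n. if \<exists>Q. halts e n Q then Some (p1 (THE Q. halts e n Q)) else None)"
      by blast
  qed
  then show ?thesis by (rule countable_subset) simp
qed

section \<open>Linear orders\<close>

lemma linear_ord_field: "linear_ord P \<Longrightarrow> (x, y) \<in> snd P \<Longrightarrow> x \<in> fst P \<and> y \<in> fst P"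
  by (auto simp: linear_ord_def)

lemma linear_ord_trans:
  "linear_ord P \<Longrightarrow> (x, y) \<in> snd P \<Longrightarrow> (y, z) \<in> snd P \<Longrightarrow> (x, z) \<in> snd P"
  unfolding linear_ord_def strict_linear_order_on_def by (blast dest: transD)

lemma linear_ord_irrefl: "linear_ord P \<Longrightarrow> (x, x) \<notin> snd P"
  by (auto simp: linear_ord_def strict_linear_order_on_def irrefl_def)

lemma linear_ord_total:
  "linear_ord P \<Longrightarrow> x \<in> fst P \<Longrightarrow> y \<in> fst P \<Longrightarrow> x = y \<or> (x, y) \<in> snd P \<or> (y, x) \<in> snd P"
  unfolding linear_ord_def strict_linear_order_on_def total_on_def by blast

lemma linear_ord_asym: "linear_ord P \<Longrightarrow> (x, y) \<in> snd P \<Longrightarrow> (y, x) \<notin> snd P"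
  using linear_ord_trans[of P x y x] linear_ord_irrefl[of P x] by blast

lemma linear_ordI:
  assumes "\<And>x y. (x, y) \<in> snd P \<Longrightarrow> x \<in> fst P \<and> y \<in> fst P"
    "\<And>x y z. (x, y) \<in> snd P \<Longrightarrow> (y, z) \<in> snd P \<Longrightarrow> (x, z) \<in> snd P"
    "\<And>x. (x, x) \<notin> snd P"
    "\<And>x y. x \<in> fst P \<Longrightarrow> y \<in> fst P \<Longrightarrow> x \<noteq> y \<Longrightarrow> (x, y) \<in> snd P \<or> (y, x) \<in> snd P"
  shows "linear_ord P"
proof -
  have "snd P \<subseteq> fst P \<times> fst P" using assms(1) by auto
  moreover have "trans (snd P)" using assms(2) by (rule transI)
  moreover have "irrefl (snd P)" using assms(3) by (rule irreflI)
  moreover have "total_on (fst P) (snd P)" using assms(4) by (simp add: total_on_def)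
  ultimately show ?thesis by (simp add: linear_ord_def strict_linear_order_on_def)
qed

lemma linear_ord_order_on: "linear_ord (order_on A)"
  by (rule linear_ordI) (auto simp: order_on_def)

lemma fst_order_on [simp]: "fst (order_on A) = A"
  and mem_order_on [simp]: "(x, y) \<in> snd (order_on A) \<longleftrightarrow> x \<in> A \<and> y \<in> A \<and> x < y"
  by (auto simp: order_on_def)

lemma linear_ord_reverse: "linear_ord P \<Longrightarrow> linear_ord (reverse_order P)"
  by (auto simp: linear_ord_def strict_linear_order_on_def reverse_order_def irrefl_def)

definition suborder :: "'a order \<Rightarrow> 'a set \<Rightarrow> 'a order" where
  "suborder P S = (fst P \<inter> S, snd P \<inter> S \<times> S)"

lemma fst_suborder [simp]: "fst (suborder P S) = fst P \<inter> S"
  and mem_suborder [simp]: "(x, y) \<in> snd (suborder P S) \<longleftrightarrow> (x, y) \<in> snd P \<and> x \<in> S \<and> y \<in> S"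
  by (auto simp: suborder_def)

lemma suborder_suborder: "suborder (suborder P S) T = suborder P (S \<inter> T)"
  by (auto simp: suborder_def)

lemma suborder_cong:
  assumes "fst P \<inter> S = fst P \<inter> T" "linear_ord P"
  shows "suborder P S = suborder P T"
proof -
  have "snd P \<inter> S \<times> S = snd P \<inter> T \<times> T"
    using assms(1) linear_ord_field[OF assms(2)] by blast
  with assms(1) show ?thesis by (simp add: suborder_def)
qed

lemma linear_ord_suborder:
  assumes P: "linear_ord P" shows "linear_ord (suborder P S)"
proof (rule linear_ordI)
  show "x \<in> fst (suborder P S) \<and> y \<in> fst (suborder P S)" if "(x, y) \<in> snd (suborder P S)" for x y
    using that linear_ord_field[OF P, of x y] by simp
  show "(x, z) \<in> snd (suborder P S)"
    if "(x, y) \<in> snd (suborder P S)" "(y, z) \<in> snd (suborder P S)" for x y z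
    using that linear_ord_trans[OF P, of x y z] by simp
  show "(x, x) \<notin> snd (suborder P S)" for x
    using linear_ord_irrefl[OF P] by simp
  show "(x, y) \<in> snd (suborder P S) \<or> (y, x) \<in> snd (suborder P S)"
    if "x \<in> fst (suborder P S)" "y \<in> fst (suborder P S)" "x \<noteq> y" for x y
    using that linear_ord_total[OF P, of x y] by simp
qed

text \<open>Between linear orders a strictly increasing surjection is enough: totality of
  \<open>P\<close> and asymmetry of \<open>Q\<close> give injectivity and reflection of the
  order.\<close>

lemma order_isoI:
  assumes "linear_ord P" "linear_ord Q" "f ` fst P = fst Q"
    "\<And>x y. (x, y) \<in> snd P \<Longrightarrow> (f x, f y) \<in> snd Q"
  shows "order_iso P Q"
proof -
  have iff: "(x, y) \<in> snd P \<longleftrightarrow> (f x, f y) \<in> snd Q" if "x \<in> fst P" "y \<in> fst P" for x y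
    using assms(4)[of x y] assms(4)[of y x] linear_ord_total[OF assms(1) that]
      linear_ord_asym[OF assms(2), of "f x" "f y"] linear_ord_irrefl[OF assms(2), of "f x"] by blast
  moreover have "inj_on f (fst P)"
  proof (rule inj_onI)
    fix x y assume "x \<in> fst P" "y \<in> fst P" "f x = f y"
    then show "x = y"
      using assms(4)[of x y] assms(4)[of y x] linear_ord_total[OF assms(1), of x y]
        linear_ord_irrefl[OF assms(2), of "f x"] by auto
  qed
  ultimately show ?thesis using assms(3) unfolding order_iso_def bij_betw_def by blast
qed

lemma order_isoE:
  assumes "order_iso P Q"
  obtains f where "bij_betw f (fst P) (fst Q)"
    "\<And>x y. x \<in> fst P \<Longrightarrow> y \<in> fst P \<Longrightarrow> (x, y) \<in> snd P \<longleftrightarrow> (f x, f y) \<in> snd Q"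
  using assms unfolding order_iso_def by blast

lemma mem_lex_sum:
  "((i, x), (j, y)) \<in> snd (lex_sum I F) \<longleftrightarrow> i \<in> fst I \<and> j \<in> fst I \<and> x \<in> fst (F i) \<and> y \<in> fst (F j) \<and>
     ((i, j) \<in> snd I \<or> i = j \<and> (x, y) \<in> snd (F i))"
  by (auto simp: lex_sum_def)

lemma linear_ord_lex_sum:
  assumes "linear_ord I" "\<And>i. i \<in> fst I \<Longrightarrow> linear_ord (F i)"
  shows "linear_ord (lex_sum I F)"
proof (rule linear_ordI)
  show "a \<in> fst (lex_sum I F) \<and> b \<in> fst (lex_sum I F)" if "(a, b) \<in> snd (lex_sum I F)" for a b
    using that by (auto simp: lex_sum_def)
  show "(a, a) \<notin> snd (lex_sum I F)" for a
  proof -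
    obtain i x where a: "a = (i, x)" by (metis surj_pair)
    show ?thesis
      using linear_ord_irrefl[OF assms(1), of i] linear_ord_irrefl[OF assms(2), of i x]
      unfolding a mem_lex_sum by blast
  qed
  show "(a, c) \<in> snd (lex_sum I F)"
    if "(a, b) \<in> snd (lex_sum I F)" "(b, c) \<in> snd (lex_sum I F)" for a b c
  proof -
    obtain i x j y k z where abc: "a = (i, x)" "b = (j, y)" "c = (k, z)" by (metis surj_pair)
    show ?thesis
      using that linear_ord_trans[OF assms(1), of i j k] linear_ord_trans[OF assms(2), of i x y z]
      unfolding abc mem_lex_sum by blast
  qed
  show "(a, b) \<in> snd (lex_sum I F) \<or> (b, a) \<in> snd (lex_sum I F)"
    if "a \<in> fst (lex_sum I F)" "b \<in> fst (lex_sum I F)" "a \<noteq> b" for a b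
  proof -
    obtain i x j y where ab: "a = (i, x)" "b = (j, y)" by (metis surj_pair)
    have "i \<in> fst I" "j \<in> fst I" "x \<in> fst (F i)" "y \<in> fst (F j)"
      using that by (auto simp: ab lex_sum_def)
    then show ?thesis
      using linear_ord_total[OF assms(1), of i j] linear_ord_total[OF assms(2), of i x y] that(3)
      unfolding ab mem_lex_sum by blast
  qed
qed

lemma countable_lex_sum:
  "countable (fst I) \<Longrightarrow> (\<And>i. i \<in> fst I \<Longrightarrow> countable (fst (F i))) \<Longrightarrow> countable (fst (lex_sum I F))"
  by (auto simp: lex_sum_def)

text \<open>A weakly increasing map into the index order cuts \<open>P\<close> into the summands,
  and the isomorphisms of the fibres are chosen separately and glued. Every sum, product and shuffle
  below is recognised in this way.\<close>

lemma order_iso_lex_sum: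
  assumes P: "linear_ord P" and I: "linear_ord I" and F: "\<And>i. i \<in> fst I \<Longrightarrow> linear_ord (F i)"
    and \<pi>: "\<And>x. x \<in> fst P \<Longrightarrow> \<pi> x \<in> fst I"
    and mono: "\<And>x y. (x, y) \<in> snd P \<Longrightarrow> \<pi> x = \<pi> y \<or> (\<pi> x, \<pi> y) \<in> snd I"
    and fibre: "\<And>i. i \<in> fst I \<Longrightarrow> order_iso (suborder P {x. \<pi> x = i}) (F i)"
  shows "order_iso P (lex_sum I F)"
proof -
  have "\<forall>i\<in>fst I. \<exists>f. bij_betw f (fst P \<inter> {x. \<pi> x = i}) (fst (F i)) \<and>
    (\<forall>x\<in>fst P. \<forall>y\<in>fst P. \<pi> x = i \<longrightarrow> \<pi> y = i \<longrightarrow> ((x, y) \<in> snd P \<longleftrightarrow> (f x, f y) \<in> snd (F i)))"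
    using fibre unfolding order_iso_def by fastforce
  from bchoice[OF this] obtain f where
    f: "\<And>i. i \<in> fst I \<Longrightarrow> bij_betw (f i) (fst P \<inter> {x. \<pi> x = i}) (fst (F i))"
    and less: "\<And>i x y. i \<in> fst I \<Longrightarrow> x \<in> fst P \<Longrightarrow> y \<in> fst P \<Longrightarrow> \<pi> x = i \<Longrightarrow> \<pi> y = i \<Longrightarrow>
      (x, y) \<in> snd P \<longleftrightarrow> (f i x, f i y) \<in> snd (F i)" by blast
  let ?f = "\<lambda>x. (\<pi> x, f (\<pi> x) x)"
  have mem: "f (\<pi> x) x \<in> fst (F (\<pi> x))" if "x \<in> fst P" for x
    using bij_betwE[OF f[OF \<pi>[OF that]]] that by blast
  show ?thesis
  proof (rule order_isoI[of P "lex_sum I F" ?f])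
    show "linear_ord (lex_sum I F)" using I F by (rule linear_ord_lex_sum)
    show "?f ` fst P = fst (lex_sum I F)"
    proof
      show "?f ` fst P \<subseteq> fst (lex_sum I F)" using \<pi> mem by (auto simp: lex_sum_def)
      show "fst (lex_sum I F) \<subseteq> ?f ` fst P"
      proof
        fix a assume "a \<in> fst (lex_sum I F)"
        then obtain i y where a: "a = (i, y)" "i \<in> fst I" "y \<in> fst (F i)" by (auto simp: lex_sum_def)
        then obtain x where "x \<in> fst P" "\<pi> x = i" "y = f i x"
          using f[OF a(2)] by (auto simp: bij_betw_def)
        with a show "a \<in> ?f ` fst P" by auto
      qed
    qed
    show "(?f x, ?f y) \<in> snd (lex_sum I F)" if "(x, y) \<in> snd P" for x y
    proof -
      have "x \<in> fst P" "y \<in> fst P" using linear_ord_field[OF P that] by auto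
      then show ?thesis
        using mono[OF that] less[of "\<pi> x" x y] that \<pi> mem by (auto simp: mem_lex_sum)
    qed
  qed (rule P)
qed

section \<open>Order-types\<close>

text \<open>\<open>rep\<close> picks a member, so it is meaningful only for a nonempty class. An
  \<open>otype\<close> may be any set of orders; this predicate singles out the genuine
  order-types.\<close>

definition proper :: "otype \<Rightarrow> bool" where
  "proper \<tau> \<longleftrightarrow> (\<exists>P :: nat order. linear_ord P \<and> \<tau> = order_type P)"

lemma proper_order_type:
  assumes "linear_ord P" "countable (fst P)"
  shows "proper (order_type P)"
proof -
  have "rep (order_type P) \<in> order_type P"
    unfolding rep_def using order_type_nonempty[OF assms] by (meson ex_in_conv someI_ex)
  then have "linear_ord (rep (order_type P))" by (simp add: order_type_def)
  moreover have "order_type P = order_type (rep (order_type P))"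
    unfolding order_type_eq_iff[OF assms] using assms by (rule order_iso_rep)
  ultimately show ?thesis unfolding proper_def by blast
qed

lemma linear_ord_rep:
  assumes "proper \<tau>" shows "linear_ord (rep \<tau>)"
proof -
  obtain P :: "nat order" where P: "linear_ord P" "\<tau> = order_type P"
    using assms by (auto simp: proper_def)
  have "rep \<tau> \<in> \<tau>"
    unfolding rep_def using order_type_nonempty[OF P(1)] P(2) by (metis ex_in_conv someI_ex uncountable_def countableI_type)
  then show ?thesis by (simp add: P(2) order_type_def)
qed

lemma has_order_type_rep:
  assumes "proper \<tau>" shows "has_order_type P \<tau> \<longleftrightarrow> order_iso P (rep \<tau>)"
proof -
  obtain Q :: "nat order" where Q: "linear_ord Q" "\<tau> = order_type Q"
    using assms by (auto simp: proper_def)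
  have c: "countable (fst Q)" by simp
  show ?thesis
    unfolding Q(2) has_order_type_iff[OF Q(1) c]
    using order_iso_rep[OF Q(1) c] order_iso_trans order_iso_sym by blast
qed

lemma has_order_type_cong:
  "order_iso P Q \<Longrightarrow> has_order_type Q \<tau> \<Longrightarrow> has_order_type P \<tau>"
  unfolding has_order_type_def using order_iso_trans by blast

lemma proper_finite_type: "proper (finite_type k)"
  and proper_omega: "proper omega"
  and proper_zeta: "proper zeta"
  and proper_eta: "proper eta"
  unfolding finite_type_def omega_def zeta_def eta_def
  by (auto intro!: proper_order_type linear_ord_order_on)

lemma proper_reverse: "proper \<tau> \<Longrightarrow> proper (reverse_type \<tau>)"
  unfolding reverse_type_def by (auto intro!: proper_order_type linear_ord_reverse linear_ord_rep)

lemma proper_plus: "proper \<sigma> \<Longrightarrow> proper \<tau> \<Longrightarrow> proper (\<sigma> \<oplus> \<tau>)"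
  unfolding plus_type_def
  by (auto intro!: proper_order_type linear_ord_lex_sum countable_lex_sum linear_ord_order_on linear_ord_rep)

lemma proper_times: "proper \<sigma> \<Longrightarrow> proper \<tau> \<Longrightarrow> proper (\<sigma> \<odot> \<tau>)"
  unfolding times_type_def
  by (auto intro!: proper_order_type linear_ord_lex_sum countable_lex_sum linear_ord_rep)

lemma has_order_type_order_on:
  fixes A :: "'a::linorder set"
  assumes "countable A"
  shows "has_order_type P (order_type (order_on A)) \<longleftrightarrow> order_iso P (order_on A)"
  using assms by (intro has_order_type_iff linear_ord_order_on) (simp add: order_on_def)

text \<open>The upper set \<open>U\<close> is the second summand: membership in \<open>U\<close> is
  the projection to \<open>bool\<close>, where False lies below True.\<close>

lemma has_order_type_plus:
  assumes P: "linear_ord P" and "proper \<sigma>" "proper \<tau>"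
    and less: "\<And>x y. x \<in> fst P \<Longrightarrow> y \<in> fst P \<Longrightarrow> x \<notin> U \<Longrightarrow> y \<in> U \<Longrightarrow> (x, y) \<in> snd P"
    and \<sigma>: "has_order_type (suborder P (- U)) \<sigma>" and \<tau>: "has_order_type (suborder P U) \<tau>"
  shows "has_order_type P (\<sigma> \<oplus> \<tau>)"
proof -
  let ?F = "\<lambda>b. if b then rep \<tau> else rep \<sigma>"
  have lin: "linear_ord (?F b)" for b using assms(2,3) by (simp add: linear_ord_rep)
  have "order_iso P (lex_sum (order_on UNIV) ?F)"
  proof (rule order_iso_lex_sum[where \<pi> = "\<lambda>x. x \<in> U"])
    show "(x \<in> U) = (y \<in> U) \<or> (x \<in> U, y \<in> U) \<in> snd (order_on UNIV)" if "(x, y) \<in> snd P" for x y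
      using that less[of y x] linear_ord_field[OF P that] linear_ord_asym[OF P that]
      by auto
    have "- U = {x. x \<notin> U}" by auto
    then show "order_iso (suborder P {x. (x \<in> U) = i}) (?F i)" for i
      using \<sigma> \<tau> assms(2,3) by (cases i) (simp_all add: has_order_type_rep)
  qed (use P lin linear_ord_order_on in auto)
  then show ?thesis
    unfolding plus_type_def
    using lin by (subst has_order_type_iff)
      (auto intro: linear_ord_lex_sum countable_lex_sum linear_ord_order_on)
qed

text \<open>The rank of a point is its number of predecessors. Ranks increase strictly, those below
  a point fill an initial segment of the naturals, and an infinite carrier makes them
  unbounded.\<close>

lemma has_order_type_omega:
  assumes P: "linear_ord P" and inf: "infinite (fst P)"
    and fin: "\<And>x. x \<in> fst P \<Longrightarrow> finite {y. (y, x) \<in> snd P}"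
  shows "has_order_type P omega"
proof -
  define f where "f x = card {y. (y, x) \<in> snd P}" for x
  have less: "f x < f y" if "(x, y) \<in> snd P" for x y
    unfolding f_def
  proof (rule psubset_card_mono)
    show "finite {z. (z, y) \<in> snd P}" using fin linear_ord_field[OF P that] by blast
    show "{z. (z, x) \<in> snd P} \<subset> {z. (z, y) \<in> snd P}"
      using that linear_ord_trans[OF P] linear_ord_irrefl[OF P] by blast
  qed
  have inj: "inj_on f (fst P)"
    using less linear_ord_total[OF P] unfolding inj_on_def by (metis less_irrefl)
  have below: "f ` {y. (y, x) \<in> snd P} = {..<f x}" if "x \<in> fst P" for x
  proof (rule card_subset_eq)
    show "f ` {y. (y, x) \<in> snd P} \<subseteq> {..<f x}" using less by auto
    have "inj_on f {y. (y, x) \<in> snd P}"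
      using inj linear_ord_field[OF P] by (auto intro: inj_on_subset)
    then show "card (f ` {y. (y, x) \<in> snd P}) = card {..<f x}"
      by (simp add: card_image) (simp add: f_def)
  qed simp
  have "n \<in> f ` fst P" for n
  proof -
    have "infinite (f ` fst P)" using inf inj by (simp add: finite_image_iff)
    then obtain x where x: "x \<in> fst P" "n < f x" by (auto simp: infinite_nat_iff_unbounded)
    then have "n \<in> f ` {y. (y, x) \<in> snd P}" using below by auto
    then show ?thesis using linear_ord_field[OF P] by blast
  qed
  then have "order_iso P (order_on (UNIV :: nat set))"
    using less by (intro order_isoI[where f = f] P linear_ord_order_on) auto
  then show ?thesis unfolding omega_def by (simp add: has_order_type_order_on)
qed

section \<open>Colored dense orders\<close>

text \<open>Since \<open>A\<close> and \<open>B\<close> may be empty, one clause covers density,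
  absence of endpoints and occurrence of each color. It is exactly the extension property that
  back-and-forth consumes.\<close>

definition shuffled :: "'a order \<Rightarrow> ('a \<Rightarrow> 'c) \<Rightarrow> 'c set \<Rightarrow> bool" where
  "shuffled P c Y \<longleftrightarrow> linear_ord P \<and> countable (fst P) \<and> c ` fst P \<subseteq> Y \<and>
     (\<forall>A B \<tau>. finite A \<longrightarrow> finite B \<longrightarrow> A \<subseteq> fst P \<longrightarrow> B \<subseteq> fst P \<longrightarrow> A \<times> B \<subseteq> snd P \<longrightarrow> \<tau> \<in> Y \<longrightarrow>
       (\<exists>z\<in>fst P. c z = \<tau> \<and> (\<forall>a\<in>A. (a, z) \<in> snd P) \<and> (\<forall>b\<in>B. (z, b) \<in> snd P)))"

lemma shuffledD:
  assumes "shuffled P c Y"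
  shows "linear_ord P" "countable (fst P)" "x \<in> fst P \<Longrightarrow> c x \<in> Y"
proof -
  note d = assms[unfolded shuffled_def]
  show "linear_ord P" using d by (rule conjunct1)
  show "countable (fst P)" using d[THEN conjunct2] by (rule conjunct1)
  show "x \<in> fst P \<Longrightarrow> c x \<in> Y" using d[THEN conjunct2, THEN conjunct2, THEN conjunct1] by blast
qed

lemma shuffled_between:
  assumes "shuffled P c Y" "finite A" "finite B" "A \<subseteq> fst P" "B \<subseteq> fst P" "A \<times> B \<subseteq> snd P" "\<tau> \<in> Y"
  shows "\<exists>z\<in>fst P. c z = \<tau> \<and> (\<forall>a\<in>A. (a, z) \<in> snd P) \<and> (\<forall>b\<in>B. (z, b) \<in> snd P)"
  using assms(1) unfolding shuffled_def using assms(2-7) by simp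

lemma shuffled_colors:
  assumes "shuffled P c Y" shows "c ` fst P = Y"
proof
  show "c ` fst P \<subseteq> Y" using shuffledD(3)[OF assms] by blast
  show "Y \<subseteq> c ` fst P"
  proof
    fix \<tau> assume "\<tau> \<in> Y"
    then obtain z where "z \<in> fst P" "c z = \<tau>"
      using shuffled_between[OF assms, of "{}" "{}" \<tau>] by blast
    then show "\<tau> \<in> c ` fst P" by blast
  qed
qed

text \<open>Forgetting the colors allows a comparison with the rationals before any dense coloring
  of them is known to exist.\<close>

lemma shuffled_uncolored:
  assumes P: "shuffled P c Y" and "Y \<noteq> {}"
  shows "shuffled P (\<lambda>_. ()) {()}"
  unfolding shuffled_def
proof (intro conjI allI impI)
  fix A B and u :: unit
  assume AB: "finite A" "finite B" "A \<subseteq> fst P" "B \<subseteq> fst P" "A \<times> B \<subseteq> snd P"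
  obtain \<tau> where "\<tau> \<in> Y" using \<open>Y \<noteq> {}\<close> by blast
  from shuffled_between[OF P AB this] show "\<exists>z\<in>fst P. () = u \<and> (\<forall>a\<in>A. (a, z) \<in> snd P) \<and> (\<forall>b\<in>B. (z, b) \<in> snd P)" by auto
next
  show "linear_ord P" "countable (fst P)" using shuffledD[OF P] by simp_all
  show "(\<lambda>_. ()) ` fst P \<subseteq> {()}" by auto
qed

lemma linear_ord_finite_max:
  assumes P: "linear_ord P" and "finite A" "A \<noteq> {}" "A \<subseteq> fst P"
  shows "\<exists>m\<in>A. \<forall>a\<in>A. a = m \<or> (a, m) \<in> snd P"
  using assms(2-4)
proof (induction A rule: finite_ne_induct)
  case (insert x A)
  then obtain m where m: "m \<in> A" "\<forall>a\<in>A. a = m \<or> (a, m) \<in> snd P" by auto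
  then have "x = m \<or> (x, m) \<in> snd P \<or> (m, x) \<in> snd P"
    using linear_ord_total[OF P, of x m] insert.prems by auto
  then show ?case
  proof (elim disjE)
    assume "(m, x) \<in> snd P"
    then have "\<forall>a\<in>A. (a, x) \<in> snd P" using m linear_ord_trans[OF P, of _ m x] by auto
    then show ?thesis by auto
  qed (use m in auto)
qed simp

text \<open>A nonempty finite set of bounds may be replaced by its maximum or minimum, which leaves
  the four cases given by emptiness of \<open>A\<close> and \<open>B\<close>.\<close>

lemma shuffledI:
  assumes P: "linear_ord P" and "countable (fst P)" "c ` fst P \<subseteq> Y"
    and ne: "\<And>\<tau>. \<tau> \<in> Y \<Longrightarrow> \<exists>z\<in>fst P. c z = \<tau>"
    and btw: "\<And>x y \<tau>. (x, y) \<in> snd P \<Longrightarrow> \<tau> \<in> Y \<Longrightarrow> \<exists>z. (x, z) \<in> snd P \<and> (z, y) \<in> snd P \<and> c z = \<tau>"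
    and below: "\<And>x \<tau>. x \<in> fst P \<Longrightarrow> \<tau> \<in> Y \<Longrightarrow> \<exists>z. (z, x) \<in> snd P \<and> c z = \<tau>"
    and above: "\<And>x \<tau>. x \<in> fst P \<Longrightarrow> \<tau> \<in> Y \<Longrightarrow> \<exists>z. (x, z) \<in> snd P \<and> c z = \<tau>"
  shows "shuffled P c Y"
  unfolding shuffled_def
proof (intro conjI allI impI)
  fix A B \<tau>
  assume A: "finite A" "A \<subseteq> fst P" and B: "finite B" "B \<subseteq> fst P"
    and AB: "A \<times> B \<subseteq> snd P" and \<tau>: "\<tau> \<in> Y"
  have max: "\<exists>m\<in>A. \<forall>z. (m, z) \<in> snd P \<longrightarrow> (\<forall>a\<in>A. (a, z) \<in> snd P)" if ne: "A \<noteq> {}"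
  proof -
    obtain m where m: "m \<in> A" "\<And>a. a \<in> A \<Longrightarrow> a = m \<or> (a, m) \<in> snd P"
      using linear_ord_finite_max[OF P A(1) ne A(2)] by blast
    have "(a, z) \<in> snd P" if "(m, z) \<in> snd P" "a \<in> A" for a z
      using m(2)[OF that(2)] linear_ord_trans[OF P, of a m z] that(1) by blast
    with m(1) show ?thesis by blast
  qed
  have min: "\<exists>m\<in>B. \<forall>z. (z, m) \<in> snd P \<longrightarrow> (\<forall>b\<in>B. (z, b) \<in> snd P)" if "B \<noteq> {}"
  proof -
    have "\<exists>m\<in>B. \<forall>b\<in>B. b = m \<or> (b, m) \<in> snd (reverse_order P)"
      using B by (intro linear_ord_finite_max linear_ord_reverse P that)
        (simp_all add: reverse_order_def)
    then obtain m where m: "m \<in> B" "\<And>b. b \<in> B \<Longrightarrow> b = m \<or> (m, b) \<in> snd P"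
      by (auto simp: reverse_order_def)
    have "(z, b) \<in> snd P" if "(z, m) \<in> snd P" "b \<in> B" for b z
      using m(2)[OF that(2)] linear_ord_trans[OF P, of z m b] that(1) by blast
    with m(1) show ?thesis by blast
  qed
  have fld: "z \<in> fst P" "w \<in> fst P" if "(z, w) \<in> snd P" for z w
    using linear_ord_field[OF P that] by auto
  show "\<exists>z\<in>fst P. c z = \<tau> \<and> (\<forall>a\<in>A. (a, z) \<in> snd P) \<and> (\<forall>b\<in>B. (z, b) \<in> snd P)"
  proof (cases "A = {}"; cases "B = {}")
    assume "A = {}" "B = {}"
    with ne[OF \<tau>] show ?thesis by simp
  next
    assume e: "A = {}" "B \<noteq> {}"
    with min obtain m where m: "m \<in> B" "\<forall>z. (z, m) \<in> snd P \<longrightarrow> (\<forall>b\<in>B. (z, b) \<in> snd P)" by blast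
    then obtain z where z: "(z, m) \<in> snd P" "c z = \<tau>" using below[of m \<tau>] \<tau> B(2) by blast
    have "\<forall>b\<in>B. (z, b) \<in> snd P" using m(2) z(1) by blast
    with e(1) z(2) fld(1)[OF z(1)] show ?thesis by blast
  next
    assume e: "A \<noteq> {}" "B = {}"
    with max obtain m where m: "m \<in> A" "\<forall>z. (m, z) \<in> snd P \<longrightarrow> (\<forall>a\<in>A. (a, z) \<in> snd P)" by blast
    then obtain z where z: "(m, z) \<in> snd P" "c z = \<tau>" using above[of m \<tau>] \<tau> A(2) by blast
    have "\<forall>a\<in>A. (a, z) \<in> snd P" using m(2) z(1) by blast
    with e(2) z(2) fld(2)[OF z(1)] show ?thesis by blast
  next
    assume e: "A \<noteq> {}" "B \<noteq> {}"
    with max obtain m where m: "m \<in> A" "\<forall>z. (m, z) \<in> snd P \<longrightarrow> (\<forall>a\<in>A. (a, z) \<in> snd P)" by blast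
    from e min obtain n where n: "n \<in> B" "\<forall>z. (z, n) \<in> snd P \<longrightarrow> (\<forall>b\<in>B. (z, b) \<in> snd P)" by blast
    have "(m, n) \<in> snd P" using AB m(1) n(1) by blast
    then obtain z where z: "(m, z) \<in> snd P" "(z, n) \<in> snd P" "c z = \<tau>" using btw[of m n \<tau>] \<tau> by blast
    have "\<forall>a\<in>A. (a, z) \<in> snd P" using m(2) z(1) by blast
    moreover have "\<forall>b\<in>B. (z, b) \<in> snd P" using n(2) z(2) by blast
    ultimately show ?thesis using z(3) fld(2)[OF z(1)] by blast
  qed
qed (use assms(1-3) in auto)

section \<open>Back-and-forth for colored dense orders\<close>

definition partial_iso :: "'a order \<Rightarrow> ('a \<Rightarrow> 'c) \<Rightarrow> 'b order \<Rightarrow> ('b \<Rightarrow> 'c) \<Rightarrow> ('a \<times> 'b) set \<Rightarrow> bool" where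
  "partial_iso P c Q d p \<longleftrightarrow> finite p \<and>
     (\<forall>x y. (x, y) \<in> p \<longrightarrow> x \<in> fst P \<and> y \<in> fst Q \<and> c x = d y) \<and>
     (\<forall>x y x' y'. (x, y) \<in> p \<longrightarrow> (x', y') \<in> p \<longrightarrow> ((x, x') \<in> snd P \<longleftrightarrow> (y, y') \<in> snd Q))"

lemma partial_isoI:
  assumes "finite p" "\<And>x y. (x, y) \<in> p \<Longrightarrow> x \<in> fst P \<and> y \<in> fst Q \<and> c x = d y"
    "\<And>x y x' y'. (x, y) \<in> p \<Longrightarrow> (x', y') \<in> p \<Longrightarrow> (x, x') \<in> snd P \<longleftrightarrow> (y, y') \<in> snd Q"
  shows "partial_iso P c Q d p"
  unfolding partial_iso_def using assms by blast

lemma partial_isoD: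
  assumes "partial_iso P c Q d p"
  shows "finite p" "(x, y) \<in> p \<Longrightarrow> x \<in> fst P \<and> y \<in> fst Q \<and> c x = d y"
    "(x, y) \<in> p \<Longrightarrow> (x', y') \<in> p \<Longrightarrow> (x, x') \<in> snd P \<longleftrightarrow> (y, y') \<in> snd Q"
  using assms unfolding partial_iso_def by blast+

lemma partial_iso_converse: "partial_iso P c Q d p \<Longrightarrow> partial_iso Q d P c (p\<inverse>)"
  unfolding partial_iso_def by simp

text \<open>The forth step; the back step is the same lemma for the converse relation. The image of
  \<open>x\<close> has to separate the images of the points below \<open>x\<close> from those of the
  points above \<open>x\<close>, two finite sets that are in the right order because
  \<open>p\<close> preserves it.\<close>

lemma partial_iso_extend:
  assumes P: "linear_ord P" and Q: "shuffled Q d Y" and p: "partial_iso P c Q d p"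
    and x: "x \<in> fst P" "c x \<in> Y"
  shows "\<exists>p'. partial_iso P c Q d p' \<and> p \<subseteq> p' \<and> x \<in> Domain p'"
proof (cases "x \<in> Domain p")
  case True
  with p show ?thesis by blast
next
  case False
  have lQ: "linear_ord Q" using Q by (rule shuffledD)
  note fin = partial_isoD(1)[OF p] and sub = partial_isoD(2)[OF p] and less = partial_isoD(3)[OF p]
  let ?A = "{b. \<exists>a. (a, b) \<in> p \<and> (a, x) \<in> snd P}" and ?B = "{b. \<exists>a. (a, b) \<in> p \<and> (x, a) \<in> snd P}"
  have "?A \<subseteq> snd ` p" "?B \<subseteq> snd ` p" by force+
  then have "finite ?A" "finite ?B" using fin by (meson finite_imageI finite_subset)+
  moreover have "?A \<subseteq> fst Q" "?B \<subseteq> fst Q" using sub by blast+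
  moreover have "(b, b') \<in> snd Q" if "(a, b) \<in> p" "(a, x) \<in> snd P" "(a', b') \<in> p" "(x, a') \<in> snd P"
    for a b a' b'
    using less[OF that(1,3)] linear_ord_trans[OF P that(2,4)] by simp
  then have "?A \<times> ?B \<subseteq> snd Q" by blast
  ultimately have "\<exists>z\<in>fst Q. d z = c x \<and> (\<forall>b\<in>?A. (b, z) \<in> snd Q) \<and> (\<forall>b\<in>?B. (z, b) \<in> snd Q)"
    using x(2) by (intro shuffled_between[OF Q])
  then obtain z where z: "z \<in> fst Q" "d z = c x"
    "\<And>b. b \<in> ?A \<Longrightarrow> (b, z) \<in> snd Q" "\<And>b. b \<in> ?B \<Longrightarrow> (z, b) \<in> snd Q" by blast
  have cmp: "((a, x) \<in> snd P \<longleftrightarrow> (b, z) \<in> snd Q) \<and> ((x, a) \<in> snd P \<longleftrightarrow> (z, b) \<in> snd Q)"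
    if "(a, b) \<in> p" for a b
  proof -
    have "a \<in> fst P" "a \<noteq> x" using that sub False by blast+
    then consider "(a, x) \<in> snd P" | "(x, a) \<in> snd P" using linear_ord_total[OF P _ x(1)] by blast
    then show ?thesis
    proof cases
      case 1
      with z(3)[of b] that show ?thesis
        using linear_ord_asym[OF P, of a x] linear_ord_asym[OF lQ, of b z] by blast
    next
      case 2
      with z(4)[of b] that show ?thesis
        using linear_ord_asym[OF P, of x a] linear_ord_asym[OF lQ, of z b] by blast
    qed
  qed
  have "partial_iso P c Q d (insert (x, z) p)"
  proof (rule partial_isoI)
    show "finite (insert (x, z) p)" using fin by simp
    show "a \<in> fst P \<and> b \<in> fst Q \<and> c a = d b" if "(a, b) \<in> insert (x, z) p" for a b
      using that sub[of a b] x(1) z(1,2) by auto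
    have "(x, x) \<in> snd P \<longleftrightarrow> (z, z) \<in> snd Q" using linear_ord_irrefl P lQ by metis
    then show "(a, a') \<in> snd P \<longleftrightarrow> (b, b') \<in> snd Q"
      if "(a, b) \<in> insert (x, z) p" "(a', b') \<in> insert (x, z) p" for a b a' b'
      using that less[of a b a' b'] cmp[of a b] cmp[of a' b'] by auto
  qed
  then show ?thesis by blast
qed

theorem shuffled_unique:
  assumes P: "shuffled P c Y" and Q: "shuffled Q d Y" and "Y \<noteq> {}"
  shows "\<exists>f. bij_betw f (fst P) (fst Q) \<and> (\<forall>x\<in>fst P. d (f x) = c x) \<and>
    (\<forall>x\<in>fst P. \<forall>y\<in>fst P. (x, y) \<in> snd P \<longleftrightarrow> (f x, f y) \<in> snd Q)"
proof -
  have lin: "linear_ord P" "linear_ord Q" and cnt: "countable (fst P)" "countable (fst Q)"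
    and col: "\<And>x. x \<in> fst P \<Longrightarrow> c x \<in> Y" "\<And>y. y \<in> fst Q \<Longrightarrow> d y \<in> Y"
    using shuffledD[OF P] shuffledD[OF Q] by blast+
  have ne: "fst P \<noteq> {}" "fst Q \<noteq> {}"
    using \<open>Y \<noteq> {}\<close> shuffled_colors[OF P] shuffled_colors[OF Q] by blast+
  let ?a = "from_nat_into (fst P)" and ?b = "from_nat_into (fst Q)"
  \<comment> \<open>Stage \<open>n\<close> puts the \<open>n\<close>-th element of \<open>P\<close>
    into the domain and the \<open>n\<close>-th element of \<open>Q\<close> into the range, so that
    the union of the chain is total on both sides.\<close>
  have "\<exists>r. \<forall>n. partial_iso P c Q d (r n) \<and>
    (r n \<subseteq> r (Suc n) \<and> ?a n \<in> Domain (r (Suc n)) \<and> ?b n \<in> Range (r (Suc n)))"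
  proof (rule dependent_nat_choice)
    have "partial_iso P c Q d {}" by (rule partial_isoI) auto
    then show "\<exists>p. partial_iso P c Q d p" ..
    fix p n assume "partial_iso P c Q d p"
    then obtain p' where p': "partial_iso P c Q d p'" "p \<subseteq> p'" "?a n \<in> Domain p'"
      using partial_iso_extend[OF lin(1) Q, of c p "?a n"] col(1) from_nat_into[OF ne(1)] by blast
    obtain p'' where p'': "partial_iso Q d P c p''" "p'\<inverse> \<subseteq> p''" "?b n \<in> Domain p''"
      using partial_iso_extend[OF lin(2) P partial_iso_converse[OF p'(1)], of "?b n"] col(2)
        from_nat_into[OF ne(2)] by blast
    have "partial_iso P c Q d (p''\<inverse>)" using p''(1) by (rule partial_iso_converse)
    moreover have sub: "p' \<subseteq> p''\<inverse>" using p''(2) by (simp add: converse_subset_swap)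
    then have "p \<subseteq> p''\<inverse>" using p'(2) by simp
    moreover have "?a n \<in> Domain (p''\<inverse>)" using p'(3) Domain_mono[OF sub] by (rule subsetD[rotated])
    moreover have "?b n \<in> Range (p''\<inverse>)" using p''(3) by (simp only: Range_converse)
    ultimately show "\<exists>q. partial_iso P c Q d q \<and> p \<subseteq> q \<and> ?a n \<in> Domain q \<and> ?b n \<in> Range q"
      by blast
  qed
  then obtain r where r: "\<And>n. partial_iso P c Q d (r n)" "\<And>n. r n \<subseteq> r (Suc n)"
    "\<And>n. ?a n \<in> Domain (r (Suc n))" "\<And>n. ?b n \<in> Range (r (Suc n))" by blast
  have mono: "r m \<subseteq> r n" if "m \<le> n" for m n
    using r(2) that by (rule lift_Suc_mono_le)
  define R where "R = (\<Union>n. r n)"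
  have less: "(x, x') \<in> snd P \<longleftrightarrow> (y, y') \<in> snd Q" if xy: "(x, y) \<in> R" "(x', y') \<in> R" for x y x' y'
  proof -
    obtain m n where "(x, y) \<in> r m" "(x', y') \<in> r n" using xy unfolding R_def by blast
    then have "(x, y) \<in> r (max m n)" "(x', y') \<in> r (max m n)"
      using mono[of m "max m n"] mono[of n "max m n"] max.cobounded1 max.cobounded2 by blast+
    then show ?thesis by (rule partial_isoD(3)[OF r(1)])
  qed
  have sub: "x \<in> fst P \<and> y \<in> fst Q \<and> d y = c x" if xy: "(x, y) \<in> R" for x y
  proof -
    obtain n where "(x, y) \<in> r n" using xy unfolding R_def by blast
    with partial_isoD(2)[OF r(1)[of n]] show ?thesis by simp
  qed
  have dom: "\<exists>y. (x, y) \<in> R" if "x \<in> fst P" for x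
    using r(3)[of "to_nat_on (fst P) x"] unfolding from_nat_into_to_nat_on[OF cnt(1) that] R_def
    by blast
  have ran: "\<exists>x. (x, y) \<in> R" if "y \<in> fst Q" for y
    using r(4)[of "to_nat_on (fst Q) y"] unfolding from_nat_into_to_nat_on[OF cnt(2) that] R_def
    by blast
  have uniq: "x = x' \<longleftrightarrow> y = y'" if "(x, y) \<in> R" "(x', y') \<in> R" for x y x' y'
    using less[OF that] less[OF that(2,1)] sub[OF that(1)] sub[OF that(2)]
      linear_ord_total[OF lin(1), of x x'] linear_ord_total[OF lin(2), of y y']
      linear_ord_irrefl[OF lin(1), of x] linear_ord_irrefl[OF lin(2), of y] by auto
  have "\<forall>x\<in>fst P. \<exists>y. (x, y) \<in> R" using dom by blast
  from bchoice[OF this] obtain f where f: "\<And>x. x \<in> fst P \<Longrightarrow> (x, f x) \<in> R" by blast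
  have "bij_betw f (fst P) (fst Q)"
  proof (rule bij_betwI')
    show "f x = f y \<longleftrightarrow> x = y" if "x \<in> fst P" "y \<in> fst P" for x y
      using uniq[OF f[OF that(1)] f[OF that(2)]] by simp
    show "f x \<in> fst Q" if "x \<in> fst P" for x using sub f that by blast
    show "\<exists>x\<in>fst P. y = f x" if y: "y \<in> fst Q" for y
    proof -
      obtain x where x: "(x, y) \<in> R" using ran[OF y] by blast
      then have "x \<in> fst P" using sub by blast
      with uniq[OF x f] show ?thesis by blast
    qed
  qed
  moreover have "\<forall>x\<in>fst P. d (f x) = c x" using f sub by blast
  moreover have "\<forall>x\<in>fst P. \<forall>y\<in>fst P. (x, y) \<in> snd P \<longleftrightarrow> (f x, f y) \<in> snd Q" using f less by blast
  ultimately show ?thesis by blast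
qed

lemma shuffled_rat:
  fixes c :: "rat \<Rightarrow> 'c"
  assumes "range c = Y" "\<And>\<tau> a b. \<tau> \<in> Y \<Longrightarrow> a < b \<Longrightarrow> \<exists>q. a < q \<and> q < b \<and> c q = \<tau>"
  shows "shuffled (order_on UNIV) c Y"
proof (rule shuffledI)
  show "linear_ord (order_on (UNIV :: rat set))" by (rule linear_ord_order_on)
  show "countable (fst (order_on (UNIV :: rat set)))" by simp
  show "c ` fst (order_on UNIV) \<subseteq> Y" by (simp add: assms(1))
  show "\<exists>z\<in>fst (order_on UNIV). c z = \<tau>" if "\<tau> \<in> Y" for \<tau>
    using that unfolding assms(1)[symmetric] by auto
  show "\<exists>z. (z, x) \<in> snd (order_on UNIV) \<and> c z = \<tau>" if "\<tau> \<in> Y" for x \<tau>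
    using assms(2)[OF that, of "x - 1" x] by auto
  show "\<exists>z. (x, z) \<in> snd (order_on UNIV) \<and> c z = \<tau>" if "\<tau> \<in> Y" for x \<tau>
    using assms(2)[OF that, of x "x + 1"] by auto
  show "\<exists>z. (x, z) \<in> snd (order_on UNIV) \<and> (z, y) \<in> snd (order_on UNIV) \<and> c z = \<tau>"
    if "(x, y) \<in> snd (order_on UNIV)" "\<tau> \<in> Y" for x y \<tau>
    using assms(2)[OF that(2), of x y] that(1) by auto
qed

section \<open>Condensing the blocks of an order to the colored rationals\<close>

locale dense_blocks =
  fixes P :: "'a order" and q :: "'a \<Rightarrow> 'b" and c :: "'a \<Rightarrow> 'c" and Y :: "'c set"
  assumes linear: "linear_ord P" and countable: "countable (fst P)"
    and convex: "\<And>x y x' y'. (x, y) \<in> snd P \<Longrightarrow> q x \<noteq> q y \<Longrightarrow> x' \<in> fst P \<Longrightarrow> y' \<in> fst P \<Longrightarrow>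
      q x' = q x \<Longrightarrow> q y' = q y \<Longrightarrow> (x', y') \<in> snd P"
    and color: "\<And>x. x \<in> fst P \<Longrightarrow> c x \<in> Y"
    and color_cong: "\<And>x y. x \<in> fst P \<Longrightarrow> y \<in> fst P \<Longrightarrow> q x = q y \<Longrightarrow> c x = c y"
    and nonempty: "fst P \<noteq> {}"
    and between: "\<And>x y \<tau>. (x, y) \<in> snd P \<Longrightarrow> q x \<noteq> q y \<Longrightarrow> \<tau> \<in> Y \<Longrightarrow>
      \<exists>z. (x, z) \<in> snd P \<and> (z, y) \<in> snd P \<and> q z \<noteq> q x \<and> q z \<noteq> q y \<and> c z = \<tau>"
    and below: "\<And>x \<tau>. x \<in> fst P \<Longrightarrow> \<tau> \<in> Y \<Longrightarrow> \<exists>z. (z, x) \<in> snd P \<and> q z \<noteq> q x \<and> c z = \<tau>"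
    and above: "\<And>x \<tau>. x \<in> fst P \<Longrightarrow> \<tau> \<in> Y \<Longrightarrow> \<exists>z. (x, z) \<in> snd P \<and> q z \<noteq> q x \<and> c z = \<tau>"
begin

text \<open>One representative per block, depending on the value of \<open>q\<close> alone. The
  representatives form the condensed order, so density there is density of blocks.\<close>

definition choice :: "'a \<Rightarrow> 'a" where
  "choice x = (SOME y. y \<in> fst P \<and> q y = q x)"

lemma choice:
  assumes "x \<in> fst P" shows "choice x \<in> fst P" "q (choice x) = q x"
  using someI[of "\<lambda>y. y \<in> fst P \<and> q y = q x" x] assms by (simp_all add: choice_def)

lemma choice_cong: "q x = q y \<Longrightarrow> choice x = choice y"
  by (simp add: choice_def)

definition blocks :: "'a order" where
  "blocks = suborder P (choice ` fst P)"

lemma fst_blocks: "fst blocks = choice ` fst P"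
  using choice(1) unfolding blocks_def by (simp add: image_subset_iff inf.absorb2)

lemma choice_less:
  assumes "(x, y) \<in> snd P" "q x \<noteq> q y" shows "(choice x, choice y) \<in> snd blocks"
proof -
  have "x \<in> fst P" "y \<in> fst P" using linear_ord_field[OF linear assms(1)] by auto
  then show ?thesis
    using convex[OF assms choice(1) choice(1) choice(2) choice(2)] by (simp add: blocks_def)
qed

lemma choice_block:
  assumes "x \<in> fst blocks" shows "choice x = x"
proof -
  obtain y where y: "y \<in> fst P" "x = choice y" using assms by (auto simp: fst_blocks)
  then show ?thesis using choice_cong[OF choice(2)[OF y(1)]] by simp
qed

lemma shuffled_blocks: "shuffled blocks c Y"
proof (rule shuffledI)
  show "linear_ord blocks" unfolding blocks_def using linear by (rule linear_ord_suborder)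
  show "countable (fst blocks)" using countable by (simp add: blocks_def)
  show "c ` fst blocks \<subseteq> Y" using color by (auto simp: blocks_def)
  have c: "c (choice z) = c z" if "z \<in> fst P" for z
    using color_cong[of "choice z" z] choice[OF that] that by simp
  have fld: "x \<in> fst P" "y \<in> fst P" if "(x, y) \<in> snd P" for x y
    using linear_ord_field[OF linear that] by auto
  have bl: "x \<in> fst P \<and> choice x = x" if "x \<in> fst blocks" for x
    using that choice_block[OF that] by (simp add: blocks_def)
  show "\<exists>z\<in>fst blocks. c z = \<tau>" if \<tau>: "\<tau> \<in> Y" for \<tau>
  proof -
    obtain x where "x \<in> fst P" using nonempty by blast
    then obtain z where z: "(z, x) \<in> snd P" "c z = \<tau>" using below[OF _ \<tau>] by blast
    then show ?thesis using c[of z] fld[OF z(1)] by (intro bexI[of _ "choice z"]) (simp_all add: fst_blocks)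
  qed
  show "\<exists>z. (z, x) \<in> snd blocks \<and> c z = \<tau>" if x0: "x \<in> fst blocks" and \<tau>: "\<tau> \<in> Y" for x \<tau>
  proof -
    have x: "x \<in> fst P" "choice x = x" using bl[OF x0] by auto
    then obtain z where z: "(z, x) \<in> snd P" "q z \<noteq> q x" "c z = \<tau>" using below[OF x(1) \<tau>] by blast
    then show ?thesis using choice_less[OF z(1,2)] x(2) c[of z] fld[OF z(1)]
      by (intro exI[of _ "choice z"]) simp
  qed
  show "\<exists>z. (x, z) \<in> snd blocks \<and> c z = \<tau>" if x0: "x \<in> fst blocks" and \<tau>: "\<tau> \<in> Y" for x \<tau>
  proof -
    have x: "x \<in> fst P" "choice x = x" using bl[OF x0] by auto
    then obtain z where z: "(x, z) \<in> snd P" "q z \<noteq> q x" "c z = \<tau>" using above[OF x(1) \<tau>] by blast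
    then show ?thesis using choice_less[OF z(1) z(2)[symmetric]] x(2) c[of z] fld[OF z(1)]
      by (intro exI[of _ "choice z"]) simp
  qed
  show "\<exists>z. (x, z) \<in> snd blocks \<and> (z, y) \<in> snd blocks \<and> c z = \<tau>"
    if xy0: "(x, y) \<in> snd blocks" and \<tau>: "\<tau> \<in> Y" for x y \<tau>
  proof -
    have "x \<in> fst blocks" "y \<in> fst blocks"
      using linear_ord_field[OF \<open>linear_ord blocks\<close> xy0] by auto
    note ch = choice_block[OF this(1)] choice_block[OF this(2)]
    have xy: "(x, y) \<in> snd P" using xy0 by (simp add: blocks_def)
    have "q x \<noteq> q y"
      using choice_cong[of x y] linear_ord_irrefl[OF linear, of x] xy unfolding ch by blast
    from between[OF xy this \<tau>] obtain z where
      z: "(x, z) \<in> snd P" "(z, y) \<in> snd P" "q z \<noteq> q x" "q z \<noteq> q y" "c z = \<tau>" by blast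
    then show ?thesis
      using choice_less[OF z(1) z(3)[symmetric]] choice_less[OF z(2,4)] c[OF fld(2)[OF z(1)]] ch
      by (intro exI[of _ "choice z"]) simp
  qed
qed

text \<open>Whichever dense coloring \<open>d\<close> is given, each rational receives an entire
  block of its color as fibre, which is the situation of \<open>order_iso_lex_sum\<close>.\<close>

lemma projection:
  fixes d :: "rat \<Rightarrow> 'c"
  assumes "range d = Y" "\<And>\<tau> a b. \<tau> \<in> Y \<Longrightarrow> a < b \<Longrightarrow> \<exists>i. a < i \<and> i < b \<and> d i = \<tau>"
  shows "\<exists>\<pi> :: 'a \<Rightarrow> rat. (\<forall>x y. (x, y) \<in> snd P \<longrightarrow> \<pi> x \<le> \<pi> y) \<and>
    (\<forall>i. \<exists>x\<in>fst P. d i = c x \<and> fst P \<inter> {y. \<pi> y = i} = fst P \<inter> {y. q y = q x})"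
proof -
  have "Y \<noteq> {}" using nonempty color by auto
  have "shuffled (order_on UNIV) d Y" using assms by (rule shuffled_rat)
  from shuffled_unique[OF shuffled_blocks this \<open>Y \<noteq> {}\<close>]
  obtain f where f: "bij_betw f (fst blocks) (fst (order_on UNIV))"
    and col: "\<forall>x\<in>fst blocks. d (f x) = c x"
    and less: "\<forall>x\<in>fst blocks. \<forall>y\<in>fst blocks. (x, y) \<in> snd blocks \<longleftrightarrow> (f x, f y) \<in> snd (order_on UNIV)"
    by (elim exE conjE)
  have mem: "choice x \<in> fst blocks" if "x \<in> fst P" for x
    using that by (simp add: fst_blocks)
  show ?thesis
  proof (intro exI[of _ "\<lambda>x. f (choice x)"] conjI allI impI)
    show "f (choice x) \<le> f (choice y)" if "(x, y) \<in> snd P" for x y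
    proof (cases "q x = q y")
      case True
      from choice_cong[OF this] show ?thesis by simp
    next
      case False
      have "x \<in> fst P" "y \<in> fst P" using linear_ord_field[OF linear that] by auto
      then have "(f (choice x), f (choice y)) \<in> snd (order_on UNIV)"
        using choice_less[OF that False] less mem by blast
      then show ?thesis by simp
    qed
    show "\<exists>x\<in>fst P. d i = c x \<and> fst P \<inter> {y. f (choice y) = i} = fst P \<inter> {y. q y = q x}" for i
    proof -
      have "i \<in> f ` fst blocks" using f by (simp add: bij_betw_def)
      then obtain x where x: "x \<in> fst blocks" "i = f x" by blast
      have "f (choice y) = i \<longleftrightarrow> q y = q x" if "y \<in> fst P" for y
      proof
        assume "f (choice y) = i"
        then have "f (choice y) = f x" using x(2) by simp
        then have "choice y = x"
          using inj_onD[OF bij_betw_imp_inj_on[OF f]] mem[OF that] x(1) by blast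
        then show "q y = q x" using choice[OF that] by simp
      next
        assume "q y = q x"
        then show "f (choice y) = i" using choice_cong[of y x] choice_block[OF x(1)] x(2) by simp
      qed
      then have "fst P \<inter> {y. f (choice y) = i} = fst P \<inter> {y. q y = q x}" by blast
      moreover have "x \<in> fst P" using x(1) by (simp add: blocks_def)
      moreover have "d i = c x" using x col by blast
      ultimately show ?thesis by blast
    qed
  qed
qed

text \<open>The coloring is transported instead of constructed: without colors the blocks form a
  countable dense order without endpoints, hence a copy of the rationals, and each rational takes
  the color of the block it corresponds to.\<close>

lemma dense_coloring_exists:
  "\<exists>d :: rat \<Rightarrow> 'c. range d = Y \<and> (\<forall>\<tau>\<in>Y. \<forall>a b. a < b \<longrightarrow> (\<exists>i. a < i \<and> i < b \<and> d i = \<tau>))"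
proof -
  have "Y \<noteq> {}" using nonempty color by auto
  then have "shuffled blocks (\<lambda>_. ()) {()}" by (rule shuffled_uncolored[OF shuffled_blocks])
  moreover have "shuffled (order_on (UNIV :: rat set)) (\<lambda>_. ()) {()}"
    using dense by (intro shuffled_rat) auto
  ultimately have "\<exists>f. bij_betw f (fst blocks) (fst (order_on (UNIV :: rat set))) \<and> (\<forall>x\<in>fst blocks. () = ()) \<and>
    (\<forall>x\<in>fst blocks. \<forall>y\<in>fst blocks. (x, y) \<in> snd blocks \<longleftrightarrow> (f x, f y) \<in> snd (order_on UNIV))"
    by (rule shuffled_unique) simp
  then obtain f :: "'a \<Rightarrow> rat" where f: "bij_betw f (fst blocks) (fst (order_on UNIV))"
    and less: "\<forall>x\<in>fst blocks. \<forall>y\<in>fst blocks. (x, y) \<in> snd blocks \<longleftrightarrow> (f x, f y) \<in> snd (order_on UNIV)"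
    by (elim exE conjE)
  define d where "d i = c (the_inv_into (fst blocks) f i)" for i
  have inj: "inj_on f (fst blocks)" and surj: "f ` fst blocks = UNIV"
    using f by (auto simp: bij_betw_def)
  have d: "d (f x) = c x" if "x \<in> fst blocks" for x
    using the_inv_into_f_f[OF inj that] by (simp add: d_def)
  have cY: "c ` fst blocks = Y" using shuffled_blocks by (rule shuffled_colors)
  have "range d = d ` f ` fst blocks" by (simp only: surj)
  also have "\<dots> = c ` fst blocks" unfolding image_image using d by (intro image_cong) simp_all
  finally have "range d = Y" using cY by simp
  moreover have "\<exists>i. a < i \<and> i < b \<and> d i = \<tau>" if \<tau>: "\<tau> \<in> Y" and less': "a < b" for \<tau> a b
  proof -
    obtain x y where xy: "x \<in> fst blocks" "y \<in> fst blocks" "a = f x" "b = f y"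
      using surj by blast
    then have "{x} \<times> {y} \<subseteq> snd blocks" using less less' by auto
    then obtain z where z: "z \<in> fst blocks" "c z = \<tau>" "(x, z) \<in> snd blocks" "(z, y) \<in> snd blocks"
      using shuffled_between[OF shuffled_blocks, of "{x}" "{y}" \<tau>] xy \<tau> by auto
    then have "f x < f z" "f z < f y" using less xy(1,2) by auto
    then show ?thesis using xy(3,4) d[OF z(1)] z(2) by blast
  qed
  ultimately show ?thesis by blast
qed

end

text \<open>\<open>shuffle\<close> refers to a coloring chosen by \<open>SOME\<close>. Existence
  makes the chosen one dense, and \<open>projection\<close> applies to every dense coloring.\<close>

theorem has_order_type_shuffle:
  assumes "dense_blocks P q c Y" and Y: "\<And>\<tau>. \<tau> \<in> Y \<Longrightarrow> proper \<tau>"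
    and fibre: "\<And>x. x \<in> fst P \<Longrightarrow> has_order_type (suborder P {y. q y = q x}) (c x)"
  shows "has_order_type P (shuffle Y)"
proof -
  interpret dense_blocks P q c Y by fact
  define d where "d = (SOME d. dense_coloring Y d)"
  have "\<exists>d. dense_coloring Y d"
    using dense_coloring_exists unfolding dense_coloring_def by blast
  then have "dense_coloring Y d" unfolding d_def by (rule someI_ex)
  then have d: "range d = Y" "\<And>\<tau> a b. \<tau> \<in> Y \<Longrightarrow> a < b \<Longrightarrow> \<exists>i. a < i \<and> i < b \<and> d i = \<tau>"
    by (auto simp: dense_coloring_def)
  have "\<exists>\<pi> :: 'a \<Rightarrow> rat. (\<forall>x y. (x, y) \<in> snd P \<longrightarrow> \<pi> x \<le> \<pi> y) \<and>
    (\<forall>i. \<exists>x\<in>fst P. d i = c x \<and> fst P \<inter> {y. \<pi> y = i} = fst P \<inter> {y. q y = q x})"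
    using d by (rule projection)
  then obtain \<pi> where \<pi>: "\<forall>x y. (x, y) \<in> snd P \<longrightarrow> \<pi> x \<le> \<pi> y"
    "\<forall>i. \<exists>x\<in>fst P. d i = c x \<and> fst P \<inter> {y. \<pi> y = i} = fst P \<inter> {y. q y = q x}"
    by (elim exE conjE)
  have lin: "linear_ord (rep (d i))" for i using Y d(1) by (auto intro: linear_ord_rep)
  have "order_iso P (lex_sum (order_on UNIV) (\<lambda>i. rep (d i)))"
  proof (rule order_iso_lex_sum)
    show "\<pi> x = \<pi> y \<or> (\<pi> x, \<pi> y) \<in> snd (order_on UNIV)" if "(x, y) \<in> snd P" for x y
      using \<pi>(1)[rule_format, OF that] by auto
    show "order_iso (suborder P {x. \<pi> x = i}) (rep (d i))" for i
    proof -
      obtain x where x: "x \<in> fst P" "d i = c x" "fst P \<inter> {y. \<pi> y = i} = fst P \<inter> {y. q y = q x}"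
        using \<pi>(2) by blast
      have "has_order_type (suborder P {y. \<pi> y = i}) (d i)"
        using fibre[OF x(1)] unfolding suborder_cong[OF x(3) linear] x(2) .
      moreover have "proper (d i)" using Y d(1) by blast
      ultimately show ?thesis by (simp add: has_order_type_rep)
    qed
  qed (auto simp: linear linear_ord_order_on lin)
  then show ?thesis
    unfolding shuffle_def d_def[symmetric]
    using lin by (subst has_order_type_iff)
      (auto intro!: linear_ord_lex_sum countable_lex_sum linear_ord_order_on)
qed

text \<open>The blocks of \<open>P\<close> witness that \<open>Y\<close> has a dense coloring,
  without which \<open>shuffle Y\<close> would be built from an arbitrary map.\<close>

lemma proper_shuffle:
  assumes "dense_blocks P q c Y" "\<And>\<tau>. \<tau> \<in> Y \<Longrightarrow> proper \<tau>"
  shows "proper (shuffle Y)"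
proof -
  interpret dense_blocks P q c Y by fact
  have "\<exists>d. dense_coloring Y d"
    using dense_coloring_exists unfolding dense_coloring_def by blast
  then have "dense_coloring Y (SOME d. dense_coloring Y d)" by (rule someI_ex)
  then have "range (SOME d. dense_coloring Y d) = Y" unfolding dense_coloring_def by (rule conjunct1)
  then have "proper ((SOME d. dense_coloring Y d) i)" for i
    using assms(2)[of "(SOME d. dense_coloring Y d) i"] by blast
  then have "linear_ord (rep ((SOME d. dense_coloring Y d) i))" for i by (rule linear_ord_rep)
  then show ?thesis
    unfolding shuffle_def
    by (intro proper_order_type linear_ord_lex_sum countable_lex_sum linear_ord_order_on) simp_all
qed

theorem has_order_type_times_eta:
  assumes "dense_blocks P q (\<lambda>_. ()) {()}" and \<tau>: "proper \<tau>"
    and fibre: "\<And>x. x \<in> fst P \<Longrightarrow> has_order_type (suborder P {y. q y = q x}) \<tau>"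
  shows "has_order_type P (\<tau> \<odot> eta)"
proof -
  interpret dense_blocks P q "\<lambda>_. ()" "{()}" by fact
  have "\<exists>\<pi> :: 'a \<Rightarrow> rat. (\<forall>x y. (x, y) \<in> snd P \<longrightarrow> \<pi> x \<le> \<pi> y) \<and>
    (\<forall>i. \<exists>x\<in>fst P. () = () \<and> fst P \<inter> {y. \<pi> y = i} = fst P \<inter> {y. q y = q x})"
    by (rule projection) (use dense in auto)
  then obtain \<pi> :: "'a \<Rightarrow> rat" where \<pi>: "\<forall>x y. (x, y) \<in> snd P \<longrightarrow> \<pi> x \<le> \<pi> y"
    "\<forall>i. \<exists>x\<in>fst P. () = () \<and> fst P \<inter> {y. \<pi> y = i} = fst P \<inter> {y. q y = q x}"
    by (elim exE conjE)
  \<comment> \<open>The product is indexed by \<open>rep eta\<close> and not by the rationals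
    themselves; \<open>g\<close> translates between them.\<close>
  have "order_iso (order_on (UNIV :: rat set)) (rep eta)"
    unfolding eta_def by (rule order_iso_rep[OF linear_ord_order_on]) (simp add: order_on_def)
  then obtain g where g: "bij_betw g (UNIV :: rat set) (fst (rep eta))"
    "\<And>i j. i < j \<longleftrightarrow> (g i, g j) \<in> snd (rep eta)"
    by (rule order_isoE) simp
  have "order_iso P (lex_sum (rep eta) (\<lambda>_. rep \<tau>))"
  proof (rule order_iso_lex_sum)
    show "g (\<pi> x) = g (\<pi> y) \<or> (g (\<pi> x), g (\<pi> y)) \<in> snd (rep eta)" if "(x, y) \<in> snd P" for x y
      using \<pi>(1)[rule_format, OF that] g(2) by (auto simp: le_less)
    show "order_iso (suborder P {x. g (\<pi> x) = j}) (rep \<tau>)" if j: "j \<in> fst (rep eta)" for j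
    proof -
      obtain i where i: "j = g i" using g(1) j by (auto simp: bij_betw_def)
      obtain x where x: "x \<in> fst P" "fst P \<inter> {y. \<pi> y = i} = fst P \<inter> {y. q y = q x}"
        using \<pi>(2) by blast
      have e: "fst P \<inter> {x. g (\<pi> x) = j} = fst P \<inter> {y. q y = q x}"
        using x(2) g(1) by (auto simp: i bij_betw_def dest: injD)
      from fibre[OF x(1)] show ?thesis
        unfolding suborder_cong[OF e linear] by (simp add: has_order_type_rep[OF \<tau>])
    qed
    show "g (\<pi> x) \<in> fst (rep eta)" for x using g(1) by (auto simp: bij_betw_def)
  qed (auto simp: linear linear_ord_rep proper_eta \<tau>)
  then show ?thesis
    unfolding times_type_def
    by (subst has_order_type_iff)
      (auto intro!: linear_ord_lex_sum countable_lex_sum linear_ord_rep proper_eta \<tau>)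
qed

section \<open>Germs of partial computable functions\<close>

text \<open>The cofinite filter on C. For cohesive C it decides every c.e. set, as an ultrafilter
  would.\<close>

definition almost :: "nat set \<Rightarrow> nat filter" where
  "almost C = inf cofinite (principal C)"

lemma eventually_almost: "eventually P (almost C) \<longleftrightarrow> finite {n \<in> C. \<not> P n}"
  by (simp add: almost_def eventually_inf_principal eventually_cofinite)

lemma almost_subset_iff: "C \<subseteq>\<^sup>* S \<longleftrightarrow> (\<forall>\<^sub>F n in almost C. n \<in> S)"
proof -
  have "C - S = {n \<in> C. n \<notin> S}" by auto
  then show ?thesis by (simp add: almost_subset_def eventually_almost)
qed

lemma eventually_almost_ge: "\<forall>\<^sub>F n in almost C. k \<le> n"
proof -
  have "{n \<in> C. \<not> k \<le> n} \<subseteq> {..<k}" by auto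
  then show ?thesis unfolding eventually_almost by (rule finite_subset) simp
qed

lemma eventually_almost_mem: "\<forall>\<^sub>F n in almost C. n \<in> C"
  by (simp add: eventually_almost)

lemma eventually_almost_bound:
  assumes "eventually P (almost C)"
  shows "\<exists>N. \<forall>n\<in>C. N \<le> n \<longrightarrow> P n"
proof -
  obtain N where "\<forall>n\<in>{n \<in> C. \<not> P n}. n < N"
    using assms finite_nat_set_iff_bounded unfolding eventually_almost by blast
  then show ?thesis by (intro exI[of _ N]) (auto simp: not_le[symmetric])
qed

section \<open>Germs along a cohesive set and their dichotomies\<close>

locale cohesive_set =
  fixes C :: "nat set"
  assumes cohesive: "cohesive C"
begin

abbreviation almost_all :: "(nat \<Rightarrow> bool) \<Rightarrow> bool"  (binder \<open>\<forall>\<^sup>*\<close> 10) where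
  "almost_all P \<equiv> eventually P (almost C)"

lemma infinite_C: "infinite C"
  using cohesive by (simp add: cohesive_def)

lemma almost_nontrivial: "almost C \<noteq> bot"
  using infinite_C by (simp add: trivial_limit_def eventually_almost)

lemma eventually_False_iff [simp]: "eventually (\<lambda>n. False) (almost C) \<longleftrightarrow> False"
  using almost_nontrivial by (simp add: trivial_limit_def)

lemma almost_contr:
  assumes "eventually P (almost C)" "eventually Q (almost C)" "\<And>n. P n \<Longrightarrow> Q n \<Longrightarrow> False"
  shows False
proof -
  from assms(1,2) have "\<forall>\<^sup>*n. False" by eventually_elim (rule assms(3))
  then show False by simp
qed

text \<open>
  Total functions that agree with a partial computable function almost everywhere on \<open>C\<close>
  serve as representatives of the elements of a cohesive power.
\<close>

definition germ :: "(nat \<Rightarrow> nat) \<Rightarrow> bool" where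
  "germ g \<longleftrightarrow> (\<exists>f. partial_computable f \<and> (\<forall>\<^sup>*n. f n = Some (g n)))"

lemma germ_computable: "computable g \<Longrightarrow> germ g"
  unfolding germ_def computable_def by (intro exI[of _ "\<lambda>n. Some (g n)"]) simp

lemma germ_compose:
  assumes "computable h" "germ g" shows "germ (\<lambda>n. h (g n))"
proof -
  obtain f where f: "partial_computable f" "\<forall>\<^sup>*n. f n = Some (g n)"
    using assms(2) unfolding germ_def by blast
  have "partial_computable (\<lambda>n. Option.bind (f n) (\<lambda>y. Some (h y)))"
    using assms(1) f(1) unfolding computable_def by (rule partial_computable.comp)
  moreover from f(2) have "\<forall>\<^sup>*n. Option.bind (f n) (\<lambda>y. Some (h y)) = Some (h (g n))"
    by eventually_elim simp
  ultimately show ?thesis unfolding germ_def by blast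
qed

lemma germ_pair:
  assumes "germ g" "germ h" shows "germ (\<lambda>n. prod_encode (g n, h n))"
proof -
  obtain f where f: "partial_computable f" "\<forall>\<^sup>*n. f n = Some (g n)"
    using assms(1) unfolding germ_def by blast
  obtain f' where f': "partial_computable f'" "\<forall>\<^sup>*n. f' n = Some (h n)"
    using assms(2) unfolding germ_def by blast
  from f(2) f'(2) have "\<forall>\<^sup>*n.
    Option.bind (f n) (\<lambda>y. Option.bind (f' n) (\<lambda>z. Some (prod_encode (y, z)))) = Some (prod_encode (g n, h n))"
    by eventually_elim simp
  with partial_computable.pair[OF f(1) f'(1)] show ?thesis unfolding germ_def by blast
qed

lemma germ_compose2:
  assumes "computable (\<lambda>z. h (p1 z) (p2 z))" "germ f" "germ g"
  shows "germ (\<lambda>n. h (f n) (g n))"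
  using germ_compose[OF assms(1) germ_pair[OF assms(2,3)]] by simp

lemma germ_const: "germ (\<lambda>_. k)" and germ_id: "germ (\<lambda>n. n)"
  by (rule germ_computable, rule computable_const) (rule germ_computable, rule computable_id)

text \<open>Cohesiveness beyond infinitude enters only here. The inputs for which the search for
  \<open>t\<close> succeeds form a c.e. set, so this set contains almost all of C or misses almost
  all of C.\<close>

lemma germ_semidecide:
  assumes R: "decidable (\<lambda>z. R (p1 z) (p2 z))" and g: "germ g"
  shows "(\<forall>\<^sup>*n. \<exists>t. R (g n) t) \<or> (\<forall>\<^sup>*n. \<forall>t. \<not> R (g n) t)"
proof -
  obtain f where f: "partial_computable f" "\<forall>\<^sup>*n. f n = Some (g n)"
    using g unfolding germ_def by blast
  let ?s = "\<lambda>y. if \<exists>t. R y t then Some (LEAST t. R y t) else None"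
  let ?W = "dom (\<lambda>n. Option.bind (f n) ?s)"
  have "partial_computable (\<lambda>n. Option.bind (f n) ?s)"
    using partial_computable_search[OF R] f(1) by (rule partial_computable.comp)
  then have "ce ?W" unfolding ce_def by blast
  then have "finite (C - ?W) \<or> finite (C \<inter> ?W)" using cohesive by (simp add: cohesive_def)
  moreover have "C - ?W = {n \<in> C. \<not> n \<in> ?W}" "C \<inter> ?W = {n \<in> C. \<not> n \<notin> ?W}" by auto
  ultimately have "(\<forall>\<^sup>*n. n \<in> ?W) \<or> (\<forall>\<^sup>*n. n \<notin> ?W)"
    unfolding eventually_almost by simp
  then show ?thesis
  proof
    assume "\<forall>\<^sup>*n. n \<in> ?W"
    with f(2) have "\<forall>\<^sup>*n. \<exists>t. R (g n) t"
      by eventually_elim (auto simp: domIff split: if_splits)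
    then show ?thesis ..
  next
    assume "\<forall>\<^sup>*n. n \<notin> ?W"
    with f(2) have "\<forall>\<^sup>*n. \<forall>t. \<not> R (g n) t"
      by eventually_elim (simp add: domIff split: if_splits)
    then show ?thesis ..
  qed
qed

lemma germ_decide:
  assumes "decidable P" "germ g"
  shows "(\<forall>\<^sup>*n. P (g n)) \<or> (\<forall>\<^sup>*n. \<not> P (g n))"
  using germ_semidecide[of "\<lambda>y t. P y" g] decidable_compose[OF assms(1) computable_p1[OF computable_id]]
    assms(2) by simp

lemma germ_decide2:
  assumes "decidable (\<lambda>z. P (p1 z) (p2 z))" "germ f" "germ g"
  shows "(\<forall>\<^sup>*n. P (f n) (g n)) \<or> (\<forall>\<^sup>*n. \<not> P (f n) (g n))"
  using germ_decide[OF assms(1) germ_pair[OF assms(2,3)]] by simp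

text \<open>Witnesses along C can be chosen by a germ, since the least one is found by search. In
  the power this plays the part of Skolem functions.\<close>

lemma germ_search:
  assumes R: "decidable (\<lambda>z. R (p1 z) (p2 z))" and g: "germ g"
    and ex: "\<forall>\<^sup>*n. \<exists>t. R (g n) t"
  shows "\<exists>k. germ k \<and> (\<forall>\<^sup>*n. R (g n) (k n))"
proof -
  obtain f where f: "partial_computable f" "\<forall>\<^sup>*n. f n = Some (g n)"
    using g unfolding germ_def by blast
  let ?s = "\<lambda>y. if \<exists>t. R y t then Some (LEAST t. R y t) else None"
  let ?k = "\<lambda>n. LEAST t. R (g n) t"
  have "partial_computable (\<lambda>n. Option.bind (f n) ?s)"
    using partial_computable_search[OF R] f(1) by (rule partial_computable.comp)
  moreover from f(2) ex have "\<forall>\<^sup>*n. Option.bind (f n) ?s = Some (?k n)"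
    by eventually_elim simp
  ultimately have "germ ?k" unfolding germ_def by blast
  moreover from ex have "\<forall>\<^sup>*n. R (g n) (?k n)"
    by eventually_elim (blast intro: LeastI)
  ultimately show ?thesis by blast
qed

text \<open>Equality with each fixed \<open>k\<close> is decided almost everywhere. If it always
  fails, the lower bounds for \<open>u\<close> rise one by one. All divisions into standard and
  nonstandard points originate here.\<close>

lemma germ_const_or_unbounded:
  assumes "germ u"
  shows "(\<exists>k. \<forall>\<^sup>*n. u n = k) \<or> (\<forall>k. \<forall>\<^sup>*n. k \<le> u n)"
proof (rule disjCI)
  assume unb: "\<not> (\<forall>k. \<forall>\<^sup>*n. k \<le> u n)"
  have "\<forall>\<^sup>*n. k \<le> u n" if nc: "\<nexists>k. \<forall>\<^sup>*n. u n = k" for k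
  proof (induction k)
    case (Suc k)
    have "decidable (\<lambda>y. y = k)" by (intro computable_intros)
    from germ_decide[OF this assms] nc have "\<forall>\<^sup>*n. u n \<noteq> k" by blast
    with Suc show ?case by eventually_elim simp
  qed simp
  with unb show "\<exists>k. \<forall>\<^sup>*n. u n = k" by blast
qed

lemma germ_finite_range:
  assumes "germ u" "finite S" "\<forall>\<^sup>*n. u n \<in> S"
  shows "\<exists>k\<in>S. \<forall>\<^sup>*n. u n = k"
proof -
  obtain b where b: "\<forall>k\<in>S. k < b" using assms(2) finite_nat_set_iff_bounded by blast
  have "\<not> (\<forall>\<^sup>*n. b \<le> u n)"
    using almost_contr[of "\<lambda>n. b \<le> u n" "\<lambda>n. u n \<in> S"] assms(3) b by fastforce
  with germ_const_or_unbounded[OF assms(1)]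
  obtain k where k: "\<forall>\<^sup>*n. u n = k" by blast
  have "k \<in> S" using almost_contr[OF k assms(3)] by auto
  with k show ?thesis by blast
qed

lemma not_const_and_unbounded:
  fixes u :: "nat \<Rightarrow> nat"
  assumes "\<forall>\<^sup>*n. u n = k" "\<forall>k. \<forall>\<^sup>*n. k \<le> u n"
  shows False
  using almost_contr[OF assms(1) spec[OF assms(2), of "Suc k"]] by auto

lemma const_unique:
  "\<forall>\<^sup>*n. u n = k \<Longrightarrow> \<forall>\<^sup>*n. u n = k' \<Longrightarrow> k = k'"
  using almost_contr[of "\<lambda>n. u n = k" "\<lambda>n. u n = k'"] by auto

lemma card_C_unbounded: "\<exists>N. \<forall>n\<ge>N. k \<le> card (C \<inter> {..<n})"
proof -
  obtain A where A: "A \<subseteq> C" "finite A" "card A = k"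
    using infinite_C infinite_arbitrarily_large by blast
  obtain N where N: "\<forall>a\<in>A. a < N" using A(2) finite_nat_set_iff_bounded by blast
  have "k \<le> card (C \<inter> {..<n})" if "N \<le> n" for n
  proof -
    have "A \<subseteq> C \<inter> {..<n}" using A(1) N that by fastforce
    then show ?thesis using A(3) card_mono[of "C \<inter> {..<n}" A] by simp
  qed
  then show ?thesis by blast
qed

end

section \<open>Growth of unbounded germs along a co-c.e. cohesive set\<close>

lemma uniform_witness:
  assumes "\<forall>m<n. \<exists>t. Q m t" "\<And>m t t'. Q m t \<Longrightarrow> t \<le> t' \<Longrightarrow> Q m t'"
  shows "\<exists>t::nat. \<forall>m<(n::nat). Q m t"
  using assms(1)
proof (induction n)
  case (Suc n)
  then obtain t where t: "\<forall>m<n. Q m t" by auto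
  from Suc.prems obtain t' where t': "Q n t'" by blast
  have "Q m (max t t')" if "m < Suc n" for m
  proof (cases "m = n")
    case True
    with assms(2)[OF t', of "max t t'"] show ?thesis by simp
  next
    case False
    with t that have "Q m t" by simp
    from assms(2)[OF this, of "max t t'"] show ?thesis by simp
  qed
  then show ?case by blast
qed simp

text \<open>\<open>E m t\<close> says that \<open>m\<close> is seen outside C at stage
  \<open>t\<close>. The stages are not assumed cumulative, so \<open>count\<close> looks at all
  \<open>t \<le> w\<close>.\<close>

locale co_ce_cohesive_set = cohesive_set +
  fixes E :: "nat \<Rightarrow> nat \<Rightarrow> bool"
  assumes decidable_E: "decidable (\<lambda>z. E (p1 z) (p2 z))"
    and E: "\<And>m. m \<notin> C \<longleftrightarrow> (\<exists>t. E m t)"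
begin

text \<open>The approximation to the number of elements of C below \<open>n\<close> known at stage
  \<open>w\<close>: an upper bound that decreases with \<open>w\<close> and is exact at some
  stage.\<close>

definition count :: "nat \<Rightarrow> nat \<Rightarrow> nat" where
  "count w n = card {m. m < n \<and> (\<forall>t\<le>w. \<not> E m t)}"

lemma computable_count:
  assumes "computable w" "computable n" shows "computable (\<lambda>x. count (w x) (n x))"
  unfolding count_def
  by (intro computable_intros decidable_compose2[OF decidable_E] assms computable_compose[OF assms(1)])

lemma count_ge: "card (C \<inter> {..<n}) \<le> count w n"
  unfolding count_def by (rule card_mono) (use E in auto)

lemma count_limit: "\<exists>w. count w n = card (C \<inter> {..<n})"
proof -
  have "\<exists>w. \<forall>m<n. m \<in> C \<or> (\<exists>t\<le>w. E m t)"
  proof (rule uniform_witness)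
    show "\<forall>m<n. \<exists>w. m \<in> C \<or> (\<exists>t\<le>w. E m t)" using E by blast
    show "m \<in> C \<or> (\<exists>t\<le>w'. E m t)" if "m \<in> C \<or> (\<exists>t\<le>w. E m t)" "w \<le> w'" for m w w'
      using that order_trans by blast
  qed
  then obtain w where "\<forall>m<n. m \<in> C \<or> (\<exists>t\<le>w. E m t)" ..
  then have "{m. m < n \<and> (\<forall>t\<le>w. \<not> E m t)} = C \<inter> {..<n}" using E by blast
  then show ?thesis unfolding count_def by metis
qed

text \<open>Ask whether an earlier element of C has the same value. That there is none is
  semidecidable, because leaving C can be observed, so one answer prevails almost everywhere on C.
  If there is none, \<open>u\<close> is injective past a threshold. If there always is one,
  following the collisions downwards leaves only finitely many values, contrary to
  unboundedness.\<close>

lemma germ_eventually_injective: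
  assumes u: "germ u" and unb: "\<forall>k. \<forall>\<^sup>*n. k \<le> u n"
  shows "\<exists>N. inj_on u {n \<in> C. N \<le> n}"
proof -
  obtain f where f: "partial_computable f" "\<forall>\<^sup>*n. f n = Some (u n)"
    using u unfolding germ_def by blast
  obtain n0 where n0: "\<And>n. n \<in> C \<Longrightarrow> n0 \<le> n \<Longrightarrow> f n = Some (u n)"
    using eventually_almost_bound[OF f(2)] by blast
  obtain e where e: "\<And>n y. f n = Some y \<longleftrightarrow> (\<exists>Q. halts e n Q \<and> p1 Q = y)"
    using halts_complete[OF f(1)] by blast
  \<comment> \<open>By stage \<open>t\<close> it is certain that \<open>m\<close> does not collide
    with the value \<open>y\<close>: it lies below the threshold \<open>n0\<close>, has left C, or
    has another value.\<close>
  define D where "D y m t \<longleftrightarrow> m < n0 \<or> (\<exists>s\<le>t. E m s) \<or> (\<exists>Q\<le>t. halts e m Q \<and> p1 Q \<noteq> y)" for y m t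
  define R where "R z t \<longleftrightarrow> (\<forall>m<p1 z. D (p2 z) m t)" for z t
  have "decidable (\<lambda>z. R (p1 z) (p2 z))"
    unfolding R_def D_def by (intro computable_intros decidable_compose2[OF decidable_E])
  note dichotomy = germ_semidecide[OF this germ_pair[OF germ_id u]]
  have D: "(\<exists>t. D (u n) m t) \<longleftrightarrow> \<not> (m \<in> C \<and> n0 \<le> m \<and> u m = u n)" for n m
  proof (cases "m \<in> C \<and> n0 \<le> m")
    case True
    then have "\<not> E m s" for s using E by blast
    moreover have "(\<exists>Q. halts e m Q \<and> p1 Q \<noteq> u n) \<longleftrightarrow> u m \<noteq> u n"
    proof -
      obtain Q where Q: "halts e m Q" "p1 Q = u m" using e[of m] n0[of m] True by auto
      then have "halts e m Q' \<longleftrightarrow> Q' = Q" for Q' using halts_unique by blast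
      with Q(2) show ?thesis by simp
    qed
    ultimately show ?thesis using True by (auto simp: D_def)
  next
    case False
    then show ?thesis unfolding D_def using E[of m] by (meson le_refl not_le)
  qed
  from dichotomy show ?thesis
  proof
    assume "\<forall>\<^sup>*n. \<exists>t. R (prod_encode (n, u n)) t"
    then obtain N where N: "\<And>n. n \<in> C \<Longrightarrow> N \<le> n \<Longrightarrow> \<exists>t. R (prod_encode (n, u n)) t"
      using eventually_almost_bound by blast
    have "u m \<noteq> u n" if "m \<in> C" "max N n0 \<le> m" "n \<in> C" "m < n" for m n
    proof -
      have "\<exists>t. D (u n) m t" using N[of n] that by (auto simp: R_def)
      then show ?thesis using D that by simp
    qed
    then have "inj_on u {n \<in> C. max N n0 \<le> n}"
      by (intro linorder_inj_onI) auto
    then show ?thesis by blast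
  next
    assume "\<forall>\<^sup>*n. \<forall>t. \<not> R (prod_encode (n, u n)) t"
    then obtain N where N: "\<And>n t. n \<in> C \<Longrightarrow> N \<le> n \<Longrightarrow> \<not> R (prod_encode (n, u n)) t"
      using eventually_almost_bound by blast
    have earlier: "\<exists>m<n. m \<in> C \<and> n0 \<le> m \<and> u m = u n" if "n \<in> C" "N \<le> n" for n
    proof (rule ccontr)
      assume "\<not> ?thesis"
      then have "\<forall>m<n. \<exists>t. D (u n) m t" unfolding D by blast
      moreover have "D y m t'" if "D y m t" "t \<le> t'" for y m t t'
        using that unfolding D_def by (meson order_trans)
      ultimately have "\<exists>t. \<forall>m<n. D (u n) m t" by (rule uniform_witness)
      then obtain t where "\<forall>m<n. D (u n) m t" ..
      with N[OF that, of t] show False by (auto simp: R_def)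
    qed
    \<comment> \<open>Descending along equal values from any \<open>n \<ge> n0\<close> in C ends at
      an argument at most \<open>N\<close>, so the values there bound all of them.\<close>
    define k where "k = Suc (Max (u ` {..N}))"
    have "u n < k" if "n \<in> C" "n0 \<le> n" for n
      using that
    proof (induction n rule: less_induct)
      case (less n)
      show ?case
      proof (cases "n \<le> N")
        case True
        then show ?thesis unfolding k_def by (simp add: less_Suc_eq_le)
      next
        case False
        then obtain m where "m < n" "m \<in> C" "n0 \<le> m" "u m = u n"
          using earlier[OF less.prems(1)] by auto
        with less.IH[of m] show ?thesis by simp
      qed
    qed
    then have "\<forall>\<^sup>*n. n \<in> C \<longrightarrow> n0 \<le> n \<longrightarrow> u n < k" by (simp add: always_eventually)
    with eventually_almost_mem[of C] eventually_almost_ge[of n0 C] spec[OF unb, of k]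
    have "\<forall>\<^sup>*n. False" by eventually_elim simp
    then show ?thesis by simp
  qed
qed

text \<open>Eventual injectivity on \<open>C\<close>: slower growth would squeeze too many values below a bound.\<close>

lemma germ_growth:
  assumes u: "germ u" and unb: "\<forall>k. \<forall>\<^sup>*n. k \<le> u n"
  shows "\<forall>\<^sup>*n. \<exists>w. count w n \<le> 2 * u n"
proof -
  define R where "R z w \<longleftrightarrow> count w (p1 z) \<le> 2 * p2 z" for z w
  have "decidable (\<lambda>z. R (p1 z) (p2 z))"
    unfolding R_def by (intro computable_intros computable_count)
  from germ_semidecide[OF this germ_pair[OF germ_id u]]
  show ?thesis
  proof
    assume "\<forall>\<^sup>*n. \<exists>w. R (prod_encode (n, u n)) w"
    then show ?thesis by (simp add: R_def)
  next
    assume "\<forall>\<^sup>*n. \<forall>w. \<not> R (prod_encode (n, u n)) w"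
    then obtain N where "\<And>n w. n \<in> C \<Longrightarrow> N \<le> n \<Longrightarrow> \<not> R (prod_encode (n, u n)) w"
      using eventually_almost_bound by blast
    \<comment> \<open>At the stage where \<open>count\<close> is exact, the failure for all
      \<open>w\<close> becomes a statement about C itself.\<close>
    then have slow: "2 * u n < card (C \<inter> {..<n})" if "n \<in> C" "N \<le> n" for n
    proof -
      obtain w where "count w n = card (C \<inter> {..<n})" using count_limit by blast
      with \<open>\<And>n w. n \<in> C \<Longrightarrow> N \<le> n \<Longrightarrow> \<not> R (prod_encode (n, u n)) w\<close>[OF that, of w]
      show ?thesis by (simp add: R_def)
    qed
    obtain N' where inj: "inj_on u {n \<in> C. N' \<le> n}"
      using germ_eventually_injective[OF assms] by blast
    define b where "b = max N N'"
    define k0 where "k0 = card (C \<inter> {..<b})"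
    \<comment> \<open>Let s be the number of points of C from \<open>b\<close> up to
      \<open>max b c\<close>; this choice gives s at least \<open>k0 + 2\<close>. Slowness puts
      twice each value on them below k0 + s, which is at most 2s - 2, so s distinct values would lie
      below s - 1. The factor 2 is what absorbs the \<open>k0\<close> early points.\<close>
    obtain c where "\<forall>n\<ge>c. 2 * k0 + 2 \<le> card (C \<inter> {..<n})" using card_C_unbounded by blast
    then have big: "2 * k0 + 2 \<le> card (C \<inter> {..<max b c})" by simp
    let ?S = "C \<inter> {b..<max b c}"
    have "C \<inter> {..<max b c} = (C \<inter> {..<b}) \<union> ?S" by auto
    then have "card (C \<inter> {..<max b c}) = k0 + card ?S"
      unfolding k0_def by (simp add: card_Un_disjoint disjoint_iff)
    then have k: "card (C \<inter> {..<max b c}) = k0 + card ?S" "k0 + 2 \<le> card ?S" using big by auto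
    have "u ` ?S \<subseteq> {..<card ?S - 1}"
    proof
      fix y assume "y \<in> u ` ?S"
      then obtain n where n: "n \<in> C" "b \<le> n" "n < max b c" "y = u n" by auto
      then have "2 * y < card (C \<inter> {..<n})" using slow[of n] by (simp add: b_def)
      also have "\<dots> \<le> card (C \<inter> {..<max b c})" using n(3) by (intro card_mono) auto
      finally have "2 * y < k0 + card ?S" unfolding k(1) .
      with k(2) have "y < card ?S - 1" by linarith
      then show "y \<in> {..<card ?S - 1}" by simp
    qed
    then have "card (u ` ?S) \<le> card ?S - 1" using card_mono[of "{..<card ?S - 1}"] by fastforce
    moreover have "inj_on u ?S" using inj by (rule inj_on_subset) (auto simp: b_def)
    then have "card (u ` ?S) = card ?S" by (rule card_image)
    ultimately have False using k(2) by linarith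
    then show ?thesis ..
  qed
qed

end

lemma order_iso_reverse:
  assumes "order_iso P Q" shows "order_iso (reverse_order P) (reverse_order Q)"
proof -
  obtain f where "bij_betw f (fst P) (fst Q)"
    "\<And>x y. x \<in> fst P \<Longrightarrow> y \<in> fst P \<Longrightarrow> (x, y) \<in> snd P \<longleftrightarrow> (f x, f y) \<in> snd Q"
    using assms unfolding order_iso_def by blast
  then show ?thesis
    unfolding order_iso_def reverse_order_def by (intro exI[of _ f]) simp
qed

lemma has_order_type_reverse:
  assumes "has_order_type (reverse_order P) \<tau>" "proper \<tau>"
  shows "has_order_type P (reverse_type \<tau>)"
proof -
  have "order_iso (reverse_order (reverse_order P)) (reverse_order (rep \<tau>))"
    using assms by (intro order_iso_reverse) (simp add: has_order_type_rep)
  then have "order_iso P (reverse_order (rep \<tau>))" by (simp add: reverse_order_def)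
  then show ?thesis
    unfolding reverse_type_def using linear_ord_rep[OF assms(2)]
    by (subst has_order_type_iff) (simp_all add: linear_ord_reverse)
qed

context cohesive_set
begin

lemma germ_add: "germ f \<Longrightarrow> germ g \<Longrightarrow> germ (\<lambda>n. f n + g n)"
  and germ_diff: "germ f \<Longrightarrow> germ g \<Longrightarrow> germ (\<lambda>n. f n - g n)"
  by (rule germ_compose2, intro computable_intros; assumption)+

lemma germ_half: "germ f \<Longrightarrow> germ (\<lambda>n. f n div 2)"
  by (rule germ_compose[of "\<lambda>y. y div 2"], intro computable_intros)

end

section \<open>Initial segments of the cohesive power of \<open>\<omega>\<close>\<close>

text \<open>All germs below \<open>a\<close>, given up to almost equality by the evaluation
  \<open>v\<close>. Keeping the points abstract makes one block of the power an instance, with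
  \<open>v\<close> the place inside the block and \<open>a\<close> its size.\<close>

locale germ_segment = cohesive_set +
  fixes P :: "'s order" and v :: "'s \<Rightarrow> nat \<Rightarrow> nat" and a :: "nat \<Rightarrow> nat"
  assumes linear: "linear_ord P" and countable: "countable (fst P)"
    and germ_v: "\<And>x. x \<in> fst P \<Longrightarrow> germ (v x)"
    and below_a: "\<And>x. x \<in> fst P \<Longrightarrow> \<forall>\<^sup>*n. v x n < a n"
    and surj: "\<And>g. germ g \<Longrightarrow> \<forall>\<^sup>*n. g n < a n \<Longrightarrow>
      \<exists>x\<in>fst P. \<forall>\<^sup>*n. v x n = g n"
    and less: "\<And>x y. x \<in> fst P \<Longrightarrow> y \<in> fst P \<Longrightarrow>
      (x, y) \<in> snd P \<longleftrightarrow> (\<forall>\<^sup>*n. v x n < v y n)"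
    and germ_a: "germ a"
begin

lemma v_less: "(x, y) \<in> snd P \<Longrightarrow> \<forall>\<^sup>*n. v x n < v y n"
  using less linear_ord_field[OF linear] by blast

lemma has_order_type_finite:
  assumes k: "\<forall>\<^sup>*n. a n = k"
  shows "has_order_type P (finite_type k)"
proof -
  have "\<exists>i\<in>{..<k}. \<forall>\<^sup>*n. v x n = i" if "x \<in> fst P" for x
  proof (rule germ_finite_range[OF germ_v[OF that]])
    show "\<forall>\<^sup>*n. v x n \<in> {..<k}"
      using k below_a[OF that] by eventually_elim simp
  qed simp
  then have "\<forall>x\<in>fst P. \<exists>i. i < k \<and> (\<forall>\<^sup>*n. v x n = i)" by blast
  from bchoice[OF this] obtain f where f: "\<And>x. x \<in> fst P \<Longrightarrow> f x < k"
    "\<And>x. x \<in> fst P \<Longrightarrow> \<forall>\<^sup>*n. v x n = f x" by blast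
  have "order_iso P (order_on {..<k})"
  proof (rule order_isoI[OF linear linear_ord_order_on, of f])
    show "f ` fst P = fst (order_on {..<k})"
    proof
      show "f ` fst P \<subseteq> fst (order_on {..<k})" using f(1) by auto
      show "fst (order_on {..<k}) \<subseteq> f ` fst P"
      proof
        fix i assume "i \<in> fst (order_on {..<k})"
        then have "\<forall>\<^sup>*n. i < a n" using k by (auto elim: eventually_mono)
        then obtain x where x: "x \<in> fst P" "\<forall>\<^sup>*n. v x n = i"
          using surj[OF germ_const] by blast
        then have "f x = i" using const_unique[OF f(2)] by blast
        with x(1) show "i \<in> f ` fst P" by blast
      qed
    qed
    show "(f x, f y) \<in> snd (order_on {..<k})" if "(x, y) \<in> snd P" for x y
    proof -
      have xy: "x \<in> fst P" "y \<in> fst P" using linear_ord_field[OF linear that] by auto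
      have "\<forall>\<^sup>*n. f x < f y"
        using v_less[OF that] f(2)[OF xy(1)] f(2)[OF xy(2)] by eventually_elim simp
      then have "f x < f y" using almost_nontrivial by (simp add: eventually_const)
      with f(1) xy show ?thesis by simp
    qed
  qed
  then show ?thesis unfolding finite_type_def by (simp add: has_order_type_order_on)
qed

definition standard :: "'s set" where
  "standard = {x. \<exists>k. \<forall>\<^sup>*n. v x n = k}"

text \<open>The points at finite distance from the top. Values stay below \<open>a\<close>, so the
  last point is the one with \<open>k = 0\<close>, whence \<open>Suc k\<close>.\<close>

definition costandard :: "'s set" where
  "costandard = {x. \<exists>k. \<forall>\<^sup>*n. a n = v x n + Suc k}"

definition middle :: "'s set" where
  "middle = {x. \<forall>k. \<forall>\<^sup>*n. k \<le> v x n \<and> v x n + k < a n}"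

text \<open>Finite signed distance; the integer becomes the coordinate within a copy of
  zeta.\<close>

definition near :: "'s \<Rightarrow> 's \<Rightarrow> int \<Rightarrow> bool" where
  "near x y k \<longleftrightarrow> (\<forall>\<^sup>*n. int (v y n) = int (v x n) + k)"

definition block :: "'s \<Rightarrow> 's set" where
  "block x = {y \<in> fst P. \<exists>k. near x y k}"

lemma near_refl: "near x x 0"
  by (simp add: near_def)

lemma near_sym: "near x y k \<Longrightarrow> near y x (- k)"
  unfolding near_def by (erule eventually_mono) simp

lemma near_trans: "near x y k \<Longrightarrow> near y z l \<Longrightarrow> near x z (k + l)"
  unfolding near_def by (erule (1) eventually_elim2) simp

lemma block_eq_iff:
  assumes "x \<in> fst P" "y \<in> fst P"
  shows "block x = block y \<longleftrightarrow> (\<exists>k. near x y k)"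
proof
  assume "block x = block y"
  then have "y \<in> block x" using assms(2) near_refl unfolding block_def by blast
  then show "\<exists>k. near x y k" by (simp add: block_def)
next
  assume "\<exists>k. near x y k"
  then obtain k where "near x y k" ..
  then show "block x = block y"
    unfolding block_def using near_sym near_trans by blast
qed

lemma far:
  assumes xy: "x \<in> fst P" "y \<in> fst P" and k: "\<And>k. \<forall>\<^sup>*n. v x n + k < v y n"
  shows "(x, y) \<in> snd P" "block x \<noteq> block y"
proof -
  show "(x, y) \<in> snd P" using k[of 0] less[OF xy] by simp
  have "\<not> near x y i" for i
  proof
    assume "near x y i"
    with k[of "nat i"] show False
      unfolding near_def by (rule almost_contr) linarith
  qed
  then show "block x \<noteq> block y" unfolding block_eq_iff[OF xy] by blast
qed

text \<open>The distance is itself a germ, so it is constant or exceeds every \<open>k\<close>; a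
  constant one would put both points into the same block.\<close>

lemma farD:
  assumes xy: "(x, y) \<in> snd P" and far: "block x \<noteq> block y"
  shows "\<forall>\<^sup>*n. v x n + k < v y n"
proof -
  have fld: "x \<in> fst P" "y \<in> fst P" using linear_ord_field[OF linear xy] by auto
  have "germ (\<lambda>n. v y n - v x n)" using fld by (intro germ_diff germ_v)
  then consider i where "\<forall>\<^sup>*n. v y n - v x n = i"
    | "\<forall>k. \<forall>\<^sup>*n. k \<le> v y n - v x n"
    using germ_const_or_unbounded by blast
  then show ?thesis
  proof cases
    case 1
    from 1 v_less[OF xy] have "near x y (int i)"
      unfolding near_def by eventually_elim linarith
    with far show ?thesis unfolding block_eq_iff[OF fld] by blast
  next
    case 2
    from spec[OF 2, of "Suc k"] show ?thesis by eventually_elim linarith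
  qed
qed

end

section \<open>Segments of unbounded length have type alpha\<close>

locale long_germ_segment = germ_segment +
  assumes unbounded: "\<And>k. \<forall>\<^sup>*n. k \<le> a n"
begin

lemma cases_position:
  assumes "x \<in> fst P" "x \<notin> standard" "x \<notin> costandard"
  shows "x \<in> middle"
proof -
  have 1: "\<forall>\<^sup>*n. k \<le> v x n" for k
    using germ_const_or_unbounded[OF germ_v[OF assms(1)]] assms(2)
    unfolding standard_def by blast
  have "germ (\<lambda>n. a n - v x n)" using assms(1) by (intro germ_diff germ_a germ_v)
  then consider i where "\<forall>\<^sup>*n. a n - v x n = i"
    | "\<forall>k. \<forall>\<^sup>*n. k \<le> a n - v x n"
    using germ_const_or_unbounded by blast
  then have 2: "\<forall>\<^sup>*n. v x n + k < a n" for k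
  proof cases
    case 1
    \<comment> \<open>The constant \<open>i\<close> is positive because \<open>v x\<close> stays
      below \<open>a\<close>, so \<open>Suc (i - 1)\<close> equals \<open>i\<close>.\<close>
    from 1 below_a[OF assms(1)] have "\<forall>\<^sup>*n. a n = v x n + Suc (i - 1)"
      by eventually_elim linarith
    with assms(3) show ?thesis unfolding costandard_def by blast
  next
    case 2
    from spec[OF 2, of "Suc k"] show ?thesis by eventually_elim linarith
  qed
  have "\<forall>\<^sup>*n. k \<le> v x n \<and> v x n + k < a n" for k
    using 1[of k] 2[of k] by eventually_elim simp
  then show ?thesis unfolding middle_def by blast
qed

lemma middleD:
  assumes "x \<in> middle"
  shows "\<forall>\<^sup>*n. k \<le> v x n" "\<forall>\<^sup>*n. v x n + k < a n"
  using assms unfolding middle_def by (auto elim: eventually_mono)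

lemma middle_not_standard: "x \<in> middle \<Longrightarrow> x \<notin> standard"
  using not_const_and_unbounded[of "v x"] middleD(1) unfolding standard_def by blast

lemma middle_not_costandard:
  assumes "x \<in> middle" shows "x \<notin> costandard"
proof
  assume "x \<in> costandard"
  then obtain k where k: "\<forall>\<^sup>*n. a n = v x n + Suc k" unfolding costandard_def by blast
  from almost_contr[OF k middleD(2)[OF assms, of "Suc k"]] show False by simp
qed

lemma standard_not_costandard:
  assumes "x \<in> standard" shows "x \<notin> costandard"
proof
  assume "x \<in> costandard"
  then obtain k where k: "\<forall>\<^sup>*n. a n = v x n + Suc k" unfolding costandard_def by blast
  obtain i where i: "\<forall>\<^sup>*n. v x n = i" using assms unfolding standard_def by blast
  from k i have "\<forall>\<^sup>*n. a n = i + Suc k" by eventually_elim simp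
  then show False using not_const_and_unbounded unbounded by blast
qed

lemma type_standard: "has_order_type (suborder P standard) omega"
proof -
  have "\<forall>x\<in>fst P \<inter> standard. \<exists>i. \<forall>\<^sup>*n. v x n = i" unfolding standard_def by blast
  from bchoice[OF this] obtain f where
    f: "\<And>x. x \<in> fst P \<Longrightarrow> x \<in> standard \<Longrightarrow> \<forall>\<^sup>*n. v x n = f x" by blast
  have "order_iso (suborder P standard) (order_on (UNIV :: nat set))"
  proof (rule order_isoI[OF linear_ord_suborder[OF linear] linear_ord_order_on, of f])
    have "i \<in> f ` (fst P \<inter> standard)" for i
    proof -
      have "\<forall>\<^sup>*n. i < a n" using unbounded[of "Suc i"] by eventually_elim simp
      then obtain x where x: "x \<in> fst P" "\<forall>\<^sup>*n. v x n = i"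
        using surj[OF germ_const] by blast
      then have "x \<in> standard" unfolding standard_def by blast
      with x have "f x = i" using const_unique[OF f] by blast
      with x \<open>x \<in> standard\<close> show ?thesis by blast
    qed
    then show "f ` fst (suborder P standard) = fst (order_on UNIV)" by auto
    show "(f x, f y) \<in> snd (order_on UNIV)" if "(x, y) \<in> snd (suborder P standard)" for x y
    proof -
      from that have xy: "(x, y) \<in> snd P" "x \<in> standard" "y \<in> standard" by auto
      then have fld: "x \<in> fst P" "y \<in> fst P" using linear_ord_field[OF linear xy(1)] by auto
      from v_less[OF xy(1)] f[OF fld(1) xy(2)] f[OF fld(2) xy(3)]
      have "\<forall>\<^sup>*n. f x < f y" by eventually_elim linarith
      then show ?thesis using almost_nontrivial by (simp add: eventually_const)
    qed
  qed
  then show ?thesis unfolding omega_def by (simp add: has_order_type_order_on)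
qed

lemma type_costandard: "has_order_type (suborder P costandard) (reverse_type omega)"
proof (rule has_order_type_reverse[OF _ proper_omega])
  let ?P = "reverse_order (suborder P costandard)"
  have "\<forall>x\<in>fst P \<inter> costandard. \<exists>i. \<forall>\<^sup>*n. a n = v x n + Suc i"
    unfolding costandard_def by blast
  from bchoice[OF this] obtain f where
    f: "\<And>x. x \<in> fst P \<Longrightarrow> x \<in> costandard \<Longrightarrow> \<forall>\<^sup>*n. a n = v x n + Suc (f x)" by blast
  have "order_iso ?P (order_on (UNIV :: nat set))"
  proof (rule order_isoI[OF linear_ord_reverse[OF linear_ord_suborder[OF linear]] linear_ord_order_on, of f])
    have "i \<in> f ` (fst P \<inter> costandard)" for i
    proof -
      have "\<forall>\<^sup>*n. a n - Suc i < a n" using unbounded[of "Suc i"] by eventually_elim simp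
      then obtain x where x: "x \<in> fst P" "\<forall>\<^sup>*n. v x n = a n - Suc i"
        using surj[OF germ_diff[OF germ_a germ_const]] by blast
      from x(2) unbounded[of "Suc i"] have i: "\<forall>\<^sup>*n. a n = v x n + Suc i"
        by eventually_elim simp
      then have c: "x \<in> costandard" unfolding costandard_def by blast
      from f[OF x(1) c] i have "\<forall>\<^sup>*n. f x = i" by eventually_elim simp
      then have "f x = i" using almost_nontrivial by (simp add: eventually_const)
      with x(1) c show ?thesis by blast
    qed
    then show "f ` fst ?P = fst (order_on UNIV)" by (auto simp: reverse_order_def)
    show "(f x, f y) \<in> snd (order_on UNIV)" if "(x, y) \<in> snd ?P" for x y
    proof -
      from that have xy: "(y, x) \<in> snd P" "x \<in> costandard" "y \<in> costandard"
        by (auto simp: reverse_order_def)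
      then have fld: "x \<in> fst P" "y \<in> fst P" using linear_ord_field[OF linear xy(1)] by auto
      from v_less[OF xy(1)] f[OF fld(1) xy(2)] f[OF fld(2) xy(3)]
      have "\<forall>\<^sup>*n. f x < f y" by eventually_elim linarith
      then show ?thesis using almost_nontrivial by (simp add: eventually_const)
    qed
  qed
  then show "has_order_type ?P omega" unfolding omega_def by (simp add: has_order_type_order_on)
qed

lemma type_block:
  assumes x: "x \<in> fst P" "x \<in> middle"
  shows "has_order_type (suborder (suborder P middle) {y. block y = block x}) zeta"
proof -
  let ?S = "middle \<inter> {y. block y = block x}"
  have "\<exists>k. near x y k" if "y \<in> fst P" "block y = block x" for y
    using that block_eq_iff[OF x(1) that(1)] by simp
  then have "\<forall>y\<in>fst P \<inter> ?S. \<exists>k. near x y k" by blast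
  from bchoice[OF this] obtain f where f: "\<And>y. y \<in> fst P \<Longrightarrow> y \<in> ?S \<Longrightarrow> near x y (f y)" by blast
  have "order_iso (suborder P ?S) (order_on (UNIV :: int set))"
  proof (rule order_isoI[OF linear_ord_suborder[OF linear] linear_ord_order_on, of f])
    have "k \<in> f ` (fst P \<inter> ?S)" for k
    proof -
      \<comment> \<open>The germ \<open>v x + k\<close> for either sign of \<open>k\<close>.
        Truncation at 0 happens at finitely many elements of C only, as \<open>v x\<close> is
        unbounded.\<close>
      let ?g = "\<lambda>n. v x n + nat k - nat (- k)"
      have "germ ?g" using x(1) by (intro germ_add germ_diff germ_v germ_const)
      moreover have "\<forall>\<^sup>*n. ?g n < a n"
        using middleD(2)[OF x(2), of "nat k"] by eventually_elim linarith
      ultimately obtain y where y: "y \<in> fst P" "\<forall>\<^sup>*n. v y n = ?g n" using surj by blast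
      from y(2) middleD(1)[OF x(2), of "nat (- k)"] have near: "near x y k"
        unfolding near_def by eventually_elim linarith
      then have "block y = block x" using block_eq_iff[OF x(1) y(1)] by blast
      moreover have "y \<in> middle"
        unfolding middle_def
      proof (intro CollectI allI)
        fix l
        from y(2) middleD(1)[OF x(2), of "l + nat (- k)"] middleD(2)[OF x(2), of "l + nat k"]
        show "\<forall>\<^sup>*n. l \<le> v y n \<and> v y n + l < a n" by eventually_elim linarith
      qed
      ultimately have S: "y \<in> ?S" by blast
      have "\<forall>\<^sup>*n. f y = k"
        using f[OF y(1) S] near unfolding near_def by eventually_elim simp
      then have "f y = k" using almost_nontrivial by (simp add: eventually_const)
      with y(1) S show ?thesis by blast
    qed
    then show "f ` fst (suborder P ?S) = fst (order_on UNIV)" by auto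
    show "(f y, f z) \<in> snd (order_on UNIV)" if "(y, z) \<in> snd (suborder P ?S)" for y z
    proof -
      from that have yz: "(y, z) \<in> snd P" "y \<in> ?S" "z \<in> ?S" by auto
      then have fld: "y \<in> fst P" "z \<in> fst P" using linear_ord_field[OF linear yz(1)] by auto
      from v_less[OF yz(1)] f[OF fld(1) yz(2)] f[OF fld(2) yz(3)]
      have "\<forall>\<^sup>*n. f y < f z" unfolding near_def by eventually_elim linarith
      then show ?thesis using almost_nontrivial by (simp add: eventually_const)
    qed
  qed
  then show ?thesis
    unfolding zeta_def suborder_suborder by (simp add: has_order_type_order_on)
qed

lemma middle_point:
  assumes "germ g" "\<And>k. \<forall>\<^sup>*n. k \<le> g n" "\<And>k. \<forall>\<^sup>*n. g n + k < a n"
  shows "\<exists>x\<in>fst (suborder P middle). \<forall>\<^sup>*n. v x n = g n"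
proof -
  from assms(3)[of 0] have "\<forall>\<^sup>*n. g n < a n" by simp
  then obtain x where x: "x \<in> fst P" "\<forall>\<^sup>*n. v x n = g n" using surj assms(1) by blast
  have "x \<in> middle"
    unfolding middle_def
  proof (intro CollectI allI)
    fix k
    from x(2) assms(2)[of k] assms(3)[of k]
    show "\<forall>\<^sup>*n. k \<le> v x n \<and> v x n + k < a n" by eventually_elim simp
  qed
  with x show ?thesis by auto
qed

text \<open>Averages supply the new points: the midpoint of two points at infinite distance is
  infinitely far from both, half of \<open>v x\<close> lies in a lower block, and the mean of
  \<open>v x\<close> and \<open>a\<close> in a higher one.\<close>

lemma middle_blocks: "dense_blocks (suborder P middle) block (\<lambda>_. ()) {()}"
proof
  let ?P = "suborder P middle"
  show "linear_ord ?P" using linear by (rule linear_ord_suborder)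
  show "countable (fst ?P)" using countable by simp
  show "(x', y') \<in> snd ?P"
    if xy: "(x, y) \<in> snd ?P" and ne: "block x \<noteq> block y" and x': "x' \<in> fst ?P" and y': "y' \<in> fst ?P"
      and bx: "block x' = block x" and by': "block y' = block y" for x y x' y'
  proof -
    have fld: "x \<in> fst P" "y \<in> fst P" "x' \<in> fst P" "y' \<in> fst P"
      using xy x' y' linear_ord_field[OF linear, of x y] by auto
    obtain k where k: "near x x' k" using block_eq_iff[OF fld(1,3)] bx by auto
    obtain l where l: "near y y' l" using block_eq_iff[OF fld(2,4)] by' by auto
    have "(x, y) \<in> snd P" using xy by simp
    \<comment> \<open>\<open>x'\<close> lies at most \<open>nat k\<close> above \<open>x\<close> and
      \<open>y'\<close> at most \<open>nat (- l)\<close> below \<open>y\<close>; the gap between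
      \<open>x\<close> and \<open>y\<close> exceeds both together.\<close>
    from farD[OF this ne, of "nat k + nat (- l)"] k l
    have "\<forall>\<^sup>*n. v x' n < v y' n" unfolding near_def by eventually_elim linarith
    then show ?thesis using less fld x' y' by simp
  qed
  have half: "\<exists>z\<in>fst ?P. \<forall>\<^sup>*n. v z n = a n div 2"
  proof (rule middle_point[OF germ_half[OF germ_a]])
    show "\<forall>\<^sup>*n. k \<le> a n div 2" for k
      using unbounded[of "2 * k"] by eventually_elim simp
    show "\<forall>\<^sup>*n. a n div 2 + k < a n" for k
      using unbounded[of "2 * k + 2"] by eventually_elim simp
  qed
  then show "fst ?P \<noteq> {}" by blast
  show "\<exists>z. (x, z) \<in> snd ?P \<and> (z, y) \<in> snd ?P \<and> block z \<noteq> block x \<and> block z \<noteq> block y \<and> () = u"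
    if xy: "(x, y) \<in> snd ?P" and ne: "block x \<noteq> block y" for x y u
  proof -
    have xy': "(x, y) \<in> snd P" "x \<in> middle" "y \<in> middle" using xy by auto
    have fld: "x \<in> fst P" "y \<in> fst P" using linear_ord_field[OF linear xy'(1)] by auto
    have "\<exists>z\<in>fst ?P. \<forall>\<^sup>*n. v z n = (v x n + v y n) div 2"
    proof (rule middle_point)
      show "germ (\<lambda>n. (v x n + v y n) div 2)" using fld by (intro germ_half germ_add germ_v)
      show "\<forall>\<^sup>*n. k \<le> (v x n + v y n) div 2" for k
        using middleD(1)[OF xy'(2), of k] middleD(1)[OF xy'(3), of k] by eventually_elim linarith
      show "\<forall>\<^sup>*n. (v x n + v y n) div 2 + k < a n" for k
        using middleD(2)[OF xy'(2), of k] middleD(2)[OF xy'(3), of k] by eventually_elim linarith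
    qed
    then obtain z where z: "z \<in> fst P" "z \<in> middle"
      "\<forall>\<^sup>*n. v z n = (v x n + v y n) div 2" by auto
    have "\<forall>\<^sup>*n. v x n + k < v z n" for k
      using z(3) farD[OF xy'(1) ne, of "2 * k + 2"] by eventually_elim linarith
    note xz = far[OF fld(1) z(1) this]
    have "\<forall>\<^sup>*n. v z n + k < v y n" for k
      using z(3) farD[OF xy'(1) ne, of "2 * k + 2"] by eventually_elim linarith
    note zy = far[OF z(1) fld(2) this]
    show ?thesis using xz zy z(2) xy' by (intro exI[of _ z]) auto
  qed
  show "\<exists>z. (z, x) \<in> snd ?P \<and> block z \<noteq> block x \<and> () = u" if x: "x \<in> fst ?P" for x u
  proof -
    have x': "x \<in> fst P" "x \<in> middle" using x by auto
    have "\<exists>z\<in>fst ?P. \<forall>\<^sup>*n. v z n = v x n div 2"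
    proof (rule middle_point)
      show "germ (\<lambda>n. v x n div 2)" using x' by (intro germ_half germ_v)
      show "\<forall>\<^sup>*n. k \<le> v x n div 2" for k
        using middleD(1)[OF x'(2), of "2 * k"] by eventually_elim linarith
      show "\<forall>\<^sup>*n. v x n div 2 + k < a n" for k
        using middleD(2)[OF x'(2), of k] by eventually_elim linarith
    qed
    then obtain z where z: "z \<in> fst P" "z \<in> middle" "\<forall>\<^sup>*n. v z n = v x n div 2" by auto
    have "\<forall>\<^sup>*n. v z n + k < v x n" for k
      using z(3) middleD(1)[OF x'(2), of "2 * k + 2"] by eventually_elim linarith
    from far[OF z(1) x'(1) this] show ?thesis using z(2) x' by (intro exI[of _ z]) auto
  qed
  show "\<exists>z. (x, z) \<in> snd ?P \<and> block z \<noteq> block x \<and> () = u" if x: "x \<in> fst ?P" for x u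
  proof -
    have x': "x \<in> fst P" "x \<in> middle" using x by auto
    have "\<exists>z\<in>fst ?P. \<forall>\<^sup>*n. v z n = (v x n + a n) div 2"
    proof (rule middle_point)
      show "germ (\<lambda>n. (v x n + a n) div 2)" using x' by (intro germ_half germ_add germ_v germ_a)
      show "\<forall>\<^sup>*n. k \<le> (v x n + a n) div 2" for k
        using unbounded[of "2 * k"] by eventually_elim linarith
      show "\<forall>\<^sup>*n. (v x n + a n) div 2 + k < a n" for k
        using middleD(2)[OF x'(2), of "2 * k + 2"] by eventually_elim linarith
    qed
    then obtain z where z: "z \<in> fst P" "z \<in> middle"
      "\<forall>\<^sup>*n. v z n = (v x n + a n) div 2" by auto
    have "\<forall>\<^sup>*n. v x n + k < v z n" for k
      using z(3) middleD(2)[OF x'(2), of "2 * k + 2"] by eventually_elim linarith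
    from far[OF x'(1) z(1) this] show ?thesis using z(2) x' by (intro exI[of _ z]) auto
  qed
qed simp_all

lemma type_middle: "has_order_type (suborder P middle) (zeta \<odot> eta)"
  by (rule has_order_type_times_eta[OF middle_blocks proper_zeta]) (simp add: type_block)

text \<open>Following the left-nested sum, the points near the top are split off first and the
  middle part is then separated from the standard one.\<close>

theorem has_order_type_alpha: "has_order_type P (omega \<oplus> zeta \<odot> eta \<oplus> reverse_type omega)"
proof (rule has_order_type_plus[OF linear, where U = costandard])
  let ?Q = "suborder P (- costandard)"
  have Q: "linear_ord ?Q" using linear by (rule linear_ord_suborder)
  show "proper (reverse_type omega)" and "proper (omega \<oplus> zeta \<odot> eta)"
    by (intro proper_plus proper_times proper_reverse proper_omega proper_zeta proper_eta)+
  show "has_order_type (suborder P costandard) (reverse_type omega)" by (rule type_costandard)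
  show "(x, y) \<in> snd P" if "x \<in> fst P" "y \<in> fst P" "x \<notin> costandard" and y: "y \<in> costandard" for x y
  proof -
    obtain k where k: "\<forall>\<^sup>*n. a n = v y n + Suc k"
      using y unfolding costandard_def by blast
    have "\<forall>\<^sup>*n. v x n + Suc k < a n"
    proof (cases "x \<in> standard")
      case True
      then obtain i where "\<forall>\<^sup>*n. v x n = i" unfolding standard_def by blast
      with unbounded[of "i + Suc (Suc k)"] show ?thesis by eventually_elim simp
    next
      case False
      then show ?thesis using cases_position that(1,3) middleD(2) by blast
    qed
    with k have "\<forall>\<^sup>*n. v x n < v y n" by eventually_elim simp
    then show ?thesis using less that(1,2) by simp
  qed
  show "has_order_type ?Q (omega \<oplus> zeta \<odot> eta)"
  proof (rule has_order_type_plus[OF Q, where U = middle])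
    show "proper omega" and "proper (zeta \<odot> eta)"
      by (intro proper_times proper_omega proper_zeta proper_eta)+
    have "suborder ?Q middle = suborder P middle"
      unfolding suborder_suborder
      using middle_not_costandard by (intro suborder_cong linear) blast
    then show "has_order_type (suborder ?Q middle) (zeta \<odot> eta)" using type_middle by simp
    have "suborder ?Q (- middle) = suborder P standard"
      unfolding suborder_suborder
      using middle_not_standard standard_not_costandard cases_position
      by (intro suborder_cong linear) blast
    then show "has_order_type (suborder ?Q (- middle)) omega" using type_standard by simp
    show "(x, y) \<in> snd ?Q" if "x \<in> fst ?Q" "y \<in> fst ?Q" "x \<notin> middle" "y \<in> middle" for x y
    proof -
      have "x \<in> standard" using that cases_position by auto
      then obtain i where i: "\<forall>\<^sup>*n. v x n = i" unfolding standard_def by blast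
      from i middleD(1)[OF that(4), of "Suc i"] have "\<forall>\<^sup>*n. v x n < v y n"
        by eventually_elim simp
      with that show ?thesis using less by simp
    qed
  qed
qed

end

section \<open>Cohesive powers as orders of germs\<close>

lemma computable_set_iff: "computable_set A \<longleftrightarrow> decidable (\<lambda>x. x \<in> A)"
  by (simp add: computable_set_def decidable_def)

lemma computable_relation_iff:
  "computable_set (prod_encode ` r) \<longleftrightarrow> decidable (\<lambda>z. (p1 z, p2 z) \<in> r)"
proof -
  have "z \<in> prod_encode ` r \<longleftrightarrow> (p1 z, p2 z) \<in> r" for z
  proof
    assume "(p1 z, p2 z) \<in> r"
    then have "prod_encode (p1 z, p2 z) \<in> prod_encode ` r" by (rule imageI)
    then show "z \<in> prod_encode ` r" by simp
  qed auto
  then show ?thesis unfolding computable_set_iff by simp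
qed

text \<open>A copy of the cohesive power whose points are total functions instead of classes of
  partial ones. For linear \<open>L\<close>, linearity of \<open>P\<close> and \<open>less_P\<close>
  leave one function per class.\<close>

locale germ_power = cohesive_set +
  fixes L :: "nat order" and P :: "(nat \<Rightarrow> nat) order"
  assumes linear_P: "linear_ord P" and countable_P: "countable (fst P)"
    and germ_P: "\<And>g. g \<in> fst P \<Longrightarrow> germ g"
    and carrier_P: "\<And>g. g \<in> fst P \<Longrightarrow> \<forall>\<^sup>*n. g n \<in> fst L"
    and surj_P: "\<And>g. germ g \<Longrightarrow> \<forall>\<^sup>*n. g n \<in> fst L \<Longrightarrow>
      \<exists>h\<in>fst P. \<forall>\<^sup>*n. h n = g n"
    and less_P: "\<And>g h. g \<in> fst P \<Longrightarrow> h \<in> fst P \<Longrightarrow>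
      (g, h) \<in> snd P \<longleftrightarrow> (\<forall>\<^sup>*n. (g n, h n) \<in> snd L)"

context cohesive_set
begin

text \<open>The delicate point is totality. Equality and the order of \<open>L\<close> are
  decidable, so for two germs one of the three possible comparisons holds almost everywhere on
  C.\<close>

lemma cohesive_power_germs:
  assumes "computable_linear_order L"
  shows "\<exists>P. order_iso (cohesive_power C L) P \<and> germ_power C L P"
proof -
  have lin: "linear_ord L" and dec: "decidable (\<lambda>x. x \<in> fst L)" "decidable (\<lambda>z. (p1 z, p2 z) \<in> snd L)"
    using assms unfolding computable_linear_order_def
    by (simp_all only: computable_relation_iff) (simp_all only: computable_set_iff)
  \<comment> \<open>For members of the power the default 0 concerns only finitely many elements of
    C.\<close>
  define V :: "(nat \<Rightarrow> nat option) \<Rightarrow> nat \<Rightarrow> nat" where "V \<phi> n = (case \<phi> n of Some a \<Rightarrow> a | None \<Rightarrow> 0)" for \<phi> n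
  let ?F = "power_funs C L" and ?E = "power_eq C L"
  have V: "\<forall>\<^sup>*n. \<phi> n = Some (V \<phi> n) \<and> V \<phi> n \<in> fst L" if "\<phi> \<in> ?F" for \<phi>
  proof -
    have "\<forall>\<^sup>*n. n \<in> dom \<phi>" and ran: "ran \<phi> \<subseteq> fst L"
      using that by (simp_all add: power_funs_def almost_subset_iff)
    from this(1) show ?thesis
    proof eventually_elim
      case (elim n)
      then obtain a where "\<phi> n = Some a" by blast
      moreover from this have "a \<in> fst L" using ran by (auto intro: ranI)
      ultimately show ?case by (simp add: V_def)
    qed
  qed
  have E: "(\<phi>, \<psi>) \<in> ?E \<longleftrightarrow> (\<forall>\<^sup>*n. V \<phi> n = V \<psi> n)" if "\<phi> \<in> ?F" "\<psi> \<in> ?F" for \<phi> \<psi>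
  proof -
    have "(\<forall>\<^sup>*n. \<exists>a. \<phi> n = Some a \<and> \<psi> n = Some a) \<longleftrightarrow> (\<forall>\<^sup>*n. V \<phi> n = V \<psi> n)"
      by (rule eventually_cong[OF eventually_conj[OF V[OF that(1)] V[OF that(2)]]]) auto
    then show ?thesis using that by (simp add: power_eq_def almost_subset_iff)
  qed
  have equiv: "equiv ?F ?E"
  proof (rule equivI)
    show "?E \<subseteq> ?F \<times> ?F" by (auto simp: power_eq_def)
    show "refl_on ?F ?E" unfolding refl_on_def using E by auto
    show "sym ?E"
    proof (rule symI)
      fix \<phi> \<psi> assume *: "(\<phi>, \<psi>) \<in> ?E"
      then have "\<phi> \<in> ?F" "\<psi> \<in> ?F" by (auto simp: power_eq_def)
      with * show "(\<psi>, \<phi>) \<in> ?E" using E by (auto elim: eventually_mono)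
    qed
    show "trans ?E"
    proof (rule transI)
      fix \<phi> \<psi> \<chi> assume *: "(\<phi>, \<psi>) \<in> ?E" "(\<psi>, \<chi>) \<in> ?E"
      then have F: "\<phi> \<in> ?F" "\<psi> \<in> ?F" "\<chi> \<in> ?F" by (auto simp: power_eq_def)
      have "\<forall>\<^sup>*n. V \<phi> n = V \<psi> n" "\<forall>\<^sup>*n. V \<psi> n = V \<chi> n"
        using * E F by blast+
      then have "\<forall>\<^sup>*n. V \<phi> n = V \<chi> n" by eventually_elim simp
      then show "(\<phi>, \<chi>) \<in> ?E" using E F by blast
    qed
  qed
  define r where "r c = V (SOME \<phi>. \<phi> \<in> c)" for c
  have r: "\<forall>\<^sup>*n. r (?E `` {\<phi>}) n = V \<phi> n" if "\<phi> \<in> ?F" for \<phi>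
  proof -
    have "\<phi> \<in> ?E `` {\<phi>}" using equiv_class_self[OF equiv that] .
    then have "(SOME \<psi>. \<psi> \<in> ?E `` {\<phi>}) \<in> ?E `` {\<phi>}"
      by (rule someI[where P = "\<lambda>\<psi>. \<psi> \<in> ?E `` {\<phi>}"])
    then have *: "(\<phi>, SOME \<psi>. \<psi> \<in> ?E `` {\<phi>}) \<in> ?E" by simp
    then have "(SOME \<psi>. \<psi> \<in> ?E `` {\<phi>}) \<in> ?F" by (auto simp: power_eq_def)
    from *[unfolded E[OF that this]] show ?thesis unfolding r_def by eventually_elim simp
  qed
  define R where "R = r ` (?F // ?E)"
  define P where "P = (R, {(g, h). g \<in> R \<and> h \<in> R \<and> (\<forall>\<^sup>*n. (g n, h n) \<in> snd L)})"
  have R: "\<exists>\<phi>\<in>?F. g = r (?E `` {\<phi>}) \<and> (\<forall>\<^sup>*n. \<phi> n = Some (g n) \<and> g n \<in> fst L)" if g: "g \<in> R" for g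
  proof -
    obtain c where c: "c \<in> ?F // ?E" "g = r c" using g unfolding R_def by blast
    obtain \<phi> where "\<phi> \<in> ?F" "c = ?E `` {\<phi>}" using c(1) by (rule quotientE)
    with c(2) have \<phi>: "\<phi> \<in> ?F" "g = r (?E `` {\<phi>})" by simp_all
    from r[OF \<phi>(1)] V[OF \<phi>(1)] have "\<forall>\<^sup>*n. \<phi> n = Some (g n) \<and> g n \<in> fst L"
      unfolding \<phi>(2) by eventually_elim simp
    with \<phi> show ?thesis by blast
  qed
  have germ: "germ g" "\<forall>\<^sup>*n. g n \<in> fst L" if g: "g \<in> R" for g
  proof -
    obtain \<phi> where \<phi>: "\<phi> \<in> ?F" "\<forall>\<^sup>*n. \<phi> n = Some (g n) \<and> g n \<in> fst L"
      using R[OF g] by blast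
    from \<phi>(2) show "\<forall>\<^sup>*n. g n \<in> fst L" by eventually_elim simp
    from \<phi>(2) have "\<forall>\<^sup>*n. \<phi> n = Some (g n)" by eventually_elim simp
    with \<phi>(1) show "germ g" unfolding germ_def power_funs_def by blast
  qed
  have R_eq: "g = h" if gh: "g \<in> R" "h \<in> R" and eq: "\<forall>\<^sup>*n. g n = h n" for g h
  proof -
    obtain \<phi> where \<phi>: "\<phi> \<in> ?F" "g = r (?E `` {\<phi>})" using R[OF gh(1)] by blast
    obtain \<psi> where \<psi>: "\<psi> \<in> ?F" "h = r (?E `` {\<psi>})" using R[OF gh(2)] by blast
    from r[OF \<phi>(1)] r[OF \<psi>(1)] eq have "\<forall>\<^sup>*n. V \<phi> n = V \<psi> n"
      unfolding \<phi>(2) \<psi>(2) by eventually_elim simp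
    then have "(\<phi>, \<psi>) \<in> ?E" using E \<phi>(1) \<psi>(1) by blast
    then show ?thesis unfolding \<phi>(2) \<psi>(2) using equiv_class_eq[OF equiv] by metis
  qed
  have surj: "\<exists>h\<in>R. \<forall>\<^sup>*n. h n = g n" if g: "germ g" "\<forall>\<^sup>*n. g n \<in> fst L" for g
  proof -
    obtain f where f: "partial_computable f" "\<forall>\<^sup>*n. f n = Some (g n)"
      using g(1) unfolding germ_def by blast
    \<comment> \<open>\<open>power_funs\<close> demands values in the carrier everywhere and not
      just almost everywhere. This search filters them: it succeeds, with result \<open>y\<close>,
      exactly when \<open>y\<close> belongs to the carrier.\<close>
    let ?s = "\<lambda>y. if \<exists>t. y \<in> fst L \<and> t = y then Some (LEAST t. y \<in> fst L \<and> t = y) else None"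
    let ?\<phi> = "\<lambda>n. Option.bind (f n) ?s"
    have s: "?s y = (if y \<in> fst L then Some y else None)" for y
      by (auto intro: Least_equality)
    have l: "(LEAST t. t = y) = y" for y :: nat by (rule Least_equality) auto
    have "decidable (\<lambda>z. p1 z \<in> fst L \<and> p2 z = p1 z)"
      by (intro computable_intros decidable_compose[OF dec(1)])
    from partial_computable.comp[OF partial_computable_search[of "\<lambda>y t. y \<in> fst L \<and> t = y", OF this] f(1)]
    have pc: "partial_computable ?\<phi>" .
    from f(2) g(2) have \<phi>: "\<forall>\<^sup>*n. ?\<phi> n = Some (g n)"
      by eventually_elim (simp add: l)
    then have "C \<subseteq>\<^sup>* dom ?\<phi>" unfolding almost_subset_iff by eventually_elim (simp add: domIff)
    moreover have "ran ?\<phi> \<subseteq> fst L"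
      unfolding s by (auto simp: ran_def bind_eq_Some_conv split: if_splits)
    ultimately have F: "?\<phi> \<in> ?F" using pc by (simp add: power_funs_def)
    from r[OF F] \<phi> have "\<forall>\<^sup>*n. r (?E `` {?\<phi>}) n = g n"
      by eventually_elim (simp add: V_def)
    moreover have "r (?E `` {?\<phi>}) \<in> R" unfolding R_def using F by (intro imageI quotientI)
    ultimately show ?thesis by blast
  qed
  have "order_iso (cohesive_power C L) P"
    unfolding order_iso_def
  proof (intro exI[of _ r] conjI ballI)
    have "inj_on r (?F // ?E)"
    proof (rule inj_onI)
      fix c d assume cd: "c \<in> ?F // ?E" "d \<in> ?F // ?E" "r c = r d"
      obtain \<phi> where \<phi>: "\<phi> \<in> ?F" "c = ?E `` {\<phi>}" using cd(1) by (rule quotientE)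
      obtain \<psi> where \<psi>: "\<psi> \<in> ?F" "d = ?E `` {\<psi>}" using cd(2) by (rule quotientE)
      note eq = cd(3)[unfolded \<phi>(2) \<psi>(2)]
      from r[OF \<phi>(1)] r[OF \<psi>(1)] have "\<forall>\<^sup>*n. V \<phi> n = V \<psi> n"
        by eventually_elim (simp add: eq)
      then have "(\<phi>, \<psi>) \<in> ?E" using E \<phi>(1) \<psi>(1) by blast
      then show "c = d" unfolding \<phi>(2) \<psi>(2) using equiv_class_eq[OF equiv] by blast
    qed
    then show "bij_betw r (fst (cohesive_power C L)) (fst P)"
      by (simp add: cohesive_power_def P_def R_def bij_betw_def)
    fix c d assume cd: "c \<in> fst (cohesive_power C L)" "d \<in> fst (cohesive_power C L)"
    then have cd': "c \<in> ?F // ?E" "d \<in> ?F // ?E" by (simp_all add: cohesive_power_def)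
    have less: "(\<forall>\<^sup>*n. \<exists>a b. \<phi> n = Some a \<and> \<psi> n = Some b \<and> (a, b) \<in> snd L) \<longleftrightarrow>
      (\<forall>\<^sup>*n. (r (?E `` {\<phi>}) n, r (?E `` {\<psi>}) n) \<in> snd L)"
      if "\<phi> \<in> ?F" "\<psi> \<in> ?F" for \<phi> \<psi>
    proof (rule eventually_cong)
      from V[OF that(1)] V[OF that(2)] r[OF that(1)] r[OF that(2)]
      show "\<forall>\<^sup>*n. \<phi> n = Some (r (?E `` {\<phi>}) n) \<and> \<psi> n = Some (r (?E `` {\<psi>}) n)"
        by eventually_elim simp
    qed auto
    show "(c, d) \<in> snd (cohesive_power C L) \<longleftrightarrow> (r c, r d) \<in> snd P"
    proof
      assume "(c, d) \<in> snd (cohesive_power C L)"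
      then obtain \<phi> \<psi> where *: "c = ?E `` {\<phi>}" "d = ?E `` {\<psi>}" "\<phi> \<in> ?F" "\<psi> \<in> ?F"
        "C \<subseteq>\<^sup>* {x. \<exists>a b. \<phi> x = Some a \<and> \<psi> x = Some b \<and> (a, b) \<in> snd L}"
        unfolding cohesive_power_def snd_conv mem_Collect_eq prod.inject by (elim exE conjE)
      have "\<forall>\<^sup>*n. (r c n, r d n) \<in> snd L"
        using *(5) less[OF *(3,4)] unfolding *(1,2) almost_subset_iff mem_Collect_eq by simp
      then show "(r c, r d) \<in> snd P" using cd' by (simp add: P_def R_def)
    next
      assume "(r c, r d) \<in> snd P"
      then have l: "\<forall>\<^sup>*n. (r c n, r d n) \<in> snd L" by (simp add: P_def)
      obtain \<phi> where \<phi>: "\<phi> \<in> ?F" "c = ?E `` {\<phi>}" using cd'(1) by (rule quotientE)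
      obtain \<psi> where \<psi>: "\<psi> \<in> ?F" "d = ?E `` {\<psi>}" using cd'(2) by (rule quotientE)
      from l have "\<forall>\<^sup>*n. \<exists>a b. \<phi> n = Some a \<and> \<psi> n = Some b \<and> (a, b) \<in> snd L"
        unfolding less[OF \<phi>(1) \<psi>(1)] \<phi>(2) \<psi>(2) .
      then have "C \<subseteq>\<^sup>* {x. \<exists>a b. \<phi> x = Some a \<and> \<psi> x = Some b \<and> (a, b) \<in> snd L}"
        unfolding almost_subset_iff mem_Collect_eq .
      then show "(c, d) \<in> snd (cohesive_power C L)"
        unfolding cohesive_power_def snd_conv mem_Collect_eq prod.inject
        using \<phi> \<psi> by (intro exI[of _ \<phi>] exI[of _ \<psi>] conjI)
    qed
  qed
  moreover have "germ_power C L P"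
  proof
    show "linear_ord P"
    proof (rule linear_ordI)
      show "g \<in> fst P \<and> h \<in> fst P" if "(g, h) \<in> snd P" for g h
        using that by (simp add: P_def)
      show "(g, k) \<in> snd P" if "(g, h) \<in> snd P" "(h, k) \<in> snd P" for g h k
      proof -
        have "\<forall>\<^sup>*n. (g n, h n) \<in> snd L" "\<forall>\<^sup>*n. (h n, k n) \<in> snd L"
          using that by (simp_all add: P_def)
        then have "\<forall>\<^sup>*n. (g n, k n) \<in> snd L"
          by eventually_elim (rule linear_ord_trans[OF lin])
        with that show ?thesis by (simp add: P_def)
      qed
      show "(g, g) \<notin> snd P" for g
        using linear_ord_irrefl[OF lin] by (simp add: P_def)
      show "(g, h) \<in> snd P \<or> (h, g) \<in> snd P" if "g \<in> fst P" "h \<in> fst P" "g \<noteq> h" for g h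
      proof -
        have gh: "g \<in> R" "h \<in> R" using that by (simp_all add: P_def)
        have "(\<forall>\<^sup>*n. g n = h n) \<or> (\<forall>\<^sup>*n. g n \<noteq> h n)"
          by (rule germ_decide2[of "\<lambda>a b. a = b"], intro computable_intros) (use gh germ in blast)+
        then have ne: "\<forall>\<^sup>*n. g n \<noteq> h n" using R_eq[OF gh] that(3) by blast
        have "(\<forall>\<^sup>*n. (g n, h n) \<in> snd L) \<or> (\<forall>\<^sup>*n. (g n, h n) \<notin> snd L)"
          using dec(2) germ(1)[OF gh(1)] germ(1)[OF gh(2)] by (rule germ_decide2)
        then show ?thesis
        proof
          assume "\<forall>\<^sup>*n. (g n, h n) \<in> snd L"
          with gh show ?thesis by (simp add: P_def)
        next
          assume "\<forall>\<^sup>*n. (g n, h n) \<notin> snd L"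
          with ne germ(2)[OF gh(1)] germ(2)[OF gh(2)] have "\<forall>\<^sup>*n. (h n, g n) \<in> snd L"
            by eventually_elim (use linear_ord_total[OF lin] in blast)
          with gh show ?thesis by (simp add: P_def)
        qed
      qed
    qed
    have "?F \<subseteq> {f. partial_computable f}" by (auto simp: power_funs_def)
    then have "countable ?F" by (rule countable_subset[OF _ countable_partial_computable])
    then have "countable (?F // ?E)" unfolding quotient_def by auto
    then show "countable (fst P)" by (simp add: P_def R_def)
    show "germ g" "\<forall>\<^sup>*n. g n \<in> fst L" if "g \<in> fst P" for g
      using germ that by (simp_all add: P_def)
    show "\<exists>h\<in>fst P. \<forall>\<^sup>*n. h n = g n"
      if "germ g" "\<forall>\<^sup>*n. g n \<in> fst L" for g
      using surj[OF that] by (simp add: P_def)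
    show "(g, h) \<in> snd P \<longleftrightarrow> (\<forall>\<^sup>*n. (g n, h n) \<in> snd L)"
      if "g \<in> fst P" "h \<in> fst P" for g h
      using that by (simp add: P_def)
  qed
  ultimately show ?thesis by blast
qed

end

section \<open>The order\<close>

text \<open>
  A label is a halting computation \<open>(e, n, (y, D))\<close> whose output codes \<open>y = (m, h, c, w)\<close>: program \<open>e\<close>
  on input \<open>n\<close> requests a point of color \<open>c\<close> in the dyadic interval \<open>(m/2^h, (m+1)/2^h)\<close>;
  \<open>w\<close> is a stage of the enumeration of the complement of \<open>C\<close>.
\<close>

definition numer :: "nat \<Rightarrow> nat" where "numer s = p1 (p1 (p2 (p2 s)))"
definition expo :: "nat \<Rightarrow> nat" where "expo s = p1 (p2 (p1 (p2 (p2 s))))"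
definition tint :: "nat \<Rightarrow> nat" where "tint s = p1 (p2 (p2 (p1 (p2 (p2 s)))))"
definition stage :: "nat \<Rightarrow> nat" where "stage s = p2 (p2 (p2 (p1 (p2 (p2 s)))))"
definition level :: "nat \<Rightarrow> nat" where "level s = numer s div 2 ^ expo s"

text \<open>
  This is \<open>(numer s + 1/3^(s+1)) / 2^(expo s)\<close>: its 3-adic valuation recovers \<open>s\<close>, so distinct labels
  have distinct positions.
\<close>

definition position :: "nat \<Rightarrow> rat" where
  "position s = of_nat (numer s * 3 ^ Suc s + 1) / of_nat (2 ^ expo s * 3 ^ Suc s)"

lemma computable_label [computable_intros]:
  assumes "computable f"
  shows "computable (\<lambda>x. numer (f x))" "computable (\<lambda>x. expo (f x))" "computable (\<lambda>x. tint (f x))"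
    "computable (\<lambda>x. stage (f x))" "computable (\<lambda>x. level (f x))"
  unfolding level_def numer_def expo_def tint_def stage_def by (intro computable_intros assms)+

text \<open>Cross-multiplication turns comparisons of positions into inequalities between naturals,
  which are decidable.\<close>

lemma of_nat_frac_less_iff:
  assumes "0 < b" "0 < d"
  shows "(of_nat a / of_nat b :: rat) < of_nat c / of_nat d \<longleftrightarrow> a * d < c * b"
proof -
  have "(of_nat a / of_nat b :: rat) < of_nat c / of_nat d \<longleftrightarrow> (of_nat a * of_nat d :: rat) < of_nat c * of_nat b"
    using assms by (simp add: field_simps)
  also have "\<dots> \<longleftrightarrow> a * d < c * b" unfolding of_nat_mult[symmetric] by (rule of_nat_less_iff)
  finally show ?thesis .
qed

lemma position_less_iff:
  "position s < position t \<longleftrightarrow>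
    (numer s * 3 ^ Suc s + 1) * (2 ^ expo t * 3 ^ Suc t) < (numer t * 3 ^ Suc t + 1) * (2 ^ expo s * 3 ^ Suc s)"
  unfolding position_def by (rule of_nat_frac_less_iff) simp_all

lemma position_less_dyadic:
  "position s < of_nat m / of_nat (2 ^ h) \<longleftrightarrow> (numer s * 3 ^ Suc s + 1) * 2 ^ h < m * (2 ^ expo s * 3 ^ Suc s)"
  "of_nat m / of_nat (2 ^ h) < position s \<longleftrightarrow> m * (2 ^ expo s * 3 ^ Suc s) < (numer s * 3 ^ Suc s + 1) * 2 ^ h"
  unfolding position_def by (rule of_nat_frac_less_iff; simp)+

text \<open>The added fraction \<open>1/3^(s+1)\<close> lies strictly between 0 and 1, so it keeps
  the point inside the requested interval.\<close>

lemma position_interval: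
  "of_nat (numer s) / of_nat (2 ^ expo s) < position s"
  "position s < of_nat (numer s + 1) / of_nat (2 ^ expo s)"
proof -
  show "of_nat (numer s) / of_nat (2 ^ expo s) < position s"
    unfolding position_less_dyadic by (simp add: algebra_simps)
  have "(numer s * 3 ^ Suc s + 1) * 2 ^ expo s < ((numer s + 1) * 3 ^ Suc s) * 2 ^ expo s"
    using one_less_power[of "3::nat" "Suc s"] by (intro mult_strict_right_mono) simp_all
  then show "position s < of_nat (numer s + 1) / of_nat (2 ^ expo s)"
    unfolding position_less_dyadic by (simp only: ac_simps)
qed

text \<open>Together with \<open>position_less_level\<close>, this makes \<open>level s\<close> the
  integer part of the position, with both bounds strict; levels therefore sort the blocks.\<close>

lemma level_le_position: "of_nat (level s) < position s"
proof -
  have "level s * 2 ^ expo s \<le> numer s" unfolding level_def by (rule div_times_less_eq_dividend)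
  then have "level s * 2 ^ expo s * 3 ^ Suc s \<le> numer s * 3 ^ Suc s" by (rule mult_right_mono) simp
  then have "level s * (2 ^ expo s * 3 ^ Suc s) < (numer s * 3 ^ Suc s + 1) * 2 ^ 0"
    unfolding power_0 mult_1_right mult.assoc by linarith
  then have "of_nat (level s) / of_nat (2 ^ 0) < position s" unfolding position_less_dyadic .
  then show ?thesis by simp
qed

lemma position_less_level: "position s < of_nat (level s + 1)"
proof -
  have "numer s < (level s + 1) * 2 ^ expo s"
    unfolding level_def using dividend_less_div_times[of "2 ^ expo s" "numer s"] by simp
  then have "Suc (numer s) \<le> (level s + 1) * 2 ^ expo s" by (rule Suc_leI)
  then have "Suc (numer s) * 3 ^ Suc s \<le> (level s + 1) * 2 ^ expo s * 3 ^ Suc s" by (rule mult_right_mono) simp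
  moreover have "numer s * 3 ^ Suc s + 1 < Suc (numer s) * 3 ^ Suc s"
    using one_less_power[of "3::nat" "Suc s"] by simp
  ultimately have "(numer s * 3 ^ Suc s + 1) * 2 ^ 0 < (level s + 1) * (2 ^ expo s * 3 ^ Suc s)"
    by (simp only: ac_simps power_0 mult_1)
  then have "position s < of_nat (level s + 1) / of_nat (2 ^ 0)" unfolding position_less_dyadic .
  then show ?thesis by simp
qed

lemma level_less_imp: "level s < level t \<Longrightarrow> position s < position t"
proof -
  assume "level s < level t"
  then have "(of_nat (level s + 1) :: rat) \<le> of_nat (level t)" by (subst of_nat_le_iff) simp
  with position_less_level[of s] level_le_position[of t] show ?thesis by linarith
qed

lemma level_mono: "position s < position t \<Longrightarrow> level s \<le> level t"
  using level_less_imp[of t s] by (meson leI less_asym)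

text \<open>For \<open>s < t\<close>, clearing denominators leaves a factor 3 on one side, whereas
  the other is \<open>numer t * 3 ^ Suc t + 1\<close> times a power of 2 and so prime to 3.\<close>

lemma position_inj:
  assumes "position s = position t" shows "s = t"
proof -
  have False if "position s = position t" "s < t" for s t
  proof -
    let ?a = "numer s * 3 ^ Suc s + 1" and ?b = "numer t * 3 ^ Suc t + 1"
    have "\<not> position s < position t" "\<not> position t < position s" using that(1) by simp_all
    then have "?a * (2 ^ expo t * 3 ^ Suc t) = ?b * (2 ^ expo s * 3 ^ Suc s)"
      unfolding position_less_iff by linarith
    moreover have "3 ^ Suc t = 3 ^ (t - s) * (3 ^ Suc s :: nat)"
      using that(2) by (simp add: power_add[symmetric] power_Suc[symmetric] del: power_Suc)
    ultimately have "(?a * 2 ^ expo t * 3 ^ (t - s)) * 3 ^ Suc s = (?b * 2 ^ expo s) * 3 ^ Suc s"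
      by (simp only: ac_simps)
    then have eq: "?a * 2 ^ expo t * 3 ^ (t - s) = ?b * 2 ^ expo s"
      by (rule mult_right_cancel[THEN iffD1, rotated]) simp
    have "3 dvd (3 ^ (t - s) :: nat)" using that(2) by (simp add: dvd_power)
    then have "3 dvd ?b * 2 ^ expo s" unfolding eq[symmetric] by (rule dvd_mult)
    moreover have "coprime (3::nat) 2" by (simp add: coprime_iff_gcd_eq_1 gcd_nat.simps[of 3 2])
    then have "coprime (3::nat) (2 ^ expo s)" by simp
    ultimately have "3 dvd ?b" by (simp only: coprime_dvd_mult_left_iff)
    moreover have "3 dvd numer t * 3 ^ Suc t" by simp
    ultimately have "(3::nat) dvd 1" by (simp only: dvd_add_right_iff)
    then show False by simp
  qed
  then show ?thesis using assms by (metis linorder_neqE_nat)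
qed

lemma dyadic_between:
  assumes "position s < position t"
  shows "\<exists>m h. position s < of_nat m / of_nat (2 ^ h) \<and> of_nat (m + 1) / of_nat (2 ^ h) < position t"
proof -
  have pos: "0 \<le> position s" by (simp add: position_def)
  \<comment> \<open>At scale \<open>2^h\<close> the gap will exceed 2: at most one unit to reach a
    grid point beyond the first position, and one for the interval itself.\<close>
  obtain h :: nat where h: "2 / (position t - position s) < of_nat h" using reals_Archimedean2 by blast
  have "(of_nat h :: rat) < 2 ^ h" using of_nat_less_two_power by blast
  with h have "2 / (position t - position s) < 2 ^ h" by linarith
  then have gap: "position s * 2 ^ h + 2 < position t * 2 ^ h"
    using assms by (simp add: field_simps)
  define m where "m = nat \<lfloor>position s * 2 ^ h\<rfloor> + 1"
  have "0 \<le> position s * 2 ^ h" using pos by simp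
  then have "(of_nat m :: rat) = of_int \<lfloor>position s * 2 ^ h\<rfloor> + 1" by (simp add: m_def)
  then have "position s * 2 ^ h < of_nat m" "of_nat m \<le> position s * 2 ^ h + 1" by linarith+
  with gap show ?thesis by (intro exI[of _ m] exI[of _ h]) (simp add: field_simps)
qed

section \<open>Granted requests and the computable order of type omega\<close>

context co_ce_cohesive_set
begin

text \<open>The label itself contains the halting computation and, in its output, the stage.
  Quantifying over them instead would make the set of granted labels c.e. only.\<close>

definition active :: "nat \<Rightarrow> bool" where
  "active s \<longleftrightarrow> halts (p1 s) (p1 (p2 s)) (p2 (p2 s)) \<and>
     p1 s \<le> count (stage s) (p1 (p2 s)) \<and> count (stage s) (p1 (p2 s)) \<le> 2 * level s"

text \<open>A point is a label paired with a place in its block. Places run from 0 to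
  \<open>tint\<close>, so a block has \<open>tint + 1\<close> points and is never empty.\<close>

definition M :: "nat order" where
  "M = ({z. active (p1 z) \<and> p2 z \<le> tint (p1 z)},
     {(z, z'). active (p1 z) \<and> p2 z \<le> tint (p1 z) \<and> active (p1 z') \<and> p2 z' \<le> tint (p1 z') \<and>
       (position (p1 z) < position (p1 z') \<or> p1 z = p1 z' \<and> p2 z < p2 z')})"

lemma mem_M: "z \<in> fst M \<longleftrightarrow> active (p1 z) \<and> p2 z \<le> tint (p1 z)"
  by (simp add: M_def)

lemma less_M: "(z, z') \<in> snd M \<longleftrightarrow> z \<in> fst M \<and> z' \<in> fst M \<and>
    (position (p1 z) < position (p1 z') \<or> p1 z = p1 z' \<and> p2 z < p2 z')"
  by (auto simp: M_def)

lemma decidable_active: "computable f \<Longrightarrow> decidable (\<lambda>x. active (f x))"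
  unfolding active_def by (intro computable_intros computable_count)

lemma linear_ord_M: "linear_ord M"
proof (rule linear_ordI)
  show "z \<in> fst M \<and> z' \<in> fst M" if "(z, z') \<in> snd M" for z z'
    using that by (simp add: less_M)
  show "(x, z) \<in> snd M" if "(x, y) \<in> snd M" "(y, z) \<in> snd M" for x y z
    using that unfolding less_M by (elim conjE disjE) auto
  show "(z, z) \<notin> snd M" for z by (simp add: less_M)
  show "(z, z') \<in> snd M \<or> (z', z) \<in> snd M" if "z \<in> fst M" "z' \<in> fst M" "z \<noteq> z'" for z z'
  proof (cases "p1 z = p1 z'")
    case True
    then have "p2 z \<noteq> p2 z'" using that(3) prod_decode_eq by (metis prod.collapse)
    with True that show ?thesis unfolding less_M by auto
  next
    case False
    then have "position (p1 z) \<noteq> position (p1 z')" using position_inj by blast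
    with that show ?thesis unfolding less_M by auto
  qed
qed

lemma computable_M: "computable_linear_order M"
proof -
  have 1: "decidable (\<lambda>z. z \<in> fst M)"
    unfolding mem_M by (intro computable_intros decidable_active)
  have 2: "decidable (\<lambda>z. (p1 z, p2 z) \<in> snd M)"
    unfolding less_M position_less_iff by (intro computable_intros decidable_compose[OF 1])
  show ?thesis
    unfolding computable_linear_order_def
    using linear_ord_M 1[folded computable_set_iff] 2[folded computable_relation_iff] by blast
qed

text \<open>The grant condition bounds the program by \<open>2 * r\<close>. It bounds the input too,
  since \<open>count\<close> is at every stage at least the true number of elements of C. Uniqueness
  of halting computations leaves one label per program and input.\<close>

lemma finite_level: "finite {s. active s \<and> level s \<le> r}"
proof -
  obtain N where N: "\<And>n. N \<le> n \<Longrightarrow> Suc (2 * r) \<le> card (C \<inter> {..<n})"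
    using card_C_unbounded by blast
  let ?f = "\<lambda>s. (p1 s, p1 (p2 s))" and ?S = "{s. active s \<and> level s \<le> r}"
  have "?f ` ?S \<subseteq> {..2 * r} \<times> {..<N}"
  proof
    fix z assume "z \<in> ?f ` ?S"
    then obtain s where s: "active s" "level s \<le> r" "z = ?f s" by blast
    then have "p1 s \<le> 2 * r" "count (stage s) (p1 (p2 s)) \<le> 2 * r" unfolding active_def by linarith+
    moreover from this(2) count_ge[of "p1 (p2 s)" "stage s"] have "p1 (p2 s) < N"
      using N[of "p1 (p2 s)"] by linarith
    ultimately show "z \<in> {..2 * r} \<times> {..<N}" using s(3) by simp
  qed
  then have "finite (?f ` ?S)" by (rule finite_subset) simp
  moreover have "inj_on ?f ?S"
  proof (rule inj_onI)
    fix s t assume st: "s \<in> ?S" "t \<in> ?S" "?f s = ?f t"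
    then have "halts (p1 t) (p1 (p2 t)) (p2 (p2 s))" "halts (p1 t) (p1 (p2 t)) (p2 (p2 t))"
      by (simp_all add: active_def)
    then have "p2 (p2 s) = p2 (p2 t)" by (rule halts_unique)
    with st(3) have "prod_encode (p1 s, prod_encode (p1 (p2 s), p2 (p2 s))) =
      prod_encode (p1 t, prod_encode (p1 (p2 t), p2 (p2 t)))" by simp
    then show "s = t" by (simp only: prod.collapse prod_decode_inverse)
  qed
  ultimately show ?thesis by (rule finite_imageD)
qed

lemma finite_level_M: "finite {z \<in> fst M. level (p1 z) \<le> r}"
proof (rule finite_subset)
  show "{z \<in> fst M. level (p1 z) \<le> r} \<subseteq>
    prod_encode ` (SIGMA s : {s. active s \<and> level s \<le> r}. {..tint s})"
  proof
    fix z assume z: "z \<in> {z \<in> fst M. level (p1 z) \<le> r}"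
    have "z = prod_encode (p1 z, p2 z)" by simp
    moreover have "(p1 z, p2 z) \<in> (SIGMA s : {s. active s \<and> level s \<le> r}. {..tint s})"
      by (rule SigmaI) (use z in \<open>simp_all add: mem_M\<close>)
    ultimately show "z \<in> prod_encode ` (SIGMA s : {s. active s \<and> level s \<le> r}. {..tint s})"
      by (rule image_eqI)
  qed
  show "finite (prod_encode ` (SIGMA s : {s. active s \<and> level s \<le> r}. {..tint s}))"
    using finite_level by (intro finite_imageI finite_SigmaI) auto
qed

text \<open>The requesting program can wait for the stage \<open>w\<close> provided by the growth lemma.\<close>

lemma active_germ:
  assumes m: "germ m" and h: "germ h" and c: "germ c"
    and unb: "\<forall>k. \<forall>\<^sup>*n. k \<le> m n div 2 ^ h n"
  shows "\<exists>\<theta>. germ \<theta> \<and> (\<forall>\<^sup>*n.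
    active (\<theta> n) \<and> numer (\<theta> n) = m n \<and> expo (\<theta> n) = h n \<and> tint (\<theta> n) = c n)"
proof -
  let ?u = "\<lambda>n. m n div 2 ^ h n"
  have u: "germ ?u"
    by (rule germ_compose2[of "\<lambda>a b. a div 2 ^ b", OF _ m h]) (intro computable_intros)
  define R where "R z w \<longleftrightarrow> count w (p1 z) \<le> 2 * p2 z" for z w
  have "decidable (\<lambda>z. R (p1 z) (p2 z))" unfolding R_def by (intro computable_intros computable_count)
  moreover have "\<forall>\<^sup>*n. \<exists>w. R (prod_encode (n, ?u n)) w"
    using germ_growth[OF u unb] by (simp add: R_def)
  ultimately obtain w where w: "germ w" "\<forall>\<^sup>*n. R (prod_encode (n, ?u n)) (w n)"
    using germ_search[OF _ germ_pair[OF germ_id u]] by blast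
  \<comment> \<open>The stage becomes part of the requested output, from which \<open>active\<close>
    reads it.\<close>
  let ?y = "\<lambda>n. prod_encode (m n, prod_encode (h n, prod_encode (c n, w n)))"
  have y: "germ ?y" by (intro germ_pair m h c w)
  then obtain f where f: "partial_computable f" "\<forall>\<^sup>*n. f n = Some (?y n)"
    unfolding germ_def by blast
  obtain e where e: "\<And>n y. f n = Some y \<longleftrightarrow> (\<exists>Q. halts e n Q \<and> p1 Q = y)"
    using halts_complete[OF f(1)] by blast
  obtain N where N: "\<And>n. N \<le> n \<Longrightarrow> e \<le> card (C \<inter> {..<n})" using card_C_unbounded by blast
  define R' where "R' z s \<longleftrightarrow> active s \<and> p1 (p2 (p2 s)) = p2 z" for z s
  have "decidable (\<lambda>z. R' (p1 z) (p2 z))" unfolding R'_def by (intro computable_intros decidable_active)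
  moreover have "\<forall>\<^sup>*n. \<exists>s. R' (prod_encode (n, ?y n)) s"
    using f(2) w(2) eventually_almost_ge[of N C]
  proof eventually_elim
    case (elim n)
    obtain Q where Q: "halts e n Q" "p1 Q = ?y n" using elim(1) e by blast
    let ?s = "prod_encode (e, prod_encode (n, Q))"
    have "e \<le> count (w n) n" using N[OF elim(3)] count_ge[of n "w n"] by linarith
    moreover have "count (w n) n \<le> 2 * ?u n" using elim(2) by (simp add: R_def)
    ultimately have "active ?s" using Q by (simp add: active_def stage_def level_def numer_def expo_def)
    then show ?case using Q(2) by (intro exI[of _ ?s]) (simp add: R'_def)
  qed
  ultimately obtain \<theta> where \<theta>: "germ \<theta>" "\<forall>\<^sup>*n. R' (prod_encode (n, ?y n)) (\<theta> n)"
    using germ_search[OF _ germ_pair[OF germ_id y]] by blast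
  from \<theta>(2) have "\<forall>\<^sup>*n.
    active (\<theta> n) \<and> numer (\<theta> n) = m n \<and> expo (\<theta> n) = h n \<and> tint (\<theta> n) = c n"
    by eventually_elim (simp add: R'_def numer_def expo_def tint_def)
  with \<theta>(1) show ?thesis by blast
qed

lemma germ_level: "germ g \<Longrightarrow> germ (\<lambda>n. level (p1 (g n)))"
  by (rule germ_compose[of "\<lambda>z. level (p1 z)"]) (intro computable_intros)

text \<open>On input \<open>n\<close> ask for the interval from \<open>n\<close> to
  \<open>n + 1\<close>. The request is granted almost everywhere on C, and a finite carrier would
  make the resulting germ constant.\<close>

lemma infinite_M: "infinite (fst M)"
proof
  assume fin: "finite (fst M)"
  have "\<forall>k. \<forall>\<^sup>*n. k \<le> n div 2 ^ 0" by (simp add: eventually_almost_ge)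
  from active_germ[OF germ_id germ_const germ_const this, of 0]
  obtain \<theta> where \<theta>: "germ \<theta>" "\<forall>\<^sup>*n.
    active (\<theta> n) \<and> numer (\<theta> n) = n \<and> expo (\<theta> n) = 0 \<and> tint (\<theta> n) = 0" by blast
  let ?g = "\<lambda>n. prod_encode (\<theta> n, 0)"
  have g: "germ ?g" by (intro germ_pair \<theta>(1) germ_const)
  from \<theta>(2) have "\<forall>\<^sup>*n. ?g n \<in> fst M" by eventually_elim (simp add: mem_M)
  with germ_finite_range[OF g fin] obtain z where "\<forall>\<^sup>*n. ?g n = z" by blast
  with \<theta>(2) have "\<forall>\<^sup>*n. n = numer (p1 z)" by eventually_elim auto
  then show False using not_const_and_unbounded[of "\<lambda>n. n"] eventually_almost_ge by blast
qed

lemma type_M: "has_order_type M omega"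
proof (rule has_order_type_omega[OF linear_ord_M infinite_M])
  fix z
  have "{y. (y, z) \<in> snd M} \<subseteq> {y \<in> fst M. level (p1 y) \<le> level (p1 z)}"
    using level_mono by (auto simp: less_M)
  then show "finite {y. (y, z) \<in> snd M}" using finite_level_M by (rule finite_subset)
qed

end

abbreviation (input) alpha :: otype where
  "alpha \<equiv> omega \<oplus> zeta \<odot> eta \<oplus> reverse_type omega"

lemma proper_alpha: "proper alpha"
  by (intro proper_plus proper_times proper_reverse proper_omega proper_zeta proper_eta)

section \<open>Blocks in the cohesive power and the final computation of its type\<close>

locale block_power = co_ce_cohesive_set C E + germ_power C "co_ce_cohesive_set.M E" P
  for C :: "nat set" and E :: "nat \<Rightarrow> nat \<Rightarrow> bool" and P :: "(nat \<Rightarrow> nat) order"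
begin

definition standard :: "(nat \<Rightarrow> nat) set" where
  "standard = {g. \<exists>z. \<forall>\<^sup>*n. g n = z}"

definition block :: "(nat \<Rightarrow> nat) \<Rightarrow> (nat \<Rightarrow> nat) set" where
  "block g = {h \<in> fst P. \<forall>\<^sup>*n. p1 (g n) = p1 (h n)}"

text \<open>\<open>Suc\<close> because a block of constant tint \<open>k\<close> has the places 0 to
  \<open>k\<close>. A tint that is not constant is unbounded along C, hence the single remaining
  color.\<close>

definition color :: "(nat \<Rightarrow> nat) \<Rightarrow> otype" where
  "color g = (if \<exists>k. \<forall>\<^sup>*n. tint (p1 (g n)) = k
     then finite_type (Suc (THE k. \<forall>\<^sup>*n. tint (p1 (g n)) = k)) else alpha)"

lemma color_finite:
  assumes "\<forall>\<^sup>*n. tint (p1 (g n)) = k"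
  shows "color g = finite_type (Suc k)"
proof -
  have "(THE k. \<forall>\<^sup>*n. tint (p1 (g n)) = k) = k"
    using assms const_unique[OF _ assms] by (rule the_equality)
  with assms show ?thesis unfolding color_def by auto
qed

lemma color_infinite: "\<nexists>k. \<forall>\<^sup>*n. tint (p1 (g n)) = k \<Longrightarrow> color g = alpha"
  by (simp add: color_def)

lemma block_eq_iff:
  assumes "g \<in> fst P" "h \<in> fst P"
  shows "block g = block h \<longleftrightarrow> (\<forall>\<^sup>*n. p1 (g n) = p1 (h n))"
proof
  assume "block g = block h"
  moreover have "h \<in> block h" using assms(2) by (simp add: block_def)
  ultimately have "h \<in> block g" by simp
  then show "\<forall>\<^sup>*n. p1 (g n) = p1 (h n)" by (simp add: block_def)
next
  assume *: "\<forall>\<^sup>*n. p1 (g n) = p1 (h n)"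
  have "(\<forall>\<^sup>*n. p1 (g n) = p1 (k n)) \<longleftrightarrow> (\<forall>\<^sup>*n. p1 (h n) = p1 (k n))" for k
    by (rule eventually_cong[OF *]) simp
  then show "block g = block h" by (simp add: block_def)
qed

text \<open>A constant level would confine the germ to the finite set of
  \<open>finite_level_M\<close> and so make it constant; by the dichotomy the level is then
  unbounded.\<close>

lemma nonstandard_level:
  assumes "g \<in> fst P" "g \<notin> standard"
  shows "\<forall>\<^sup>*n. k \<le> level (p1 (g n))"
proof -
  have "\<not> (\<forall>\<^sup>*n. level (p1 (g n)) = r)" for r
  proof
    assume "\<forall>\<^sup>*n. level (p1 (g n)) = r"
    with carrier_P[OF assms(1)] have "\<forall>\<^sup>*n. g n \<in> {z \<in> fst M. level (p1 z) \<le> r}"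
      by eventually_elim simp
    from germ_finite_range[OF germ_P[OF assms(1)] finite_level_M this]
    show False using assms(2) unfolding standard_def by blast
  qed
  with germ_const_or_unbounded[OF germ_level[OF germ_P[OF assms(1)]]] show ?thesis by blast
qed

lemma nonstandardI:
  assumes "\<And>k. \<forall>\<^sup>*n. k \<le> level (p1 (g n))"
  shows "g \<notin> standard"
proof
  assume "g \<in> standard"
  then obtain z where "\<forall>\<^sup>*n. g n = z" unfolding standard_def by blast
  then have "\<forall>\<^sup>*n. level (p1 (g n)) = level (p1 z)" by eventually_elim simp
  then show False using not_const_and_unbounded[of "\<lambda>n. level (p1 (g n))"] assms by blast
qed

lemma type_standard: "has_order_type (suborder P standard) omega"
proof -
  have "\<forall>g\<in>fst P \<inter> standard. \<exists>z. \<forall>\<^sup>*n. g n = z" unfolding standard_def by blast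
  from bchoice[OF this] obtain f where
    f: "\<And>g. g \<in> fst P \<Longrightarrow> g \<in> standard \<Longrightarrow> \<forall>\<^sup>*n. g n = f g" by blast
  have "order_iso (suborder P standard) M"
  proof (rule order_isoI[OF linear_ord_suborder[OF linear_P] linear_ord_M, of f])
    show "f ` fst (suborder P standard) = fst M"
    proof
      show "f ` fst (suborder P standard) \<subseteq> fst M"
      proof
        fix z assume "z \<in> f ` fst (suborder P standard)"
        then obtain g where g: "g \<in> fst P" "g \<in> standard" "z = f g" by auto
        from f[OF g(1,2)] carrier_P[OF g(1)] have "\<forall>\<^sup>*n. f g \<in> fst M"
          by eventually_elim simp
        then show "z \<in> fst M" using almost_nontrivial by (simp add: g(3))
      qed
      show "fst M \<subseteq> f ` fst (suborder P standard)"
      proof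
        fix z assume "z \<in> fst M"
        then have "\<forall>\<^sup>*n. z \<in> fst M" by simp
        then obtain g where g: "g \<in> fst P" "\<forall>\<^sup>*n. g n = z"
          using surj_P[OF germ_const] by blast
        then have s: "g \<in> standard" unfolding standard_def by blast
        have "f g = z" using const_unique[OF f[OF g(1) s] g(2)] .
        with g(1) s show "z \<in> f ` fst (suborder P standard)" by auto
      qed
    qed
    show "(f g, f h) \<in> snd M" if "(g, h) \<in> snd (suborder P standard)" for g h
    proof -
      from that have gh: "(g, h) \<in> snd P" "g \<in> standard" "h \<in> standard" by auto
      then have fld: "g \<in> fst P" "h \<in> fst P" using linear_ord_field[OF linear_P gh(1)] by auto
      have "\<forall>\<^sup>*n. (g n, h n) \<in> snd M" using gh(1) less_P[OF fld] by blast
      with f[OF fld(1) gh(2)] f[OF fld(2) gh(3)] have "\<forall>\<^sup>*n. (f g, f h) \<in> snd M"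
        by eventually_elim simp
      then show ?thesis using almost_nontrivial by simp
    qed
  qed
  then show ?thesis using type_M by (rule has_order_type_cong)
qed

abbreviation N :: "(nat \<Rightarrow> nat) order" where
  "N \<equiv> suborder P (- standard)"

lemma lessN:
  assumes "g \<in> fst N" "h \<in> fst N"
  shows "(g, h) \<in> snd N \<longleftrightarrow> (\<forall>\<^sup>*n. (g n, h n) \<in> snd M)"
  using assms less_P by simp

lemma position_lessI:
  assumes "g \<in> fst N" "h \<in> fst N" "\<forall>\<^sup>*n. position (p1 (g n)) < position (p1 (h n))"
  shows "(g, h) \<in> snd N" "block g \<noteq> block h"
proof -
  from assms have "g \<in> fst P" "h \<in> fst P" by auto
  from assms(3) carrier_P[OF this(1)] carrier_P[OF this(2)]
  have "\<forall>\<^sup>*n. (g n, h n) \<in> snd M" by eventually_elim (simp add: less_M)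
  then show "(g, h) \<in> snd N" unfolding lessN[OF assms(1,2)] .
  show "block g \<noteq> block h"
    unfolding block_eq_iff[OF \<open>g \<in> fst P\<close> \<open>h \<in> fst P\<close>] using almost_contr[OF assms(3)] by force
qed

lemma position_lessD:
  assumes "(g, h) \<in> snd N" "block g \<noteq> block h"
  shows "\<forall>\<^sup>*n. position (p1 (g n)) < position (p1 (h n))"
proof -
  have gh: "(g, h) \<in> snd P" using assms(1) by simp
  then have fld: "g \<in> fst P" "h \<in> fst P" using linear_ord_field[OF linear_P] by blast+
  have "decidable (\<lambda>z. p1 (p1 z) = p1 (p2 z))" by (intro computable_intros)
  from germ_decide2[OF this germ_P[OF fld(1)] germ_P[OF fld(2)]]
  have ne: "\<forall>\<^sup>*n. p1 (g n) \<noteq> p1 (h n)" using assms(2) block_eq_iff[OF fld] by blast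
  have "\<forall>\<^sup>*n. (g n, h n) \<in> snd M" using gh less_P[OF fld] by blast
  with ne show ?thesis by eventually_elim (simp add: less_M)
qed

text \<open>Turns a granted request into a point of the power, the first one of its block.
  Unboundedness of \<open>m div 2^h\<close> both secures the grant and makes the point
  nonstandard.\<close>

lemma new_point:
  assumes m: "germ m" "germ h" "germ c" and unb: "\<forall>k. \<forall>\<^sup>*n. k \<le> m n div 2 ^ h n"
  shows "\<exists>z\<in>fst N. (\<forall>\<^sup>*n. of_nat (m n) / of_nat (2 ^ h n) < position (p1 (z n)) \<and>
      position (p1 (z n)) < of_nat (m n + 1) / of_nat (2 ^ h n)) \<and>
    (\<forall>\<^sup>*n. tint (p1 (z n)) = c n)"
proof -
  obtain \<theta> where \<theta>: "germ \<theta>" "\<forall>\<^sup>*n.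
    active (\<theta> n) \<and> numer (\<theta> n) = m n \<and> expo (\<theta> n) = h n \<and> tint (\<theta> n) = c n"
    using active_germ[OF assms] by blast
  have "germ (\<lambda>n. prod_encode (\<theta> n, 0))" by (intro germ_pair \<theta>(1) germ_const)
  moreover from \<theta>(2) have "\<forall>\<^sup>*n. prod_encode (\<theta> n, 0) \<in> fst M"
    by eventually_elim (simp add: mem_M)
  ultimately obtain z where z: "z \<in> fst P" "\<forall>\<^sup>*n. z n = prod_encode (\<theta> n, 0)"
    using surj_P by blast
  have "z \<notin> standard"
  proof (rule nonstandardI)
    fix k
    from z(2) \<theta>(2) spec[OF unb, of k] show "\<forall>\<^sup>*n. k \<le> level (p1 (z n))"
      by eventually_elim (simp add: level_def)
  qed
  moreover from z(2) \<theta>(2) have "\<forall>\<^sup>*n. of_nat (m n) / of_nat (2 ^ h n) < position (p1 (z n)) \<and>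
      position (p1 (z n)) < of_nat (m n + 1) / of_nat (2 ^ h n)"
  proof eventually_elim
    case (elim n)
    then show ?case using position_interval[of "\<theta> n"] by simp
  qed
  moreover from z(2) \<theta>(2) have "\<forall>\<^sup>*n. tint (p1 (z n)) = c n" by eventually_elim simp
  ultimately show ?thesis using z(1) by auto
qed

text \<open>A constant germ realises a finite type. For alpha any unbounded germ would serve; the
  identity is taken.\<close>

lemma color_germ:
  assumes "\<tau> \<in> {finite_type k | k. k \<noteq> 0} \<union> {alpha}"
  shows "\<exists>c. germ c \<and> (\<forall>z. (\<forall>\<^sup>*n. tint (p1 (z n)) = c n) \<longrightarrow> color z = \<tau>)"
  using assms
proof
  assume "\<tau> \<in> {finite_type k | k. k \<noteq> 0}"
  then obtain k where k: "\<tau> = finite_type (Suc k)" by (auto simp: gr0_conv_Suc)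
  show ?thesis by (rule exI[of _ "\<lambda>_. k"]) (simp add: germ_const color_finite k)
next
  assume "\<tau> \<in> {alpha}"
  have "color z = alpha" if z: "\<forall>\<^sup>*n. tint (p1 (z n)) = n" for z
  proof (rule color_infinite, rule notI, elim exE)
    fix k assume "\<forall>\<^sup>*n. tint (p1 (z n)) = k"
    with z have "\<forall>\<^sup>*n. n = k" by eventually_elim simp
    then show False using not_const_and_unbounded[of "\<lambda>n. n"] eventually_almost_ge by blast
  qed
  then show ?thesis using germ_id \<open>\<tau> \<in> {alpha}\<close> by blast
qed

lemma blocks_dense: "dense_blocks N block color ({finite_type k | k. k \<noteq> 0} \<union> {alpha})"
proof
  let ?Y = "{finite_type k | k. k \<noteq> 0} \<union> {alpha}"
  show lin: "linear_ord N" using linear_P by (rule linear_ord_suborder)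
  show "countable (fst N)" using countable_P by simp
  show "(x', y') \<in> snd N"
    if xy: "(x, y) \<in> snd N" and ne: "block x \<noteq> block y" and x': "x' \<in> fst N" and y': "y' \<in> fst N"
      and bx: "block x' = block x" and by': "block y' = block y" for x y x' y'
  proof -
    have "x \<in> fst P" "y \<in> fst P" "x' \<in> fst P" "y' \<in> fst P"
      using x' y' linear_ord_field[OF lin xy] by auto
    then have "\<forall>\<^sup>*n. p1 (x' n) = p1 (x n)" "\<forall>\<^sup>*n. p1 (y' n) = p1 (y n)"
      using bx by' block_eq_iff by blast+
    with position_lessD[OF xy ne]
    have "\<forall>\<^sup>*n. position (p1 (x' n)) < position (p1 (y' n))" by eventually_elim simp
    with x' y' show ?thesis by (rule position_lessI)
  qed
  show "color x \<in> ?Y" for x unfolding color_def by auto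
  show "color x = color y" if "x \<in> fst N" "y \<in> fst N" "block x = block y" for x y
  proof -
    have *: "\<forall>\<^sup>*n. p1 (x n) = p1 (y n)" using that block_eq_iff by simp
    have "(\<forall>\<^sup>*n. tint (p1 (x n)) = k) \<longleftrightarrow> (\<forall>\<^sup>*n. tint (p1 (y n)) = k)" for k
      by (rule eventually_cong[OF *]) simp
    then show ?thesis unfolding color_def by simp
  qed
  have "\<exists>z\<in>fst N. (\<forall>\<^sup>*n. of_nat n / of_nat (2 ^ 0) < position (p1 (z n)) \<and>
      position (p1 (z n)) < of_nat (n + 1) / of_nat (2 ^ 0)) \<and>
    (\<forall>\<^sup>*n. tint (p1 (z n)) = 0)"
    by (rule new_point[OF germ_id germ_const germ_const]) (simp add: eventually_almost_ge)
  then show "fst N \<noteq> {}" by blast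
  show "\<exists>z. (x, z) \<in> snd N \<and> (z, y) \<in> snd N \<and> block z \<noteq> block x \<and> block z \<noteq> block y \<and> color z = \<tau>"
    if xy: "(x, y) \<in> snd N" and ne: "block x \<noteq> block y" and \<tau>: "\<tau> \<in> ?Y" for x y \<tau>
  proof -
    have fld: "x \<in> fst N" "y \<in> fst N" using linear_ord_field[OF lin xy] by auto
    \<comment> \<open>A dyadic interval between the two positions is searched for uniformly in
      \<open>n\<close>; cross-multiplication makes the condition decidable.\<close>
    define R where "R z t \<longleftrightarrow> position (p1 (p1 z)) < of_nat (p1 t) / of_nat (2 ^ p2 t) \<and>
      of_nat (p1 t + 1) / of_nat (2 ^ p2 t) < position (p1 (p2 z))" for z t
    have "decidable (\<lambda>z. R (p1 z) (p2 z))"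
      unfolding R_def position_less_dyadic by (intro computable_intros)
    moreover have "germ (\<lambda>n. prod_encode (x n, y n))" using fld germ_P by (intro germ_pair) auto
    moreover have "\<forall>\<^sup>*n. \<exists>t. R (prod_encode (x n, y n)) t"
      using position_lessD[OF xy ne]
    proof eventually_elim
      case (elim n)
      from dyadic_between[OF elim] obtain m h where
        "position (p1 (x n)) < of_nat m / of_nat (2 ^ h)" "of_nat (m + 1) / of_nat (2 ^ h) < position (p1 (y n))"
        by blast
      then show ?case by (intro exI[of _ "prod_encode (m, h)"]) (simp add: R_def)
    qed
    ultimately obtain t where t: "germ t" "\<forall>\<^sup>*n. R (prod_encode (x n, y n)) (t n)"
      using germ_search by blast
    obtain c where c: "germ c" "\<And>z. \<forall>\<^sup>*n. tint (p1 (z n)) = c n \<Longrightarrow> color z = \<tau>"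
      using color_germ[OF \<tau>] by blast
    have "germ (\<lambda>n. p1 (t n))" "germ (\<lambda>n. p2 (t n))"
      using t(1) by (intro germ_compose[of p1] germ_compose[of p2] computable_intros; assumption)+
    \<comment> \<open>The interval lies to the right of \<open>x\<close>, whose level is unbounded,
      so its own level is unbounded as a grant demands.\<close>
    moreover have "\<forall>k. \<forall>\<^sup>*n. k \<le> p1 (t n) div 2 ^ p2 (t n)"
    proof
      fix k
      have "\<forall>\<^sup>*n. k \<le> level (p1 (x n))" using fld nonstandard_level by simp
      then show "\<forall>\<^sup>*n. k \<le> p1 (t n) div 2 ^ p2 (t n)"
        using t(2)
      proof eventually_elim
        case (elim n)
        have "of_nat (level (p1 (x n))) < (of_nat (p1 (t n)) / of_nat (2 ^ p2 (t n)) :: rat)"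
          using level_le_position[of "p1 (x n)"] elim(2) by (simp add: R_def)
        then have "(of_nat (level (p1 (x n))) / of_nat 1 :: rat) < of_nat (p1 (t n)) / of_nat (2 ^ p2 (t n))"
          by simp
        then have "level (p1 (x n)) * 2 ^ p2 (t n) < p1 (t n) * 1"
          by (subst (asm) of_nat_frac_less_iff) simp_all
        then have "level (p1 (x n)) \<le> p1 (t n) div 2 ^ p2 (t n)"
          by (simp add: less_eq_div_iff_mult_less_eq)
        with elim(1) show ?case by simp
      qed
    qed
    ultimately obtain z where z: "z \<in> fst N" and
      pos: "\<forall>\<^sup>*n. of_nat (p1 (t n)) / of_nat (2 ^ p2 (t n)) < position (p1 (z n)) \<and>
        position (p1 (z n)) < of_nat (p1 (t n) + 1) / of_nat (2 ^ p2 (t n))"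
      and tint: "\<forall>\<^sup>*n. tint (p1 (z n)) = c n"
      using new_point[OF _ _ c(1)] by blast
    from pos t(2) have "\<forall>\<^sup>*n. position (p1 (x n)) < position (p1 (z n))"
      by eventually_elim (simp add: R_def)
    note xz = position_lessI[OF fld(1) z this]
    from pos t(2) have "\<forall>\<^sup>*n. position (p1 (z n)) < position (p1 (y n))"
      by eventually_elim (simp add: R_def)
    note zy = position_lessI[OF z fld(2) this]
    show ?thesis using xz(1) zy(1) xz(2)[symmetric] zy(2) c(2)[OF tint] by blast
  qed
  show "\<exists>z. (z, x) \<in> snd N \<and> block z \<noteq> block x \<and> color z = \<tau>"
    if x: "x \<in> fst N" and \<tau>: "\<tau> \<in> ?Y" for x \<tau>
  proof -
    obtain c where c: "germ c" "\<And>z. \<forall>\<^sup>*n. tint (p1 (z n)) = c n \<Longrightarrow> color z = \<tau>"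
      using color_germ[OF \<tau>] by blast
    have lev: "\<forall>\<^sup>*n. k \<le> level (p1 (x n))" for k using x nonstandard_level by simp
    \<comment> \<open>The unit interval that ends at the level of \<open>x\<close>. This level is
      positive almost everywhere on C, where the subtraction is therefore exact.\<close>
    let ?m = "\<lambda>n. level (p1 (x n)) - 1"
    have m: "germ ?m" using x germ_P by (intro germ_diff germ_level germ_const) simp
    have "\<forall>k. \<forall>\<^sup>*n. k \<le> ?m n div 2 ^ 0"
    proof
      fix k show "\<forall>\<^sup>*n. k \<le> ?m n div 2 ^ 0"
        using lev[of "Suc k"] by eventually_elim simp
    qed
    from new_point[OF m germ_const c(1) this] obtain z where z: "z \<in> fst N"
      "\<forall>\<^sup>*n. of_nat (?m n) / of_nat (2 ^ 0) < position (p1 (z n)) \<and>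
        position (p1 (z n)) < of_nat (?m n + 1) / of_nat (2 ^ 0)"
      "\<forall>\<^sup>*n. tint (p1 (z n)) = c n" by blast
    from z(2) lev[of 1] have "\<forall>\<^sup>*n. position (p1 (z n)) < position (p1 (x n))"
    proof eventually_elim
      case (elim n)
      then have "position (p1 (z n)) < of_nat (level (p1 (x n)))" by simp
      with level_le_position[of "p1 (x n)"] show ?case by linarith
    qed
    from position_lessI[OF z(1) x this] c(2)[OF z(3)] show ?thesis by blast
  qed
  show "\<exists>z. (x, z) \<in> snd N \<and> block z \<noteq> block x \<and> color z = \<tau>"
    if x: "x \<in> fst N" and \<tau>: "\<tau> \<in> ?Y" for x \<tau>
  proof -
    obtain c where c: "germ c" "\<And>z. \<forall>\<^sup>*n. tint (p1 (z n)) = c n \<Longrightarrow> color z = \<tau>"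
      using color_germ[OF \<tau>] by blast
    have lev: "\<forall>\<^sup>*n. k \<le> level (p1 (x n))" for k using x nonstandard_level by simp
    \<comment> \<open>The unit interval that follows the one containing \<open>x\<close>.\<close>
    let ?m = "\<lambda>n. level (p1 (x n)) + 1"
    have m: "germ ?m" using x germ_P by (intro germ_add germ_level germ_const) simp
    have "\<forall>k. \<forall>\<^sup>*n. k \<le> ?m n div 2 ^ 0"
    proof
      fix k show "\<forall>\<^sup>*n. k \<le> ?m n div 2 ^ 0"
        using lev[of k] by eventually_elim simp
    qed
    from new_point[OF m germ_const c(1) this] obtain z where z: "z \<in> fst N"
      "\<forall>\<^sup>*n. of_nat (?m n) / of_nat (2 ^ 0) < position (p1 (z n)) \<and>
        position (p1 (z n)) < of_nat (?m n + 1) / of_nat (2 ^ 0)"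
      "\<forall>\<^sup>*n. tint (p1 (z n)) = c n" by blast
    from z(2) have "\<forall>\<^sup>*n. position (p1 (x n)) < position (p1 (z n))"
    proof eventually_elim
      case (elim n)
      then have "of_nat (level (p1 (x n)) + 1) < position (p1 (z n))" by simp
      with position_less_level[of "p1 (x n)"] show ?case by linarith
    qed
    from position_lessI[OF x z(1) this] c(2)[OF z(3)] show ?thesis by metis
  qed
qed

text \<open>Within a block the label is the same almost everywhere, so points differ only in their
  place, a germ below \<open>Suc (tint ...)\<close>. All such germs occur, and the block is a
  \<open>germ_segment\<close>.\<close>

lemma type_block:
  assumes g: "g \<in> fst N"
  shows "has_order_type (suborder N {h. block h = block g}) (color g)"
proof -
  let ?S = "suborder N {h. block h = block g}"
  have gP: "g \<in> fst P" "g \<notin> standard" using g by auto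
  have S: "h \<in> fst N" "\<forall>\<^sup>*n. p1 (h n) = p1 (g n)" if "h \<in> fst ?S" for h
    using that block_eq_iff[of h g] gP(1) by auto
  interpret seg: germ_segment C ?S "\<lambda>h n. p2 (h n)" "\<lambda>n. Suc (tint (p1 (g n)))"
  proof
    show "linear_ord ?S" by (intro linear_ord_suborder linear_P)
    show "countable (fst ?S)" using countable_P by simp
    show "germ (\<lambda>n. p2 (x n))" if "x \<in> fst ?S" for x
      using that germ_P by (intro germ_compose[of p2] computable_intros) simp
    show "\<forall>\<^sup>*n. p2 (x n) < Suc (tint (p1 (g n)))" if "x \<in> fst ?S" for x
    proof -
      have "x \<in> fst P" using that by simp
      from carrier_P[OF this] S(2)[OF that] show ?thesis by eventually_elim (simp add: mem_M)
    qed
    show "(x, y) \<in> snd ?S \<longleftrightarrow> (\<forall>\<^sup>*n. p2 (x n) < p2 (y n))"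
      if "x \<in> fst ?S" "y \<in> fst ?S" for x y
    proof -
      have xy: "x \<in> fst P" "y \<in> fst P" using that by auto
      have "(x, y) \<in> snd ?S \<longleftrightarrow> (\<forall>\<^sup>*n. (x n, y n) \<in> snd M)"
        using that less_P[OF xy] by simp
      also have "\<dots> \<longleftrightarrow> (\<forall>\<^sup>*n. p2 (x n) < p2 (y n))"
      proof (rule eventually_cong)
        show "\<forall>\<^sup>*n. x n \<in> fst M \<and> y n \<in> fst M \<and> p1 (x n) = p1 (y n)"
          using carrier_P[OF xy(1)] carrier_P[OF xy(2)] S(2)[OF that(1)] S(2)[OF that(2)]
          by eventually_elim simp
      qed (simp add: less_M)
      finally show ?thesis .
    qed
    show "germ (\<lambda>n. Suc (tint (p1 (g n))))"
      by (rule germ_compose[of "\<lambda>z. Suc (tint (p1 z))", OF _ germ_P[OF gP(1)]]) (intro computable_intros)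
    show "\<exists>x\<in>fst ?S. \<forall>\<^sup>*n. p2 (x n) = i n"
      if i: "germ i" "\<forall>\<^sup>*n. i n < Suc (tint (p1 (g n)))" for i
    proof -
      have "germ (\<lambda>n. prod_encode (p1 (g n), i n))"
        using germ_P[OF gP(1)] by (intro germ_pair i(1) germ_compose[of p1] computable_intros)
      moreover from carrier_P[OF gP(1)] i(2)
      have "\<forall>\<^sup>*n. prod_encode (p1 (g n), i n) \<in> fst M"
        by eventually_elim (simp add: mem_M)
      ultimately obtain x where x: "x \<in> fst P" "\<forall>\<^sup>*n. x n = prod_encode (p1 (g n), i n)"
        using surj_P by blast
      from x(2) have p: "\<forall>\<^sup>*n. p1 (x n) = p1 (g n)" by eventually_elim simp
      then have "block x = block g" using block_eq_iff[OF x(1) gP(1)] by blast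
      moreover have "x \<notin> standard"
      proof (rule nonstandardI)
        fix k
        from p nonstandard_level[OF gP, of k] show "\<forall>\<^sup>*n. k \<le> level (p1 (x n))"
          by eventually_elim simp
      qed
      moreover from x(2) have "\<forall>\<^sup>*n. p2 (x n) = i n" by eventually_elim simp
      ultimately show ?thesis using x(1) by auto
    qed
  qed
  show ?thesis
  proof (cases "\<exists>k. \<forall>\<^sup>*n. tint (p1 (g n)) = k")
    case True
    then obtain k where k: "\<forall>\<^sup>*n. tint (p1 (g n)) = k" ..
    then have "\<forall>\<^sup>*n. Suc (tint (p1 (g n))) = Suc k" by eventually_elim simp
    from seg.has_order_type_finite[OF this] show ?thesis unfolding color_finite[OF k] .
  next
    case False
    have "germ (\<lambda>n. tint (p1 (g n)))"
      by (rule germ_compose[of "\<lambda>z. tint (p1 z)", OF _ germ_P[OF gP(1)]]) (intro computable_intros)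
    with False germ_const_or_unbounded have unb: "\<forall>\<^sup>*n. k \<le> tint (p1 (g n))" for k by blast
    interpret seg: long_germ_segment C ?S "\<lambda>h n. p2 (h n)" "\<lambda>n. Suc (tint (p1 (g n)))"
    proof
      show "\<forall>\<^sup>*n. k \<le> Suc (tint (p1 (g n)))" for k
        using unb[of k] by eventually_elim simp
    qed
    from seg.has_order_type_alpha show ?thesis unfolding color_infinite[OF False] .
  qed
qed

text \<open>Nonstandard points have unbounded level and so lie above every constant germ; this cut
  is the outer sum.\<close>

lemma type_power: "has_order_type P (omega \<oplus> shuffle ({finite_type k | k. k \<noteq> 0} \<union> {alpha}))"
proof (rule has_order_type_plus[OF linear_P, where U = "- standard"])
  let ?Y = "{finite_type k | k. k \<noteq> 0} \<union> {alpha}"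
  show "proper omega" by (rule proper_omega)
  have Y: "proper \<tau>" if "\<tau> \<in> ?Y" for \<tau> using that proper_finite_type proper_alpha by auto
  show shuffle: "has_order_type N (shuffle ?Y)"
    using blocks_dense Y type_block by (rule has_order_type_shuffle)
  show "proper (shuffle ?Y)"
    using blocks_dense Y by (rule proper_shuffle)
  show "has_order_type (suborder P (- (- standard))) omega" using type_standard by simp
  show "(x, y) \<in> snd P" if "x \<in> fst P" "y \<in> fst P" and x: "x \<notin> - standard" and y: "y \<in> - standard" for x y
  proof -
    obtain z where z: "\<forall>\<^sup>*n. x n = z" using x unfolding standard_def by blast
    have "\<forall>\<^sup>*n. Suc (level (p1 z)) \<le> level (p1 (y n))"
      using that(2) y by (intro nonstandard_level) auto
    with z carrier_P[OF that(1)] carrier_P[OF that(2)]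
    have "\<forall>\<^sup>*n. (x n, y n) \<in> snd M"
      by eventually_elim (simp add: less_M level_less_imp)
    then show ?thesis using less_P that(1,2) by simp
  qed
qed

end

theorem theorem6p3:
  fixes X :: "otype set" and \<alpha> :: otype and C :: "nat set"
  assumes "X = {finite_type k | k. k \<noteq> 0}"
    and "\<alpha> = omega \<oplus> zeta \<odot> eta \<oplus> reverse_type omega"
    and "cohesive C" and "co_ce C"
  shows "\<exists>M. computable_linear_order M \<and> has_order_type M omega \<and>
    has_order_type (cohesive_power C M) (omega \<oplus> shuffle (X \<union> {\<alpha>}))"
proof -
  obtain \<phi> where \<phi>: "partial_computable \<phi>" "UNIV - C = dom \<phi>"
    using assms(4) unfolding co_ce_def ce_def by blast
  obtain e where e: "\<And>n y. \<phi> n = Some y \<longleftrightarrow> (\<exists>Q. halts e n Q \<and> p1 Q = y)"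
    using halts_complete[OF \<phi>(1)] by blast
  \<comment> \<open>The halting computation on input \<open>m\<close> of a program for the
    complement serves as the stage at which \<open>m\<close> is seen outside C.\<close>
  interpret co_ce_cohesive_set C "halts e"
  proof
    show "cohesive C" by fact
    show "decidable (\<lambda>z. halts e (p1 z) (p2 z))" by (intro computable_intros)
    have "m \<notin> C \<longleftrightarrow> (\<exists>y. \<phi> m = Some y)" for m using \<phi>(2) by (auto simp: set_eq_iff domIff)
    then show "m \<notin> C \<longleftrightarrow> (\<exists>Q. halts e m Q)" for m using e by blast
  qed
  obtain P where P: "order_iso (cohesive_power C M) P" "germ_power C M P"
    using cohesive_power_germs[OF computable_M] by blast
  interpret germ_power C M P by fact
  interpret block_power C "halts e" P ..
  have "has_order_type (cohesive_power C M) (omega \<oplus> shuffle (X \<union> {\<alpha>}))"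
    using P(1) type_power unfolding assms(1,2) by (rule has_order_type_cong)
  with computable_M type_M show ?thesis by blast
qed

end
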